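(* Let $L$ be a restricted Lie algebra over a field $\mathbb{F}$ of characteristic $p>0$, and let $u(L)$ be its restricted enveloping algebra. If $u(L)$ is Lie nilpotent, then $$ p^{e([x,y])}\leq \mathrm{cl}_{Lie}(u(L)) \leq \mathrm{cl}^{Lie}(u(L)) \leq p^{\dim_{\mathbb{F}} L'_p} $$ for every $x,y\in L$.
   Context: $L$ is not assumed finite-dimensional. The $p$-map of $L$ is written $x\mapsto x^{[p]}$, and $x^{[p]^s}$ denotes its $s$-fold iterate applied to $x$ (with $x^{[p]^0}=x$). $L'=[L,L]$ is the derived subalgebra, and $L'_p$ is the restricted subalgebra of $L$ generated by $L'$. An element $x\in L$ is $p$-nilpotent if $x^{[p]^t}=0$ for some non-negative integer $t$; its exponent $e(x)$ is the least non-negative integer $s$ with $x^{[p]^s}=0$. A unital associative algebra $A$ is regarded as a Lie algebra via $[a,b]=ab-ba$. $A$ is Lie nilpotent if it is nilpotent as a Lie algebra, and then $\mathrm{cl}_{Lie}(A)$ denotes its nilpotency class as a Lie algebra (the least $n$ such that the $(n+1)$-st term of the lower central series $\gamma_1(A)=A$, $\gamma_{i+1}(A)=[\gamma_i(A),A]$ is zero). The upper Lie powers of $A$ are the associative ideals defined by $A^{(1)}=A$ and $A^{(i)}=[A^{(i-1)},A]A$, where $[C,D]$ is the linear span of all $[c,d]$, $c\in C$, $d\in D$. $A$ is strongly Lie nilpotent if $A^{(i)}=0$ for some $i$, and then $\mathrm{cl}^{Lie}(A)$ is the least $n$ such that $A^{(n+1)}=0$. All quantities in the claim are well defined by a known theorem: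 $u(L)$ is Lie nilpotent if and only if it is strongly Lie nilpotent, if and only if $L$ is nilpotent and $L'$ is finite-dimensional and $p$-nilpotent (i.e. there is an $n$ such that $x^{[p]^n}=0$ for all $x\in L'$). *)

theory Defs
  imports
    "HOL-Library.Poly_Mapping"
    "HOL-Computational_Algebra.Polynomial"
    "HOL-Algebra.QuotRing"
    "HOL-Algebra.Module"
    "HOL-Algebra.Algebraic_Closure_Type"
begin

section \<open>Restricted Lie algebras\<close>

locale lie_algebra = vector_space scale
  for scale :: "'f::field \<Rightarrow> 'a::ab_group_add \<Rightarrow> 'a" +
  fixes bracket :: "'a \<Rightarrow> 'a \<Rightarrow> 'a"
  assumes bracket_add_left: "bracket (x + y) z = bracket x z + bracket y z"
    and bracket_add_right: "bracket x (y + z) = bracket x y + bracket x z"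
    and bracket_scale_left: "bracket (scale c x) y = scale c (bracket x y)"
    and bracket_scale_right: "bracket x (scale c y) = scale c (bracket x y)"
    and bracket_self: "bracket x x = 0"
    and jacobi: "bracket x (bracket y z) + bracket y (bracket z x) + bracket z (bracket x y) = 0"

text \<open>
  The terms in Jacobson's formula for the \<open>p\<close>-th power of a sum: \<open>i s\<^sub>i(x, y)\<close> is the coefficient of
  \<open>t\<^sup>i\<^sup>-\<^sup>1\<close> in \<open>ad(t x + y)\<^sup>p\<^sup>-\<^sup>1(x)\<close>, computed in \<open>L[t]\<close>. An element of \<open>L[t]\<close> is represented as an
  \<open>'a poly\<close>, and the iterated map below is \<open>ad(t x + y)\<close> on \<open>L[t]\<close>.
\<close>

definition jacobson_s ::
  "('f::field \<Rightarrow> 'a::ab_group_add \<Rightarrow> 'a) \<Rightarrow> ('a \<Rightarrow> 'a \<Rightarrow> 'a) \<Rightarrow> nat \<Rightarrow> nat \<Rightarrow> 'a \<Rightarrow> 'a \<Rightarrow> 'a"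
where
  "jacobson_s scale bracket p i x y =
     scale (inverse (of_nat i))
       (Polynomial.coeff
         (((\<lambda>v. pCons 0 (map_poly (bracket x) v) + map_poly (bracket y) v) ^^ (p - 1)) [:x:])
         (i - 1))"

locale restricted_lie_algebra = lie_algebra scale bracket
  for scale :: "'f::field \<Rightarrow> 'a::ab_group_add \<Rightarrow> 'a" and bracket :: "'a \<Rightarrow> 'a \<Rightarrow> 'a" +
  fixes p :: nat and pmap :: "'a \<Rightarrow> 'a"
  assumes char_eq: "CHAR('f) = p"
    and char_pos: "p > 0"
    and pmap_scale: "pmap (scale c x) = scale (c ^ p) (pmap x)"
    and bracket_pmap: "bracket (pmap x) y = (bracket x ^^ p) y"
    and pmap_add: "pmap (x + y) = pmap x + pmap y + (\<Sum>i=1..p - 1. jacobson_s scale bracket p i x y)"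

definition derived_subalgebra ::
  "('f::field \<Rightarrow> 'a::ab_group_add \<Rightarrow> 'a) \<Rightarrow> ('a \<Rightarrow> 'a \<Rightarrow> 'a) \<Rightarrow> 'a set"
where
  "derived_subalgebra scale bracket = module.span scale {bracket x y |x y. True}"

definition restricted_subalgebra ::
  "('f::field \<Rightarrow> 'a::ab_group_add \<Rightarrow> 'a) \<Rightarrow> ('a \<Rightarrow> 'a \<Rightarrow> 'a) \<Rightarrow> ('a \<Rightarrow> 'a) \<Rightarrow> 'a set \<Rightarrow> bool"
where
  "restricted_subalgebra scale bracket pmap H \<longleftrightarrow>
     module.subspace scale H \<and> (\<forall>x\<in>H. \<forall>y\<in>H. bracket x y \<in> H) \<and> (\<forall>x\<in>H. pmap x \<in> H)"

definition generated_restricted_subalgebra ::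
  "('f::field \<Rightarrow> 'a::ab_group_add \<Rightarrow> 'a) \<Rightarrow> ('a \<Rightarrow> 'a \<Rightarrow> 'a) \<Rightarrow> ('a \<Rightarrow> 'a) \<Rightarrow> 'a set \<Rightarrow> 'a set"
where
  "generated_restricted_subalgebra scale bracket pmap S =
     \<Inter>{H. restricted_subalgebra scale bracket pmap H \<and> S \<subseteq> H}"

definition p_exponent :: "('a::zero \<Rightarrow> 'a) \<Rightarrow> 'a \<Rightarrow> nat" where
  "p_exponent pmap x = (LEAST s. (pmap ^^ s) x = 0)"


section \<open>The restricted enveloping algebra\<close>

text \<open>
  The free monoid is written additively, as required for monoid algebras built with
  \<open>poly_mapping\<close>. Hence \<open>'a free_mon \<Rightarrow>\<^sub>0 'f\<close> is the free unital associative \<open>'f\<close>-algebra on the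
  set \<open>'a\<close>, with the scalar \<open>c\<close> embedded as \<open>Poly_Mapping.single 0 c\<close>.
\<close>

datatype 'a free_mon = Free_Mon "'a list"

instantiation free_mon :: (type) monoid_add
begin

definition zero_free_mon :: "'a free_mon" where
  "zero_free_mon = Free_Mon []"

fun plus_free_mon :: "'a free_mon \<Rightarrow> 'a free_mon \<Rightarrow> 'a free_mon" where
  "plus_free_mon (Free_Mon u) (Free_Mon v) = Free_Mon (u @ v)"

instance
proof
  fix a b c :: "'a free_mon"
  show "a + b + c = a + (b + c)"
    by (cases a; cases b; cases c) simp
  show "0 + a = a" and "a + 0 = a"
    by (cases a; simp add: zero_free_mon_def)+
qed

end

definition free_gen :: "'a \<Rightarrow> 'a free_mon \<Rightarrow>\<^sub>0 'f::field" where
  "free_gen x = Poly_Mapping.single (Free_Mon [x]) 1"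

text \<open>
  The first two families of relators turn the free algebra on the set \<open>L\<close> into the tensor algebra
  of the vector space \<open>L\<close>.
\<close>

definition restricted_relators ::
  "('f::field \<Rightarrow> 'a::ab_group_add \<Rightarrow> 'a) \<Rightarrow> ('a \<Rightarrow> 'a \<Rightarrow> 'a) \<Rightarrow> nat \<Rightarrow> ('a \<Rightarrow> 'a)
    \<Rightarrow> ('a free_mon \<Rightarrow>\<^sub>0 'f) set"
where
  "restricted_relators scale bracket p pmap =
     {free_gen (x + y) - (free_gen x + free_gen y) |x y. True} \<union>
     {free_gen (scale c x) - Poly_Mapping.single 0 c * free_gen x |c x. True} \<union>
     {free_gen (bracket x y) - (free_gen x * free_gen y - free_gen y * free_gen x) |x y. True} \<union>
     {free_gen (pmap x) - free_gen x ^ p |x. True}"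

text \<open>The HOL-Algebra record type \<open>module\<close> serves here as the signature of an associative algebra.\<close>

definition restricted_env_alg ::
  "('f::field \<Rightarrow> 'a::ab_group_add \<Rightarrow> 'a) \<Rightarrow> ('a \<Rightarrow> 'a \<Rightarrow> 'a) \<Rightarrow> nat \<Rightarrow> ('a \<Rightarrow> 'a)
    \<Rightarrow> ('f, ('a free_mon \<Rightarrow>\<^sub>0 'f) set) module"
where
  "restricted_env_alg scale bracket p pmap =
     (let R = (ring_of_type_algebra :: ('a free_mon \<Rightarrow>\<^sub>0 'f) ring);
          J = Idl\<^bsub>R\<^esub> (restricted_relators scale bracket p pmap)
      in ring.extend (R Quot J)
           (module.fields (\<lambda>c C. \<Union>a\<in>C. J +>\<^bsub>R\<^esub> (Poly_Mapping.single 0 c * a))))"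


section \<open>Lie nilpotency of associative algebras\<close>

definition alg_commutator :: "('f, 'b) module \<Rightarrow> 'b \<Rightarrow> 'b \<Rightarrow> 'b" where
  "alg_commutator A a b = a \<otimes>\<^bsub>A\<^esub> b \<ominus>\<^bsub>A\<^esub> b \<otimes>\<^bsub>A\<^esub> a"

inductive_set alg_span :: "('f, 'b) module \<Rightarrow> 'b set \<Rightarrow> 'b set"
  for A :: "('f, 'b) module" and S :: "'b set"
where
  zero: "\<zero>\<^bsub>A\<^esub> \<in> alg_span A S"
| add_scaled: "s \<in> S \<Longrightarrow> v \<in> alg_span A S \<Longrightarrow> c \<odot>\<^bsub>A\<^esub> s \<oplus>\<^bsub>A\<^esub> v \<in> alg_span A S"

definition commutator_space :: "('f, 'b) module \<Rightarrow> 'b set \<Rightarrow> 'b set \<Rightarrow> 'b set" where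
  "commutator_space A C D = alg_span A {alg_commutator A c d |c d. c \<in> C \<and> d \<in> D}"

definition product_space :: "('f, 'b) module \<Rightarrow> 'b set \<Rightarrow> 'b set \<Rightarrow> 'b set" where
  "product_space A C D = alg_span A {c \<otimes>\<^bsub>A\<^esub> d |c d. c \<in> C \<and> d \<in> D}"

text \<open>
  Both series are indexed from \<open>0\<close>: \<open>lower_central A n\<close> is \<open>\<gamma>\<^sub>n\<^sub>+\<^sub>1(A)\<close> and \<open>upper_lie_power A n\<close>
  is \<open>A\<^sup>(\<^sup>n\<^sup>+\<^sup>1\<^sup>)\<close>.
\<close>

primrec lower_central :: "('f, 'b) module \<Rightarrow> nat \<Rightarrow> 'b set" where
  "lower_central A 0 = carrier A"
| "lower_central A (Suc n) = commutator_space A (lower_central A n) (carrier A)"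

primrec upper_lie_power :: "('f, 'b) module \<Rightarrow> nat \<Rightarrow> 'b set" where
  "upper_lie_power A 0 = carrier A"
| "upper_lie_power A (Suc n) =
     product_space A (commutator_space A (upper_lie_power A n) (carrier A)) (carrier A)"

definition lie_nilpotent :: "('f, 'b) module \<Rightarrow> bool" where
  "lie_nilpotent A \<longleftrightarrow> (\<exists>n. lower_central A n = {\<zero>\<^bsub>A\<^esub>})"

definition lie_class :: "('f, 'b) module \<Rightarrow> nat" where
  "lie_class A = (LEAST n. lower_central A n = {\<zero>\<^bsub>A\<^esub>})"

definition upper_lie_class :: "('f, 'b) module \<Rightarrow> nat" where
  "upper_lie_class A = (LEAST n. upper_lie_power A n = {\<zero>\<^bsub>A\<^esub>})"

end

theory Submission
  imports Defs "HOL-Computational_Algebra.Formal_Power_Series"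
begin

text \<open>
  Let \<open>A = u(L)\<close>. It is the free algebra on the set \<open>L\<close> modulo the ideal \<open>env_ideal\<close>, and all
  computations are done in the free algebra up to congruence; \<open>lcs n\<close> and \<open>ulp n\<close> map onto the terms
  \<open>\<gamma>\<^sub>n\<^sub>+\<^sub>1(A)\<close> and \<open>A\<^sup>(\<^sup>n\<^sup>+\<^sup>1\<^sup>)\<close>.

  All nonvanishing statements come from the theorem of Poincare, Birkhoff and Witt for restricted
  enveloping algebras (\<open>pbw_independent\<close>): for an ordered basis of \<open>L\<close>, the sorted words in which no
  letter occurs \<open>p\<close> times are independent in \<open>A\<close>. To prove it, \<open>L\<close> is made to act on the polynomials in
  the basis elements; the elements \<open>b\<^sup>p - b\<^sup>[\<^sup>p\<^sup>]\<close> act by commuting central operators, which can replace the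
  \<open>p\<close>-th powers in a basis of monomials. In a refined form (\<open>heavy_monomial\<close>), if a descending
  filtration of \<open>L\<close> respects brackets and \<open>p\<close>-th powers, then a monomial in an adapted basis lies in the
  \<open>n\<close>-th member of the induced filtration of \<open>A\<close> only if its weight is at least \<open>n\<close>.

  Suppose that \<open>A\<close> is Lie nilpotent. If \<open>[h, l]\<close> and the \<open>z\<^sub>i\<close> are central and \<open>h\<close>, \<open>h'\<close> commute, then
  \<open>[z\<^sub>1 \<dots> z\<^sub>t h, l h'] = z\<^sub>1 \<dots> z\<^sub>t [h, l] h'\<close>. So a long product of independent central commutators, or a high
  power of one central commutator that is not \<open>p\<close>-nilpotent, would give nonzero elements deep in the
  lower central series of \<open>A\<close>. Applied to \<open>L\<close> modulo the terms of its lower central series, this shows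
  that \<open>L'\<^sub>p\<close> has a finite chain of restricted ideals with one-dimensional factors on which \<open>L\<close> and the
  \<open>p\<close>-map act trivially (\<open>p_chain_derived_p\<close>).

  The upper bound goes down this chain: modulo the next ideal, each step adds one central element \<open>c\<close>
  with \<open>c\<^sup>p = 0\<close>, and if \<open>A\<^sup>(\<^sup>k\<^sup>+\<^sup>1\<^sup>)\<close> lies in \<open>c A\<close>, then \<open>A\<^sup>(\<^sup>k\<^sup>p\<^sup>+\<^sup>1\<^sup>)\<close> lies in
  \<open>c\<^sup>p A = 0\<close> (\<open>ulp_central_step\<close>).

  For the lower bound, let \<open>z = [x, y]\<close> have exponent \<open>e\<close>. If \<open>z\<close> is central, \<open>t\<close> brackets of \<open>x\<close> with \<open>y x\<close>
  give \<open>z\<^sup>t x\<close>, which for \<open>t = p\<^sup>e - 1\<close> is a product of basis elements \<open>z\<^sup>[\<^sup>p\<^sup>]\<^sup>a\<close> with exponents \<open>p - 1\<close> and of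
  \<open>x\<close>, hence nonzero. In general \<open>z\<close> is replaced by a commutator \<open>g = [h, l]\<close> of length \<open>i + 1\<close> in \<open>x\<close> and \<open>y\<close>
  with \<open>g\<^sup>[\<^sup>p\<^sup>]\<^sup>j \<noteq> 0\<close> for which \<open>i p\<^sup>j\<close> is maximal, and \<open>i\<close> as large as possible. By maximality there is a weight
  filtration with respect to which \<open>g\<close> behaves like a central element while \<open>g\<^sup>[\<^sup>p\<^sup>]\<^sup>j\<close> keeps its expected
  weight. Up to terms of higher weight, suitable brackets produce \<open>g\<^sup>k h\<close> for \<open>k = p\<^sup>j\<^sup>+\<^sup>1 - 1\<close>, with \<open>i\<close>
  brackets for each factor \<open>g\<close>. This gives a nonzero element of the lower central series after
  \<open>i p\<^sup>j\<^sup>+\<^sup>1 - 1 \<ge> p\<^sup>e - 1\<close> brackets (\<open>lcs_lower_bound\<close>).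
\<close>

unbundle fps_syntax

section \<open>Commutators and Jacobson's formula\<close>

definition comm :: "'r::ring \<Rightarrow> 'r \<Rightarrow> 'r" where
  "comm a b = a * b - b * a"

lemma comm_add_left: "comm (a + b) c = comm a c + comm b c"
  and comm_add_right: "comm a (b + c) = comm a b + comm a c"
  and comm_mult_left: "comm (a * b) c = a * comm b c + comm a c * b"
  and comm_mult_right: "comm a (b * c) = b * comm a c + comm a b * c"
  and comm_self [simp]: "comm a a = 0"
  and comm_zero [simp]: "comm 0 a = 0" "comm a 0 = 0"
  and comm_minus_swap: "- comm a b = comm b a"
  and comm_diff_left: "comm (a - b) c = comm a c - comm b c"
  and comm_comm_right: "comm a (comm b c) = comm (comm a b) c - comm (comm a c) b"
  by (simp_all add: comm_def algebra_simps)

lemma comm_iterate: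
  fixes a x :: "'r::ring_1"
  shows "(comm a ^^ n) x = (\<Sum>k\<le>n. of_int ((-1) ^ k * int (n choose k)) * (a ^ (n - k) * x * a ^ k))"
proof (induction n)
  case (Suc n)
  let ?c = "\<lambda>n k. of_int ((-1) ^ k * int (n choose k)) :: 'r"
  let ?m = "\<lambda>n k. a ^ (n - k) * x * a ^ k"
  have com: "a * of_int i = of_int i * a" for i
    by (simp add: mult_of_int_commute)
  have 1: "a * (\<Sum>k\<le>n. ?c n k * ?m n k) = (\<Sum>k\<le>Suc n. ?c n k * ?m (Suc n) k)"
  proof -
    have "a * (?c n k * ?m n k) = ?c n k * ?m (Suc n) k" if "k \<le> n" for k
      using that by (simp add: Suc_diff_le com mult.assoc[symmetric] del: of_int_mult)
    then show ?thesis by (simp add: sum_distrib_left binomial_eq_0)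
  qed
  have 2: "(\<Sum>k\<le>n. ?c n k * ?m n k) * a =
      (\<Sum>k\<le>n. ?c n k * ?m (Suc n) (Suc k))"
    by (simp add: sum_distrib_right mult.assoc power_commutes)
  have 3: "?c (Suc n) (Suc k) = ?c n (Suc k) - ?c n k" for k
    by (simp add: algebra_simps)
  have "(comm a ^^ Suc n) x = (\<Sum>k\<le>Suc n. ?c n k * ?m (Suc n) k) - (\<Sum>k\<le>n. ?c n k * ?m (Suc n) (Suc k))"
    unfolding funpow.simps o_apply Suc comm_def 1 2 ..
  also have "\<dots> = ?m (Suc n) 0 + (\<Sum>k\<le>n. (?c n (Suc k) - ?c n k) * ?m (Suc n) (Suc k))"
    by (subst sum.atMost_Suc_shift) (simp add: sum_subtractf left_diff_distrib del: sum.atMost_Suc)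
  also have "\<dots> = ?m (Suc n) 0 + (\<Sum>k\<le>n. ?c (Suc n) (Suc k) * ?m (Suc n) (Suc k))"
    by (simp only: 3)
  also have "\<dots> = (\<Sum>k\<le>Suc n. ?c (Suc n) k * ?m (Suc n) k)"
    by (subst sum.atMost_Suc_shift) simp
  finally show ?case .
qed simp

lemma of_int_eq_zero_if_dvd:
  assumes "of_nat p = (0 :: 'r::ring_1)" "int p dvd i"
  shows "of_int i = (0 :: 'r)"
  using assms by (auto elim!: dvdE)

text \<open>
  The binomial expansion of \<open>ad(a)\<^sup>p\<close>, in which \<open>p\<close> divides all mixed coefficients.
\<close>

lemma comm_iterate_prime:
  fixes a x :: "'r::ring_1"
  assumes p: "prime p" and ch: "of_nat p = (0 :: 'r)"
  shows "(comm a ^^ p) x = comm (a ^ p) x"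
proof -
  have p0: "p > 0" using p prime_gt_0_nat by auto
  let ?c = "\<lambda>k. of_int ((-1) ^ k * int (p choose k)) :: 'r"
  let ?f = "\<lambda>k. ?c k * (a ^ (p - k) * x * a ^ k)"
  have mid: "?c k = 0" if "0 < k" "k < p" for k
    by (rule of_int_eq_zero_if_dvd[OF ch])
       (use that p in \<open>auto intro!: dvd_mult simp: int_dvd_int_iff dvd_choose_prime\<close>)
  have "(\<Sum>k\<le>p. ?f k) = (\<Sum>k\<in>{0,p}. ?f k)"
    by (rule sum.mono_neutral_right) (use mid in \<open>auto simp del: of_int_mult\<close>)
  also have "\<dots> = a ^ p * x + of_int ((-1) ^ p) * (x * a ^ p)"
    using p0 by simp
  also have "of_int ((-1) ^ p) = (- 1 :: 'r)"
  proof (cases "p = 2")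
    case True
    then have "(1::'r) + 1 = 0" using ch by simp
    then show ?thesis using True by (simp add: eq_neg_iff_add_eq_0)
  next
    case False
    then have "odd p" using p prime_odd_nat prime_ge_2_nat by (metis nat_less_le)
    then show ?thesis by simp
  qed
  finally show ?thesis by (simp add: comm_iterate comm_def)
qed

text \<open>
  Here \<open>(-1)\<^sup>k\<close> times the binomial coefficient of \<open>p - 1\<close> over \<open>k\<close> is congruent to \<open>1\<close> modulo \<open>p\<close>.
\<close>

lemma comm_iterate_prime_minus_one:
  fixes a x :: "'r::ring_1"
  assumes p: "prime p" and ch: "of_nat p = (0 :: 'r)"
  shows "(comm a ^^ (p - 1)) x = (\<Sum>k<p. a ^ (p - 1 - k) * x * a ^ k)"
proof -
  have p0: "p > 0" using p prime_gt_0_nat by auto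
  have "of_int ((-1) ^ k * int ((p - 1) choose k)) = (1 :: 'r)" if "k < p" for k
    using that
  proof (induction k)
    case (Suc k)
    have "p choose Suc k = ((p - 1) choose k) + ((p - 1) choose Suc k)"
      using p0 by (metis Suc_diff_1 binomial_Suc_Suc)
    then have e: "(-1) ^ Suc k * int ((p - 1) choose Suc k) =
        (-1) ^ k * int ((p - 1) choose k) - (-1) ^ k * int (p choose Suc k)"
      by (simp add: algebra_simps)
    have "of_int ((-1) ^ k * int (p choose Suc k)) = (0 :: 'r)"
      by (rule of_int_eq_zero_if_dvd[OF ch])
         (use Suc.prems p in \<open>auto intro!: dvd_mult simp: int_dvd_int_iff dvd_choose_prime\<close>)
    then show ?case using Suc unfolding e of_int_diff by simp
  qed simp
  moreover have "{..p - 1} = {..<p}" using p0 by auto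
  ultimately show ?thesis unfolding comm_iterate by (intro sum.cong) auto
qed

text \<open>
  The coefficient of \<open>t\<^sup>n\<close> in \<open>ad(t x + y)\<^sup>k(x)\<close> for an arbitrary bracket.
\<close>

primrec jacobson_coeff ::
  "('a::ab_group_add \<Rightarrow> 'a \<Rightarrow> 'a) \<Rightarrow> 'a \<Rightarrow> 'a \<Rightarrow> nat \<Rightarrow> nat \<Rightarrow> 'a" where
  "jacobson_coeff br x y 0 n = (if n = 0 then x else 0)"
| "jacobson_coeff br x y (Suc k) n =
     (if n = 0 then 0 else br x (jacobson_coeff br x y k (n - 1))) + br y (jacobson_coeff br x y k n)"

lemma fps_iterate_comm_nth:
  fixes A B :: "'r::ring_1"
  defines "U \<equiv> fps_const A * fps_X + fps_const B"
  shows "(comm U ^^ k) (fps_const A) $ n = jacobson_coeff comm A B k n"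
proof (induction k arbitrary: n)
  case (Suc k)
  have "comm U V $ n = (if n = 0 then 0 else comm A (V $ (n - 1))) + comm B (V $ n)" for V
  proof -
    have "(U * V) $ n = (if n = 0 then 0 else A * V $ (n - 1)) + B * V $ n"
      by (simp add: U_def distrib_right mult.assoc)
    moreover have "(V * U) $ n = (if n = 0 then 0 else V $ (n - 1) * A) + V $ n * B"
      by (simp add: U_def distrib_left mult.assoc[symmetric])
    ultimately show ?thesis by (simp add: comm_def)
  qed
  then show ?case using Suc by simp
qed simp

text \<open>
  Differentiating \<open>(t A + B)\<^sup>p\<close> with respect to \<open>t\<close> gives
  \<open>\<Sum>\<^sub>k (t A + B)\<^sup>p\<^sup>-\<^sup>1\<^sup>-\<^sup>k A (t A + B)\<^sup>k\<close>, which in characteristic \<open>p\<close> is \<open>ad(t A + B)\<^sup>p\<^sup>-\<^sup>1(A)\<close>; so the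
  mixed coefficients of the power are Lie polynomials.
\<close>

lemma jacobson_formula:
  fixes A B :: "'r::ring_1"
  assumes p: "prime p" and ch: "of_nat p = (0 :: 'r)"
  obtains c where "(A + B) ^ p = A ^ p + B ^ p + (\<Sum>i=1..p-1. c i)"
    "\<And>i. 1 \<le> i \<Longrightarrow> i \<le> p - 1 \<Longrightarrow> of_nat i * c i = jacobson_coeff comm A B (p - 1) (i - 1)"
proof -
  define U where "U = fps_const A * fps_X + fps_const B"
  have p0: "p \<ge> 2" using p prime_ge_2_nat by auto
  have step: "(U ^ Suc n) $ i = (if i = 0 then 0 else A * (U ^ n) $ (i - 1)) + B * (U ^ n) $ i" for n i
    by (simp add: U_def distrib_right mult.assoc)
  have hi: "(U ^ n) $ i = 0" if "i > n" for n i
    using that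
  proof (induction n arbitrary: i)
    case (Suc n)
    then show ?case unfolding step by simp
  qed simp
  have lo: "(U ^ n) $ 0 = B ^ n" for n
    by (induction n) (simp_all add: step del: power_Suc, simp)
  have top: "(U ^ n) $ n = A ^ n" for n
  proof (induction n)
    case (Suc n)
    then show ?case unfolding step by (simp add: hi)
  qed simp
  have total: "(\<Sum>i\<le>n. (U ^ n) $ i) = (A + B) ^ n" for n
  proof (induction n)
    case (Suc n)
    have "(\<Sum>i\<le>Suc n. (U ^ Suc n) $ i) =
        (\<Sum>i\<le>Suc n. if i = 0 then 0 else A * (U ^ n) $ (i - 1)) + (\<Sum>i\<le>Suc n. B * (U ^ n) $ i)"
      unfolding step by (rule sum.distrib)
    also have "(\<Sum>i\<le>Suc n. if i = 0 then 0 else A * (U ^ n) $ (i - 1)) = A * (\<Sum>i\<le>n. (U ^ n) $ i)"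
      by (subst sum.atMost_Suc_shift) (simp add: sum_distrib_left)
    also have "(\<Sum>i\<le>Suc n. B * (U ^ n) $ i) = B * (\<Sum>i\<le>n. (U ^ n) $ i)"
      by (simp add: hi sum_distrib_left)
    finally show ?case by (simp add: Suc distrib_right)
  qed simp
  have der: "fps_deriv (U ^ n) = (\<Sum>k<n. U ^ (n - 1 - k) * fps_const A * U ^ k)" for n
  proof (induction n)
    case (Suc n)
    have dU: "fps_deriv U = fps_const A"
      by (rule fps_ext) (auto simp: U_def)
    have e: "U * (U ^ (n - 1 - k) * fps_const A * U ^ k) = U ^ (Suc n - 1 - k) * fps_const A * U ^ k"
      if "k < n" for k
    proof -
      have "Suc n - 1 - k = Suc (n - 1 - k)" using that by simp
      then show ?thesis by (simp add: mult.assoc)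
    qed
    have "fps_deriv (U ^ Suc n) = U * fps_deriv (U ^ n) + fps_const A * U ^ n"
      by (simp add: dU)
    also have "U * fps_deriv (U ^ n) = (\<Sum>k<n. U ^ (Suc n - 1 - k) * fps_const A * U ^ k)"
      unfolding Suc sum_distrib_left by (rule sum.cong) (use e in auto)
    finally show ?case by simp
  qed simp
  have chf: "of_nat p = (0 :: 'r fps)" using ch by (simp add: fps_of_nat[symmetric])
  have key: "fps_deriv (U ^ p) = (comm U ^^ (p - 1)) (fps_const A)"
    unfolding der comm_iterate_prime_minus_one[OF p chf] ..
  have "of_nat i * (U ^ p) $ i = jacobson_coeff comm A B (p - 1) (i - 1)" if "1 \<le> i" for i
  proof -
    have "of_nat i * (U ^ p) $ i = fps_deriv (U ^ p) $ (i - 1)" using that by simp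
    also have "\<dots> = jacobson_coeff comm A B (p - 1) (i - 1)"
      unfolding key by (rule fps_iterate_comm_nth[where A = A and B = B, folded U_def])
    finally show ?thesis .
  qed
  moreover have "(A + B) ^ p = A ^ p + B ^ p + (\<Sum>i=1..p-1. (U ^ p) $ i)"
  proof -
    have "{..p} = insert 0 (insert p {1..p-1})" using p0 by auto
    then have "(\<Sum>i\<le>p. (U ^ p) $ i) = (U ^ p) $ 0 + ((U ^ p) $ p + (\<Sum>i=1..p-1. (U ^ p) $ i))"
      using p0 by simp
    then show ?thesis unfolding total lo top by (simp add: algebra_simps)
  qed
  ultimately show thesis using that by blast
qed

abbreviation "lookup \<equiv> Poly_Mapping.lookup"
abbreviation "keys \<equiv> Poly_Mapping.keys"

section \<open>Linear algebra of finitely supported functions\<close>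

definition scal :: "'f::field \<Rightarrow> ('m::monoid_add \<Rightarrow>\<^sub>0 'f) \<Rightarrow> ('m \<Rightarrow>\<^sub>0 'f)" where
  "scal c t = Poly_Mapping.single 0 c * t"

lemma lookup_scal [simp]: "lookup (scal c t) k = c * lookup t k"
  unfolding scal_def
  by (simp add: mult_map_scale_conv_mult[symmetric] Poly_Mapping.map.rep_eq when_def)

lemma scal_single [simp]: "scal c (Poly_Mapping.single k d) = Poly_Mapping.single k (c * d)"
  by (simp add: scal_def mult_single)

interpretation pm: vector_space "scal :: 'f::field \<Rightarrow> ('m::monoid_add \<Rightarrow>\<^sub>0 'f) \<Rightarrow> _"
  by standard (auto intro!: poly_mapping_eqI simp: lookup_add algebra_simps)

lemma poly_mapping_sum_single: "t = (\<Sum>k\<in>keys t. Poly_Mapping.single k (lookup t k))"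
proof (rule poly_mapping_eqI)
  fix k
  have "lookup (\<Sum>k\<in>keys t. Poly_Mapping.single k (lookup t k)) k =
      (\<Sum>k'\<in>keys t. if k' = k then lookup t k else 0)"
    unfolding lookup_sum by (rule sum.cong) (auto simp: lookup_single)
  then show "lookup t k = lookup (\<Sum>k\<in>keys t. Poly_Mapping.single k (lookup t k)) k"
    by (simp add: in_keys_iff)
qed

lemma poly_mapping_linear_induct [case_names single add]:
  assumes "\<And>k c. P (Poly_Mapping.single k c)" "\<And>a b. P a \<Longrightarrow> P b \<Longrightarrow> P (a + b)"
  shows "P (t :: 'm \<Rightarrow>\<^sub>0 'b::comm_monoid_add)"
proof -
  have "P (\<Sum>k\<in>A. Poly_Mapping.single k (lookup t k))" if "finite A" for A
    using that
  proof (induction A rule: finite_induct)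
    case empty
    show ?case using assms(1)[of undefined 0] by simp
  qed (simp add: assms)
  then show ?thesis using poly_mapping_sum_single[of t] by (metis finite_keys)
qed

lemma single_zero_commute: "Poly_Mapping.single 0 c * t = t * Poly_Mapping.single 0 (c :: 'f::field)"
  by (induction t rule: poly_mapping_linear_induct)
     (simp_all add: mult_single mult.commute distrib_left distrib_right)

lemma scal_mult_left [simp]: "scal c t * u = scal c (t * u)"
  and scal_mult_right [simp]: "t * scal c u = scal c (t * u)"
  by (simp_all add: scal_def mult.assoc single_zero_commute)

lemma scal_comm_left [simp]: "comm (scal c t) u = scal c (comm t u)"
  and scal_comm_right [simp]: "comm t (scal c u) = scal c (comm t u)"
  by (simp_all add: comm_def pm.scale_right_diff_distrib)

lemma scal_power: "scal c t ^ n = scal (c ^ n) (t ^ n)"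
  by (induction n) simp_all

lemma of_nat_char_poly_mapping:
  "of_nat CHAR('f) = (0 :: 'm::monoid_add \<Rightarrow>\<^sub>0 'f::field)"
  by (metis of_nat_CHAR single_of_nat single_zero)

definition lin_ext :: "('m::monoid_add \<Rightarrow> 'n::monoid_add \<Rightarrow>\<^sub>0 'f) \<Rightarrow> ('m \<Rightarrow>\<^sub>0 'f::field) \<Rightarrow> ('n \<Rightarrow>\<^sub>0 'f)" where
  "lin_ext f t = (\<Sum>k\<in>keys t. scal (lookup t k) (f k))"

lemma lin_ext_superset: "finite A \<Longrightarrow> keys t \<subseteq> A \<Longrightarrow> lin_ext f t = (\<Sum>k\<in>A. scal (lookup t k) (f k))"
  unfolding lin_ext_def by (rule sum.mono_neutral_left) (auto simp: in_keys_iff)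

lemma linear_lin_ext:
  fixes f :: "'m::monoid_add \<Rightarrow> 'n::monoid_add \<Rightarrow>\<^sub>0 'f::field"
  shows "Vector_Spaces.linear scal scal (lin_ext f)"
  unfolding Vector_Spaces.linear_iff
proof (intro conjI allI)
  fix a b :: "'m \<Rightarrow>\<^sub>0 'f" and c
  let ?A = "keys a \<union> keys b \<union> keys (a + b) \<union> keys (scal c a)"
  show "lin_ext f (a + b) = lin_ext f a + lin_ext f b"
    by (subst (1 2 3) lin_ext_superset[of ?A])
       (auto simp: lookup_add pm.scale_left_distrib sum.distrib)
  show "lin_ext f (scal c a) = scal c (lin_ext f a)"
    by (subst (1 2) lin_ext_superset[of ?A]) (auto simp: pm.scale_sum_right)
qed unfold_locales

lemmas lin_ext_add = linear_lin_ext[THEN Vector_Spaces.linear_iff[THEN iffD1], THEN conjunct2, THEN conjunct2, THEN conjunct1, rule_format]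
  and lin_ext_scal = linear_lin_ext[THEN Vector_Spaces.linear_iff[THEN iffD1], THEN conjunct2, THEN conjunct2, THEN conjunct2, rule_format]

lemma lin_ext_zero [simp]: "lin_ext f 0 = 0"
  by (simp add: lin_ext_def)

lemma lin_ext_single [simp]: "lin_ext f (Poly_Mapping.single k c) = scal c (f k)"
  by (cases "c = 0") (simp_all add: lin_ext_def)

lemma lin_ext_minus: "lin_ext f (- a) = - lin_ext f a"
  by (metis lin_ext_add lin_ext_zero add_eq_0_iff ab_group_add_class.ab_left_minus)

lemma lin_ext_diff: "lin_ext f (a - b) = lin_ext f a - lin_ext f b"
  using lin_ext_add[of f a "- b"] by (simp add: lin_ext_minus)

lemma lin_ext_cong: "(\<And>k. k \<in> keys t \<Longrightarrow> f k = g k) \<Longrightarrow> lin_ext f t = lin_ext g t"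
  by (simp add: lin_ext_def)

lemma lin_ext_in_subspace:
  assumes "pm.subspace U" "\<And>k. k \<in> keys t \<Longrightarrow> f k \<in> U"
  shows "lin_ext f t \<in> U"
  unfolding lin_ext_def using assms by (intro pm.subspace_sum pm.subspace_scale) auto

section \<open>The Poincare--Birkhoff--Witt module of a Lie algebra\<close>

lemma subspace_keys: "pm.subspace {s :: 'b::monoid_add \<Rightarrow>\<^sub>0 'a::field. \<forall>M\<in>keys s. P M}"
proof (rule pm.subspaceI)
  fix x y :: "'b::monoid_add \<Rightarrow>\<^sub>0 'a::field" and c
  assume x: "x \<in> {s. \<forall>M\<in>keys s. P M}"
  then show "scal c x \<in> {s. \<forall>M\<in>keys s. P M}" by (auto simp: in_keys_iff)
  assume "y \<in> {s. \<forall>M\<in>keys s. P M}"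
  with x show "x + y \<in> {s. \<forall>M\<in>keys s. P M}" using keys_add[of x y] by blast
qed simp

definition bmon :: "'a multiset \<Rightarrow> ('a multiset \<Rightarrow>\<^sub>0 'f::field)" where
  "bmon M = Poly_Mapping.single M 1"

lemma lin_ext_mon [simp]: "lin_ext f (bmon M) = f M"
  by (simp add: bmon_def)

context lie_algebra begin

lemma bracket_zero_left [simp]: "bracket 0 y = 0"
  using bracket_add_left[of 0 0 y] by simp

lemma bracket_zero_right [simp]: "bracket x 0 = 0"
  using bracket_add_right[of x 0 0] by simp

lemma bracket_swap: "bracket x y = - bracket y x"
proof -
  have "bracket x x + bracket x y + (bracket y x + bracket y y) = bracket (x + y) (x + y)"
    by (simp only: bracket_add_left bracket_add_right add_ac)
  then show ?thesis by (simp add: bracket_self eq_neg_iff_add_eq_0)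
qed

lemma bracket_minus_left: "bracket (- x) y = - bracket x y"
  using bracket_add_left[of x "- x" y] by (simp add: add_eq_0_iff)

lemma bracket_minus_right: "bracket x (- y) = - bracket x y"
  using bracket_add_right[of x y "- y"] by (simp add: add_eq_0_iff)

lemma bracket_diff_left: "bracket (x - y) z = bracket x z - bracket y z"
  using bracket_add_left[of x "- y" z] by (simp add: bracket_minus_left)

lemma bracket_diff_right: "bracket z (x - y) = bracket z x - bracket z y"
  using bracket_add_right[of z x "- y"] by (simp add: bracket_minus_right)

lemma bracket_bracket_right: "bracket x (bracket y z) = bracket (bracket x y) z - bracket (bracket x z) y"
proof -
  have "bracket (bracket x y) z = - bracket z (bracket x y)" by (rule bracket_swap)
  moreover have "bracket (bracket x z) y = bracket y (bracket z x)"
    using bracket_swap[of "bracket x z" y] bracket_swap[of x z] by (simp add: bracket_minus_right)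
  ultimately show ?thesis using jacobi[of x y z]
    by (metis add_diff_cancel_right' diff_minus_eq_add diff_0 eq_diff_eq)
qed

end

locale ordered_basis = lie_algebra scale bracket
  for scale :: "'f::field \<Rightarrow> 'a::ab_group_add \<Rightarrow> 'a" and bracket :: "'a \<Rightarrow> 'a \<Rightarrow> 'a" +
  fixes B :: "'a set" and le :: "'a \<Rightarrow> 'a \<Rightarrow> bool"
  assumes indep: "independent B" and span_B: "span B = UNIV"
    and le_refl: "le a a" and le_trans: "le a b \<Longrightarrow> le b c \<Longrightarrow> le a c"
    and le_antisym: "le a b \<Longrightarrow> le b a \<Longrightarrow> a = b" and le_total: "le a b \<or> le b a"
begin

sublocale vp: vector_space_pair scale "scal :: 'f \<Rightarrow> ('a multiset \<Rightarrow>\<^sub>0 'f) \<Rightarrow> _" ..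

definition size_le :: "nat \<Rightarrow> ('a multiset \<Rightarrow>\<^sub>0 'f) set" where
  "size_le n = {s. \<forall>M\<in>keys s. set_mset M \<subseteq> B \<and> size M \<le> n}"

lemma subspace_size_le: "pm.subspace (size_le n)"
  unfolding size_le_def by (rule subspace_keys)

lemma size_le_mono: "m \<le> n \<Longrightarrow> size_le m \<subseteq> size_le n"
  by (auto simp: size_le_def)

lemma bmon_in_size_le: "set_mset M \<subseteq> B \<Longrightarrow> size M \<le> n \<Longrightarrow> bmon M \<in> size_le n"
  by (simp add: size_le_def bmon_def)

definition below :: "'a \<Rightarrow> 'a multiset \<Rightarrow> bool" where
  "below b M \<longleftrightarrow> (\<forall>c\<in>#M. le b c)"

definition least_letter :: "'a multiset \<Rightarrow> 'a" where
  "least_letter M = (SOME c. c \<in># M \<and> below c M)"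

lemma least_letter: "M \<noteq> {#} \<Longrightarrow> least_letter M \<in># M \<and> below (least_letter M) M"
proof -
  assume "M \<noteq> {#}"
  then have "\<exists>c. c \<in># M \<and> below c M"
  proof (induction M)
    case (add x M)
    show ?case
    proof (cases "M = {#}")
      case True
      then show ?thesis by (auto simp: below_def le_refl)
    next
      case False
      with add obtain c where "c \<in># M" "below c M" by auto
      then show ?thesis using le_total[of c x] le_refl le_trans
        by (metis (no_types, opaque_lifting) below_def insert_iff set_mset_add_mset_insert)
    qed
  qed simp
  then show ?thesis unfolding least_letter_def by (rule someI_ex)
qed

lemma least_add: "below j M \<Longrightarrow> least_letter (add_mset j M) = j"
  using least_letter[of "add_mset j M"] le_antisym by (auto simp: below_def)

text \<open>
  The action of a letter \<open>b\<close> on a monomial \<open>M\<close> is forced: it is the monomial \<open>b M\<close> if \<open>b\<close> is at most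
  all letters of \<open>M\<close>, and otherwise, with \<open>M = j N\<close> and \<open>j\<close> the least letter, it is \<open>j (b N) + [b, j] N\<close>.
  Only the part of \<open>j (b N)\<close> below the leading monomial \<open>j b N\<close> needs a recursive call. Then all
  recursive calls concern monomials shorter than \<open>M\<close>, and a numerical bound on the length makes the
  recursion primitive. Monomials with letters outside \<open>B\<close> are annihilated, so that they satisfy every
  linear identity between products of letters.
\<close>

primrec pact :: "nat \<Rightarrow> 'a \<Rightarrow> 'a multiset \<Rightarrow> ('a multiset \<Rightarrow>\<^sub>0 'f)" where
  "pact 0 b M = (if set_mset M \<subseteq> B then bmon (add_mset b M) else 0)"
| "pact (Suc n) b M = (if \<not> set_mset M \<subseteq> B then 0
     else if below b M then bmon (add_mset b M)
     else bmon (add_mset b M)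
       + lin_ext (pact n (least_letter M)) (pact n b (M - {#least_letter M#}) - bmon (add_mset b (M - {#least_letter M#})))
       + vp.construct B (\<lambda>k. pact n k (M - {#least_letter M#})) (bracket b (least_letter M)))"

lemma pact_junk: "\<not> set_mset M \<subseteq> B \<Longrightarrow> pact n b M = 0"
  by (cases n) simp_all

text \<open>
  A letter acts as multiplication by itself up to terms of lower degree. This makes the recursion
  independent of the bound, and later gives linear independence.
\<close>

lemma pact_degree:
  assumes "size M \<le> n" "set_mset M \<subseteq> B" "b \<in> B"
  shows "pact n b M - bmon (add_mset b M) \<in> size_le (size M)"
  using assms
proof (induction n arbitrary: b M)
  case 0
  then show ?case by (simp add: pm.subspace_0[OF subspace_size_le])
next
  case (Suc n)
  show ?case
  proof (cases "below b M")
    case True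
    then show ?thesis using Suc.prems by (simp add: pm.subspace_0[OF subspace_size_le])
  next
    case False
    define j where "j = least_letter M"
    define N where "N = M - {#j#}"
    have "M \<noteq> {#}" using False by (auto simp: below_def)
    then have M: "M = add_mset j N" unfolding N_def j_def using least_letter by simp
    have sN: "size N \<le> n" "set_mset N \<subseteq> B" "j \<in> B" using Suc.prems M by auto
    have *: "pact n k K \<in> size_le (size M)" if "size K \<le> size N" "k \<in> B" for k K
    proof (cases "set_mset K \<subseteq> B")
      case True
      have "pact n k K - bmon (add_mset k K) \<in> size_le (size M)"
        using Suc.IH[of K k] that sN True size_le_mono[of "size K" "size M"] M by auto
      moreover have "bmon (add_mset k K) \<in> size_le (size M)"
        using that True M by (intro bmon_in_size_le) auto
      ultimately show ?thesis using pm.subspace_add[OF subspace_size_le] by fastforce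
    qed (simp add: pact_junk pm.subspace_0[OF subspace_size_le])
    have "lin_ext (pact n j) (pact n b N - bmon (add_mset b N)) \<in> size_le (size M)"
    proof (intro lin_ext_in_subspace subspace_size_le)
      fix K assume "K \<in> keys (pact n b N - bmon (add_mset b N))"
      then have "size K \<le> size N" using Suc.IH[OF sN(1,2) Suc.prems(3)] by (auto simp: size_le_def)
      then show "pact n j K \<in> size_le (size M)" using * sN(3) by blast
    qed
    moreover have "vp.construct B (\<lambda>k. pact n k N) (bracket b j) \<in> size_le (size M)"
      using vp.construct_in_span[OF indep, of "\<lambda>k. pact n k N" "bracket b j"]
        pm.span_minimal[of "(\<lambda>k. pact n k N) ` B" "size_le (size M)"] subspace_size_le * by blast
    ultimately show ?thesis using False Suc.prems(2)
      by (simp add: j_def[symmetric] N_def[symmetric] pm.subspace_add[OF subspace_size_le])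
  qed
qed

lemma pact_step: "size M \<le> n \<Longrightarrow> b \<in> B \<Longrightarrow> pact (Suc n) b M = pact n b M"
proof (induction n arbitrary: b M)
  case 0
  then show ?case by (simp add: below_def)
next
  case (Suc n)
  show ?case
  proof (cases "set_mset M \<subseteq> B \<and> \<not> below b M")
    case False
    then show ?thesis by auto
  next
    case True
    define j where "j = least_letter M"
    define N where "N = M - {#j#}"
    have "M \<noteq> {#}" using True by (auto simp: below_def)
    then have M: "M = add_mset j N" unfolding N_def j_def using least_letter by simp
    have sN: "size N \<le> n" "set_mset N \<subseteq> B" "j \<in> B" using Suc.prems True M by auto
    have 1: "vp.construct B (\<lambda>k. pact (Suc n) k N) v = vp.construct B (\<lambda>k. pact n k N) v" for v
      using vp.construct_cong[of B "\<lambda>k. pact (Suc n) k N" "\<lambda>k. pact n k N"] Suc.IH[OF sN(1)] by simp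
    have 3: "pact (Suc n) b N = pact n b N" using Suc.IH sN Suc.prems by blast
    have 2: "lin_ext (pact (Suc n) j) (pact n b N - bmon (add_mset b N)) = lin_ext (pact n j) (pact n b N - bmon (add_mset b N))"
      proof (rule lin_ext_cong)
      fix K assume "K \<in> keys (pact n b N - bmon (add_mset b N))"
      then have "size K \<le> n" using pact_degree[OF sN(1,2) Suc.prems(2)] sN(1) by (force simp: size_le_def)
      then show "pact (Suc n) j K = pact n j K" by (rule Suc.IH[OF _ sN(3)])
    qed
    show ?thesis using True
      by (subst (1 2) pact.simps(2)) (simp only: j_def[symmetric] N_def[symmetric] 1 3 2 if_cancel simp_thms if_True if_False)
  qed
qed

lemma pact_stable: "size M \<le> n \<Longrightarrow> b \<in> B \<Longrightarrow> pact n b M = pact (size M) b M"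
proof (induction "n - size M" arbitrary: n)
  case (Suc d)
  then obtain m where "n = Suc m" "size M \<le> m" by (cases n) auto
  then show ?case using Suc pact_step[of M m b] by auto
qed simp

definition bact :: "'a \<Rightarrow> 'a multiset \<Rightarrow> ('a multiset \<Rightarrow>\<^sub>0 'f)" where
  "bact b M = pact (size M) b M"

definition act :: "'a \<Rightarrow> ('a multiset \<Rightarrow>\<^sub>0 'f) \<Rightarrow> ('a multiset \<Rightarrow>\<^sub>0 'f)" where
  "act v s = vp.construct B (\<lambda>b. lin_ext (bact b) s) v"

lemma bact_below: "set_mset M \<subseteq> B \<Longrightarrow> below b M \<Longrightarrow> bact b M = bmon (add_mset b M)"
  unfolding bact_def by (cases "size M") simp_all

lemma bact_junk: "\<not> set_mset M \<subseteq> B \<Longrightarrow> bact b M = 0"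
  unfolding bact_def by (rule pact_junk)

lemma bact_degree: "b \<in> B \<Longrightarrow> set_mset M \<subseteq> B \<Longrightarrow> bact b M - bmon (add_mset b M) \<in> size_le (size M)"
  unfolding bact_def by (rule pact_degree) simp_all

lemma act_basis: "b \<in> B \<Longrightarrow> act b s = lin_ext (bact b) s"
  unfolding act_def by (rule vp.construct_basis[OF indep])

lemma linear_act: "Vector_Spaces.linear scale scal (\<lambda>v. act v s)"
  unfolding act_def by (rule vp.linear_construct[OF indep])

lemma act_add_left: "act (u + v) s = act u s + act v s"
  and act_scale_left: "act (scale c u) s = scal c (act u s)"
  using linear_act[of s] unfolding Vector_Spaces.linear_iff by auto

lemma act_add: "act v (s + t) = act v s + act v t"
  unfolding act_def lin_ext_add by (rule vp.construct_add[OF indep])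

lemma act_scal: "act v (scal c s) = scal c (act v s)"
  unfolding act_def lin_ext_scal by (rule vp.construct_scale[OF indep])

lemma act_zero [simp]: "act v 0 = 0"
  using act_add[of v 0 0] by simp

lemma act_zero_left [simp]: "act 0 s = 0"
  using act_add_left[of 0 0 s] by simp

lemma act_minus: "act v (- s) = - act v s"
  using act_add[of v s "- s"] by (simp add: add_eq_0_iff)

lemma act_minus_left: "act (- v) s = - act v s"
  using act_add_left[of v "- v" s] by (simp add: add_eq_0_iff)

lemma act_diff: "act v (s - t) = act v s - act v t"
  using act_add[of v s "- t"] by (simp add: act_minus)

lemma act_diff_left: "act (u - v) s = act u s - act v s"
  using act_add_left[of u "- v" s] by (simp add: act_minus_left)

lemma act_recursion:
  assumes "set_mset M \<subseteq> B" "b \<in> B" "j \<in> B" "below j M" "le j b" "j \<noteq> b"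
  shows "act b (bmon (add_mset j M)) = act j (act b (bmon M)) + act (bracket b j) (bmon M)"
proof -
  have nb: "\<not> below b (add_mset j M)" using assms le_antisym by (auto simp: below_def)
  have lj: "least_letter (add_mset j M) = j" using assms by (simp add: least_add)
  have bj: "below j (add_mset b M)" using assms by (auto simp: below_def)
  let ?w = "bact b M - bmon (add_mset b M)"
  have "bact b (add_mset j M) = bmon (add_mset b (add_mset j M)) +
      lin_ext (pact (size M) j) ?w + act (bracket b j) (bmon M)"
    using nb lj assms by (simp add: bact_def act_def)
  also have "lin_ext (pact (size M) j) ?w = lin_ext (bact j) ?w"
    unfolding bact_def
  proof (rule lin_ext_cong)
    fix K assume "K \<in> keys (pact (size M) b M - bmon (add_mset b M))"
    then have "size K \<le> size M" using bact_degree[OF assms(2,1)] by (auto simp: bact_def size_le_def)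
    then show "pact (size M) j K = pact (size K) j K" by (rule pact_stable[OF _ assms(3)])
  qed
  also have "\<dots> = act j (act b (bmon M)) - bmon (add_mset b (add_mset j M))"
    using assms bact_below[OF _ bj] by (simp add: act_basis lin_ext_diff add_mset_commute)
  finally show ?thesis using assms by (simp add: act_basis)
qed

definition law :: "'a \<Rightarrow> 'a \<Rightarrow> ('a multiset \<Rightarrow>\<^sub>0 'f) \<Rightarrow> bool" where
  "law u v s \<longleftrightarrow> act u (act v s) - act v (act u s) = act (bracket u v) s"

lemma law_swap: "law u v s \<Longrightarrow> law v u s"
  unfolding law_def bracket_swap[of v u] act_minus_left by (metis minus_diff_eq)

lemma law_add: "law u v s \<Longrightarrow> law u v t \<Longrightarrow> law u v (s + t)"
  unfolding law_def by (simp add: act_add algebra_simps)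

lemma law_scal: "law u v s \<Longrightarrow> law u v (scal c s)"
  unfolding law_def by (metis act_scal pm.scale_right_diff_distrib)

lemma law_basis_imp_law:
  assumes "\<And>b c. b \<in> B \<Longrightarrow> c \<in> B \<Longrightarrow> law b c s"
  shows "law u v s"
proof -
  have "law u c s" if "c \<in> B" for c
  proof -
    have "u \<in> span B" by (simp add: span_B)
    then show ?thesis
    proof (induction rule: span_induct_alt)
      case base
      then show ?case by (simp add: law_def)
    next
      case (step k b w)
      then have "law (scale k b) c s" using assms[OF step(1) that]
        by (simp add: law_def act_scale_left act_scal bracket_scale_left
              flip: pm.scale_right_diff_distrib)
      then show ?case using step(2)
        by (simp add: law_def act_add_left act_add bracket_add_left algebra_simps)
    qed
  qed
  note * = this
  have "v \<in> span B" by (simp add: span_B)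
  then show ?thesis
  proof (induction rule: span_induct_alt)
    case base
    then show ?case by (simp add: law_def)
  next
    case (step k b w)
    then have "law u (scale k b) s" using *[OF step(1)]
      by (simp add: law_def act_scale_left act_scal bracket_scale_right
            flip: pm.scale_right_diff_distrib)
    then show ?case using step(2)
      by (simp add: law_def act_add_left act_add bracket_add_right algebra_simps)
  qed
qed

lemma act_junk:
  assumes "\<not> set_mset M \<subseteq> B"
  shows "act v (bmon M) = 0"
proof -
  have "(\<lambda>b. lin_ext (bact b) (bmon M)) = (\<lambda>b. scal 0 (lin_ext (bact b) (bmon M)))"
    using assms by (auto simp: bact_junk)
  then show ?thesis
    unfolding act_def using vp.construct_scale[OF indep, of 0 "\<lambda>b. lin_ext (bact b) (bmon M)" v] by simp
qed

lemma law_monomials: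
  assumes "\<And>M. M \<in> keys s \<Longrightarrow> set_mset M \<subseteq> B \<Longrightarrow> law u v (bmon M)"
  shows "law u v s"
proof -
  have m: "law u v (bmon M)" if "M \<in> keys s" for M
    using assms[OF that] act_junk by (cases "set_mset M \<subseteq> B") (auto simp: law_def)
  have "law u v (\<Sum>M\<in>A. Poly_Mapping.single M (lookup s M))" if "finite A" "A \<subseteq> keys s" for A
    using that
  proof (induction A rule: finite_induct)
    case empty
    then show ?case by (simp add: law_def)
  next
    case (insert M A)
    then show ?case using law_scal[OF m[of M], of "lookup s M"] by (auto simp: bmon_def intro!: law_add)
  qed
  then show ?thesis using poly_mapping_sum_single[of s] by (metis finite_keys order_refl)
qed

lemma law_below:
  assumes "set_mset M \<subseteq> B" "b \<in> B" "j \<in> B" "below j M"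
  shows "law b j (bmon M)"
proof -
  have core: "law b j (bmon M)" if "b \<in> B" "j \<in> B" "below j M" "le j b" "j \<noteq> b" for b j
    using act_recursion[OF assms(1) that] bact_below[OF assms(1) that(3)] that(2)
    by (simp add: law_def act_basis[of j "bmon M"])
  consider "b = j" | "le j b" "j \<noteq> b" | "le b j" "j \<noteq> b" using le_total by blast
  then show ?thesis
  proof cases
    case 1
    then show ?thesis by (simp add: law_def bracket_self)
  next
    case 2
    then show ?thesis using core assms by blast
  next
    case 3
    then have "below b M" using assms(4) le_trans by (auto simp: below_def)
    then show ?thesis using core[of j b] 3 assms by (auto intro: law_swap)
  qed
qed

lemma act_degree:
  assumes "b \<in> B" "set_mset M \<subseteq> B"
  shows "act b (bmon M) - bmon (add_mset b M) \<in> size_le (size M)"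
  using bact_degree[OF assms] assms(1) by (simp add: act_basis)

text \<open>
  The commutation law holds for letters \<open>b\<close>, \<open>j\<close> on a monomial \<open>M\<close> by construction when one of
  them is at most all letters of \<open>M\<close>. Otherwise the smallest letter \<open>j\<close> of \<open>M = j N\<close> is smaller
  than both letters; moving it to the front reduces the claim to \<open>N\<close>, and the remaining terms
  cancel by the Jacobi identity.
\<close>

lemma law_mon: "set_mset M \<subseteq> B \<Longrightarrow> law u v (bmon M)"
proof (induction "size M" arbitrary: M u v rule: less_induct)
  case (less M)
  show ?case
  proof (rule law_basis_imp_law)
    fix b c assume bc: "b \<in> B" "c \<in> B"
    show "law b c (bmon M)"
    proof (cases "below b M \<or> below c M")
      case True
      then show ?thesis using law_below bc less.prems law_swap by blast
    next
      case False
      define j where "j = least_letter M"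
      define N where "N = M - {#j#}"
      have ne: "M \<noteq> {#}" using False by (auto simp: below_def)
      have M: "M = add_mset j N" unfolding N_def j_def using least_letter[OF ne] by simp
      have N: "set_mset N \<subseteq> B" "j \<in> B" using less.prems M by auto
      have jM: "below j M" unfolding j_def using least_letter[OF ne] by simp
      have jb: "below j (add_mset b N)" "below j (add_mset c N)" "below j N"
        using False jM le_total le_trans M by (auto simp: below_def)
      have IH: "law u v s" if "s \<in> size_le (size N)" for u v s
      proof (rule law_monomials)
        fix K assume "K \<in> keys s" "set_mset K \<subseteq> B"
        then show "law u v (bmon K)" using that M less.hyps by (auto simp: size_le_def)
      qed
      let ?n = "bmon N"
      have nn: "?n \<in> size_le (size N)" using N by (intro bmon_in_size_le) auto
      have zM: "bmon M = act j ?n" using bact_below[OF N(1) jb(3)] N(2) M by (simp add: act_basis)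
      have lawj: "law d j (act e ?n)" if "d \<in> B" "e \<in> B" "below j (add_mset e N)" for d e
      proof -
        have "law d j (bmon (add_mset e N))" using that N by (intro law_below) auto
        moreover have "law d j (act e ?n - bmon (add_mset e N))"
          by (rule IH, rule act_degree) (use that N in auto)
        ultimately show ?thesis using law_add by fastforce
      qed
      have 1: "act d (act e (act j ?n)) = act j (act d (act e ?n)) + act (bracket d j) (act e ?n)
          + act (bracket e j) (act d ?n) + act (bracket d (bracket e j)) ?n"
        if "d \<in> B" "e \<in> B" "below j (add_mset e N)" for d e
      proof -
        have "act e (act j ?n) = act j (act e ?n) + act (bracket e j) ?n"
          using IH[OF nn, of e j] by (simp add: law_def algebra_simps)
        moreover have "act d (act j (act e ?n)) = act j (act d (act e ?n)) + act (bracket d j) (act e ?n)"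
          using lawj[OF that] by (simp add: law_def algebra_simps)
        moreover have "act d (act (bracket e j) ?n) = act (bracket e j) (act d ?n) + act (bracket d (bracket e j)) ?n"
          using IH[OF nn, of d "bracket e j"] by (simp add: law_def algebra_simps)
        ultimately show ?thesis by (simp add: act_add)
      qed
      have J: "bracket b (bracket c j) - bracket c (bracket b j) = bracket (bracket b c) j"
        unfolding bracket_bracket_right[of b c j] bracket_swap[of "bracket b j" c] by simp
      have "act b (act c (bmon M)) - act c (act b (bmon M)) =
          act j (act b (act c ?n) - act c (act b ?n)) + act (bracket (bracket b c) j) ?n"
        unfolding zM 1[OF bc jb(2)] 1[OF bc(2,1) jb(1)] J[symmetric] act_diff act_diff_left by simp
      also have "act b (act c ?n) - act c (act b ?n) = act (bracket b c) ?n"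
        using IH[OF nn, of b c] by (simp add: law_def)
      also have "act j (act (bracket b c) ?n) + act (bracket (bracket b c) j) ?n = act (bracket b c) (act j ?n)"
        using IH[OF nn, of "bracket b c" j] by (simp add: law_def algebra_simps)
      finally show ?thesis by (simp add: law_def zM)
    qed
  qed
qed

theorem act_bracket: "act (bracket u v) s = act u (act v s) - act v (act u s)"
  using law_monomials[of s u v] law_mon by (simp add: law_def)

primrec wact :: "'a list \<Rightarrow> ('a multiset \<Rightarrow>\<^sub>0 'f) \<Rightarrow> ('a multiset \<Rightarrow>\<^sub>0 'f)" where
  "wact [] s = s"
| "wact (v # w) s = act v (wact w s)"

lemma wact_append: "wact (u @ v) s = wact u (wact v s)"
  by (induction u) simp_all

definition tact :: "('a free_mon \<Rightarrow>\<^sub>0 'f) \<Rightarrow> ('a multiset \<Rightarrow>\<^sub>0 'f) \<Rightarrow> ('a multiset \<Rightarrow>\<^sub>0 'f)" where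
  "tact t s = lin_ext (\<lambda>m. case m of Free_Mon w \<Rightarrow> wact w s) t"

lemma wact_add: "wact w (s + t) = wact w s + wact w t"
  by (induction w) (simp_all add: act_add)

lemma wact_scal: "wact w (scal c s) = scal c (wact w s)"
  by (induction w) (simp_all add: act_scal)

lemma tact_single [simp]: "tact (Poly_Mapping.single (Free_Mon w) c) s = scal c (wact w s)"
  by (simp add: tact_def)

lemma tact_add_left: "tact (t + u) s = tact t s + tact u s"
  by (simp add: tact_def lin_ext_add)

lemma tact_diff_left: "tact (t - u) s = tact t s - tact u s"
  by (simp add: tact_def lin_ext_diff)

lemma tact_scal_left: "tact (scal c t) s = scal c (tact t s)"
  by (simp add: tact_def lin_ext_scal)

lemma tact_add: "tact t (s + s') = tact t s + tact t s'"
proof (induction t rule: poly_mapping_linear_induct)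
  case (single k c)
  then show ?case by (cases k) (simp add: wact_add pm.scale_right_distrib)
qed (simp add: tact_add_left algebra_simps)

lemma tact_scal: "tact t (scal c s) = scal c (tact t s)"
proof (induction t rule: poly_mapping_linear_induct)
  case (single k d)
  then show ?case by (cases k) (simp add: wact_scal mult.commute)
qed (simp add: tact_add_left pm.scale_right_distrib)

lemma tact_zero [simp]: "tact t 0 = 0"
  using tact_add[of t 0 0] by simp

lemma tact_mult: "tact (t * u) s = tact t (tact u s)"
proof (induction t rule: poly_mapping_linear_induct)
  case (single k c)
  show ?case
  proof (induction u rule: poly_mapping_linear_induct)
    case (single l d)
    then show ?case by (cases k; cases l) (simp add: mult_single wact_append wact_scal)
  qed (simp add: distrib_left tact_add_left tact_add)
qed (simp add: distrib_right tact_add_left)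

lemma tact_free_gen [simp]: "tact (free_gen v) s = act v s"
  by (simp add: free_gen_def)

lemma tact_one [simp]: "tact 1 s = s"
  by (metis tact_single pm.scale_one single_one wact.simps(1) zero_free_mon_def)

end

section \<open>Two-sided ideals and congruence\<close>

definition two_sided :: "'r::ring_1 set \<Rightarrow> bool" where
  "two_sided I \<longleftrightarrow> 0 \<in> I \<and> (\<forall>a\<in>I. \<forall>b\<in>I. a + b \<in> I) \<and> (\<forall>a\<in>I. \<forall>t. t * a \<in> I \<and> a * t \<in> I)"

definition gen_ideal :: "'r::ring_1 set \<Rightarrow> 'r set" where
  "gen_ideal S = \<Inter>{I. two_sided I \<and> S \<subseteq> I}"

lemma two_sided_gen_ideal: "two_sided (gen_ideal S)"
  unfolding two_sided_def gen_ideal_def by blast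

lemma gen_ideal_superset: "S \<subseteq> gen_ideal S"
  unfolding gen_ideal_def by blast

lemma gen_ideal_minimal: "two_sided I \<Longrightarrow> S \<subseteq> I \<Longrightarrow> gen_ideal S \<subseteq> I"
  unfolding gen_ideal_def by blast

lemma gen_ideal_mono: "S \<subseteq> S' \<Longrightarrow> gen_ideal S \<subseteq> gen_ideal S'"
  unfolding gen_ideal_def by blast

lemma two_sided_zero: "two_sided I \<Longrightarrow> 0 \<in> I"
  and two_sided_add: "two_sided I \<Longrightarrow> a \<in> I \<Longrightarrow> b \<in> I \<Longrightarrow> a + b \<in> I"
  and two_sided_mult_left: "two_sided I \<Longrightarrow> a \<in> I \<Longrightarrow> t * a \<in> I"
  and two_sided_mult_right: "two_sided I \<Longrightarrow> a \<in> I \<Longrightarrow> a * t \<in> I"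
  unfolding two_sided_def by auto

lemma two_sided_minus: "two_sided I \<Longrightarrow> a \<in> I \<Longrightarrow> - a \<in> I"
  using two_sided_mult_left[of I a "-1"] by simp

lemma two_sided_diff: "two_sided I \<Longrightarrow> a \<in> I \<Longrightarrow> b \<in> I \<Longrightarrow> a - b \<in> I"
  using two_sided_add[of I a "- b"] two_sided_minus[of I b] by simp

lemma two_sided_scal: "two_sided I \<Longrightarrow> a \<in> I \<Longrightarrow> scal c a \<in> I"
  unfolding scal_def by (rule two_sided_mult_left)

lemma two_sided_comm: "two_sided I \<Longrightarrow> a \<in> I \<Longrightarrow> comm a b \<in> I"
  unfolding comm_def by (intro two_sided_diff two_sided_mult_left two_sided_mult_right)

lemma subspace_two_sided: "two_sided I \<Longrightarrow> pm.subspace I"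
  by (intro pm.subspaceI two_sided_zero two_sided_add two_sided_scal)

definition eqm :: "'r::ring_1 set \<Rightarrow> 'r \<Rightarrow> 'r \<Rightarrow> bool" where
  "eqm I a b \<longleftrightarrow> a - b \<in> I"

lemma eqm_refl: "two_sided I \<Longrightarrow> eqm I a a"
  by (simp add: eqm_def two_sided_zero)

lemma eqm_sym: "two_sided I \<Longrightarrow> eqm I a b \<Longrightarrow> eqm I b a"
  unfolding eqm_def using two_sided_minus[of I "a - b"] by simp

lemma eqm_trans: "two_sided I \<Longrightarrow> eqm I a b \<Longrightarrow> eqm I b c \<Longrightarrow> eqm I a c"
  unfolding eqm_def using two_sided_add[of I "a - b" "b - c"] by simp

lemma eqm_add: "two_sided I \<Longrightarrow> eqm I a b \<Longrightarrow> eqm I c d \<Longrightarrow> eqm I (a + c) (b + d)"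
  unfolding eqm_def using two_sided_add[of I "a - b" "c - d"] by (simp add: algebra_simps)

lemma eqm_diff: "two_sided I \<Longrightarrow> eqm I a b \<Longrightarrow> eqm I c d \<Longrightarrow> eqm I (a - c) (b - d)"
  unfolding eqm_def using two_sided_diff[of I "a - b" "c - d"] by (simp add: algebra_simps)

lemma eqm_mult:
  assumes "two_sided I" "eqm I a b" "eqm I c d"
  shows "eqm I (a * c) (b * d)"
proof -
  have "a * c - b * d = (a - b) * c + b * (c - d)" by (simp add: algebra_simps)
  then show ?thesis using assms unfolding eqm_def
    by (simp add: two_sided_add two_sided_mult_left two_sided_mult_right)
qed

lemma eqm_scal: "two_sided I \<Longrightarrow> eqm I a b \<Longrightarrow> eqm I (scal c a) (scal c b)"
  unfolding eqm_def pm.scale_right_diff_distrib[symmetric] by (rule two_sided_scal)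

lemma eqm_comm: "two_sided I \<Longrightarrow> eqm I a b \<Longrightarrow> eqm I c d \<Longrightarrow> eqm I (comm a c) (comm b d)"
  unfolding comm_def by (intro eqm_diff eqm_mult)

lemma eqm_power: "two_sided I \<Longrightarrow> eqm I a b \<Longrightarrow> eqm I (a ^ n) (b ^ n)"
  by (induction n) (simp_all add: eqm_refl eqm_mult)

lemma eqm_mono: "I \<subseteq> I' \<Longrightarrow> eqm I a b \<Longrightarrow> eqm I' a b"
  unfolding eqm_def by blast

lemma eqm_mem: "two_sided I \<Longrightarrow> eqm I a b \<Longrightarrow> b \<in> I \<Longrightarrow> a \<in> I"
  unfolding eqm_def using two_sided_add[of I "a - b" b] by simp

section \<open>The restricted enveloping ideal\<close>

lemma (in lie_algebra) coeff_jacobson_iterate: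
  "Polynomial.coeff
     (((\<lambda>v. pCons 0 (map_poly (bracket x) v) + map_poly (bracket y) v) ^^ k) [:x:]) n
   = jacobson_coeff bracket x y k n"
proof (induction k arbitrary: n)
  case 0
  then show ?case by (cases n) simp_all
next
  case (Suc k)
  then show ?case by (cases n) (simp_all add: coeff_map_poly)
qed

lemma (in lie_algebra) jacobson_s_eq:
  "jacobson_s scale bracket q i x y = scale (inverse (of_nat i)) (jacobson_coeff bracket x y (q - 1) (i - 1))"
  unfolding jacobson_s_def coeff_jacobson_iterate ..

context restricted_lie_algebra begin

lemma prime_p: "prime p"
  using char_pos prime_CHAR_semidom[where 'a = 'f] unfolding char_eq by simp

lemma p_ge_2: "p \<ge> 2"
  using prime_p by (rule prime_ge_2_nat)

lemma pmap_zero [simp]: "pmap 0 = 0"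
  using pmap_scale[of 0 0] char_pos by (simp add: zero_power)

lemma of_nat_p_poly_mapping: "of_nat p = (0 :: 'm::monoid_add \<Rightarrow>\<^sub>0 'f)"
  unfolding char_eq[symmetric] by (rule of_nat_char_poly_mapping)

lemma of_nat_less_p: "0 < i \<Longrightarrow> i < p \<Longrightarrow> of_nat i \<noteq> (0 :: 'f)"
  unfolding of_nat_eq_0_iff_char_dvd char_eq by (auto dest: dvd_imp_le)

definition env_ideal :: "('a free_mon \<Rightarrow>\<^sub>0 'f) set" where
  "env_ideal = gen_ideal (restricted_relators scale bracket p pmap)"

lemma two_sided_env_ideal: "two_sided env_ideal"
  unfolding env_ideal_def by (rule two_sided_gen_ideal)

lemma env_relators: "restricted_relators scale bracket p pmap \<subseteq> env_ideal"
  unfolding env_ideal_def by (rule gen_ideal_superset)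

lemma env_add: "eqm env_ideal (free_gen (x + y)) (free_gen x + free_gen y)"
  and env_scale: "eqm env_ideal (free_gen (scale c x)) (scal c (free_gen x))"
  and env_bracket: "eqm env_ideal (free_gen (bracket x y)) (comm (free_gen x) (free_gen y))"
  and env_pmap: "eqm env_ideal (free_gen (pmap x)) (free_gen x ^ p)"
  unfolding eqm_def scal_def comm_def
  by (rule subsetD[OF env_relators], force simp: restricted_relators_def)+

lemma free_gen_zero_mem: "free_gen 0 \<in> env_ideal"
  using env_scale[of 0 0] by (simp add: eqm_def)

end

section \<open>The Poincare--Birkhoff--Witt theorem for restricted enveloping algebras\<close>

locale restricted_basis = restricted_lie_algebra scale bracket p pmap + ordered_basis scale bracket B le
  for scale :: "'f::field \<Rightarrow> 'a::ab_group_add \<Rightarrow> 'a" and bracket p pmap B le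
begin

lemma tact_zero_left [simp]: "tact 0 s = 0"
  by (simp add: tact_def)

lemma tact_power: "tact (t ^ n) s = (tact t ^^ n) s"
  by (induction n) (simp_all add: tact_mult)

lemma tact_comm: "tact (comm t u) s = tact t (tact u s) - tact u (tact t s)"
  by (simp add: comm_def tact_diff_left tact_mult)

lemma tact_comm_iterate: "tact ((comm (free_gen v) ^^ n) (free_gen x)) s = act ((bracket v ^^ n) x) s"
  by (induction n arbitrary: s) (simp_all add: tact_comm act_bracket)

lemma tact_jacobson_coeff:
  "tact (jacobson_coeff comm (free_gen x) (free_gen y) k n) s = act (jacobson_coeff bracket x y k n) s"
  by (induction k arbitrary: n s)
     (simp_all add: tact_comm act_bracket tact_add_left act_add_left)

text \<open>
  The action of \<open>v\<^sup>p - v\<^sup>[\<^sup>p\<^sup>]\<close>, which commutes with \<open>L\<close> since both terms induce the derivation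
  \<open>ad(v)\<^sup>p\<close>.
\<close>

definition cact :: "'a \<Rightarrow> ('a multiset \<Rightarrow>\<^sub>0 'f) \<Rightarrow> ('a multiset \<Rightarrow>\<^sub>0 'f)" where
  "cact v s = tact (free_gen v ^ p - free_gen (pmap v)) s"

lemma cact_add: "cact v (s + t) = cact v s + cact v t"
  and cact_scal: "cact v (scal c s) = scal c (cact v s)"
  by (simp_all add: cact_def tact_add tact_scal)

lemma cact_act: "cact v (act x s) = act x (cact v s)"
proof -
  have "tact (comm (free_gen v ^ p - free_gen (pmap v)) (free_gen x)) s = 0"
    unfolding comm_diff_left tact_diff_left
      comm_iterate_prime[OF prime_p of_nat_p_poly_mapping, symmetric] tact_comm_iterate
    by (simp add: tact_comm flip: act_bracket bracket_pmap)
  then show ?thesis by (simp add: tact_comm cact_def)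
qed

lemma cact_tact: "cact v (tact t s) = tact t (cact v s)"
proof (induction t rule: poly_mapping_linear_induct)
  case (single k c)
  obtain w where k: "k = Free_Mon w" by (cases k)
  have "cact v (wact w s) = wact w (cact v s)"
    by (induction w) (simp_all add: cact_act)
  then show ?case by (simp add: k cact_scal)
qed (simp add: tact_add_left cact_add)

lemma cact_commute: "cact v (cact u s) = cact u (cact v s)"
  unfolding cact_def[of u] by (rule cact_tact)

lemma act_top:
  assumes "b \<in> B" "s \<in> size_le n"
  shows "act b s - bmon {#b#} * s \<in> size_le n"
proof -
  have "act b s - bmon {#b#} * s = lin_ext (\<lambda>M. bact b M - bmon (add_mset b M)) s"
  proof (induction s rule: poly_mapping_linear_induct)
    case (single M c)
    then show ?case using assms(1)
      by (simp add: act_basis bmon_def mult_single pm.scale_right_diff_distrib)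
  qed (simp add: act_add lin_ext_add algebra_simps)
  also have "\<dots> \<in> size_le n"
  proof (intro lin_ext_in_subspace subspace_size_le)
    fix M assume "M \<in> keys s"
    then have M: "set_mset M \<subseteq> B" "size M \<le> n" using assms(2) by (auto simp: size_le_def)
    show "bact b M - bmon (add_mset b M) \<in> size_le n"
      using bact_degree[OF assms(1) M(1)] size_le_mono[OF M(2)] by blast
  qed
  finally show ?thesis .
qed

lemma bmon_mult_size_le:
  assumes "set_mset K \<subseteq> B" "s \<in> size_le n"
  shows "bmon K * s \<in> size_le (size K + n)"
  unfolding size_le_def
proof (intro CollectI ballI)
  fix M assume "M \<in> keys (bmon K * s)"
  then have "M \<in> {a + b |a b. a \<in> keys (bmon K :: _ \<Rightarrow>\<^sub>0 'f) \<and> b \<in> keys s}" using keys_mult by blast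
  then obtain N where "M = K + N" "N \<in> keys s" by (auto simp: bmon_def)
  then show "set_mset M \<subseteq> B \<and> size M \<le> size K + n" using assms by (auto simp: size_le_def)
qed

lemma act_size_le:
  assumes "s \<in> size_le n"
  shows "act v s \<in> size_le (Suc n)"
proof -
  have *: "lin_ext (bact b) s \<in> size_le (Suc n)" if "b \<in> B" for b
  proof -
    have 1: "act b s - bmon {#b#} * s \<in> size_le (Suc n)"
      using act_top[OF that assms] size_le_mono[of n "Suc n"] by auto
    have 2: "bmon {#b#} * s \<in> size_le (Suc n)"
      using bmon_mult_size_le[of "{#b#}" s n] that assms by simp
    show ?thesis
      using pm.subspace_add[OF subspace_size_le 1 2] act_basis[OF that, of s] by simp
  qed
  then have "pm.span ((\<lambda>b. lin_ext (bact b) s) ` B) \<subseteq> size_le (Suc n)"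
    by (intro pm.span_minimal subspace_size_le) auto
  then show ?thesis unfolding act_def using vp.construct_in_span[OF indep] by blast
qed

lemma act_power_top:
  assumes "b \<in> B" "s \<in> size_le n"
  shows "(act b ^^ Suc k) s - bmon (replicate_mset (Suc k) b) * s \<in> size_le (n + k)"
proof (induction k)
  case 0
  then show ?case using act_top[OF assms] by simp
next
  case (Suc k)
  define x where "x = bmon (replicate_mset (Suc k) b) * s"
  define r where "r = (act b ^^ Suc k) s - x"
  have r: "act b r \<in> size_le (n + Suc k)"
    using Suc act_size_le[of r "n + k" b] by (simp add: r_def x_def)
  have "x \<in> size_le (n + Suc k)"
    using bmon_mult_size_le[of "replicate_mset (Suc k) b" s n] assms
    by (auto simp: x_def add.commute split: if_splits)
  then have x: "act b x - bmon {#b#} * x \<in> size_le (n + Suc k)" by (rule act_top[OF assms(1)])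
  have "(act b ^^ Suc (Suc k)) s = act b x + act b r"
    by (simp add: r_def flip: act_add)
  moreover have "bmon {#b#} * x = bmon (replicate_mset (Suc (Suc k)) b) * s"
    by (simp add: x_def bmon_def mult_single flip: mult.assoc)
  ultimately have "(act b ^^ Suc (Suc k)) s - bmon (replicate_mset (Suc (Suc k)) b) * s
      = (act b x - bmon {#b#} * x) + act b r" by simp
  then show ?case using pm.subspace_add[OF subspace_size_le x r] by simp
qed

lemma cact_top:
  assumes "b \<in> B" "s \<in> size_le n"
  shows "cact b s - bmon (replicate_mset p b) * s \<in> size_le (n + (p - 1))"
proof -
  have "tact (free_gen b) = act b" by (rule ext) simp
  then have 1: "cact b s = (act b ^^ Suc (p - 1)) s - act (pmap b) s"
    using p_ge_2 by (simp add: cact_def tact_diff_left tact_power)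
  have low: "act (pmap b) s \<in> size_le (n + (p - 1))"
  proof -
    have "Suc n \<le> n + (p - 1)" using p_ge_2 by linarith
    then show ?thesis using act_size_le[OF assms(2), of "pmap b"] size_le_mono by blast
  qed
  have "Suc (p - 1) = p" using p_ge_2 by simp
  with 1 have "cact b s - bmon (replicate_mset p b) * s =
      ((act b ^^ Suc (p - 1)) s - bmon (replicate_mset (Suc (p - 1)) b) * s) - act (pmap b) s"
    by simp
  also have "\<dots> \<in> size_le (n + (p - 1))"
    by (rule pm.subspace_diff[OF subspace_size_le act_power_top[OF assms, of "p - 1"] low])
  finally show ?thesis .
qed

definition truncated :: "'a multiset \<Rightarrow> bool" where
  "truncated M \<longleftrightarrow> (\<forall>b. count M b < p)"

definition overflow :: "'a multiset \<Rightarrow> 'a" where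
  "overflow M = (SOME b. p \<le> count M b)"

lemma overflow: "\<not> truncated M \<Longrightarrow> p \<le> count M (overflow M)"
  unfolding truncated_def overflow_def by (rule someI_ex) (auto simp: not_less)

lemma overflow_split: "p \<le> count M b \<Longrightarrow> \<exists>N. M = N + replicate_mset p b"
  by (metis count_le_replicate_mset_subset_eq subset_mset.diff_add)

text \<open>
  The family \<open>E M\<close> replaces every full \<open>p\<close>-th power \<open>b\<^sup>p\<close> in a monomial by the central element
  \<open>b\<^sup>p - b\<^sup>[\<^sup>p\<^sup>]\<close>. It is unitriangular over the monomials, hence another basis, and the relations
  \<open>b\<^sup>p = b\<^sup>[\<^sup>p\<^sup>]\<close> kill exactly those \<open>E M\<close> for which \<open>M\<close> has an exponent at least \<open>p\<close>.
\<close>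

function E :: "'a multiset \<Rightarrow> ('a multiset \<Rightarrow>\<^sub>0 'f)" where
  "E M = (if \<not> set_mset M \<subseteq> B \<or> truncated M then bmon M
     else cact (overflow M) (E (M - replicate_mset p (overflow M))))"
  by auto
termination
proof (relation "measure size")
  fix M assume "\<not> (\<not> set_mset M \<subseteq> B \<or> truncated M)"
  then obtain N where N: "M = N + replicate_mset p (overflow M)"
    using overflow_split[OF overflow] by auto
  have "M - replicate_mset p (overflow M) = N" by (subst (1) N) simp
  moreover have "size M = size N + p" by (subst N) simp
  ultimately show "(M - replicate_mset p (overflow M), M) \<in> measure size" using p_ge_2 by simp
qed simp

declare E.simps [simp del]

lemma E_fixed: "\<not> set_mset M \<subseteq> B \<or> truncated M \<Longrightarrow> E M = bmon M"
  by (simp add: E.simps)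

lemma E_overflow:
  assumes "\<not> truncated M" "set_mset M \<subseteq> B"
  obtains b N where "M = N + replicate_mset p b" "b \<in> B" "set_mset N \<subseteq> B" "E M = cact b (E N)"
proof -
  obtain N where N: "M = N + replicate_mset p (overflow M)"
    using overflow_split[OF overflow[OF assms(1)]] by auto
  have "M - replicate_mset p (overflow M) = N" by (subst (1) N) simp
  then have "E M = cact (overflow M) (E N)" using assms by (subst E.simps) simp
  moreover have "0 < count M (overflow M)" using overflow[OF assms(1)] p_ge_2 by linarith
  then have "overflow M \<in># M" by simp
  moreover have "set_mset N \<subseteq> B" using assms(2) by (subst (asm) N) simp
  ultimately show thesis using that N assms(2) by blast
qed

lemma cact_E: "b \<in> B \<Longrightarrow> set_mset M \<subseteq> B \<Longrightarrow> cact b (E M) = E (M + replicate_mset p b)"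
proof (induction "size M" arbitrary: M b rule: less_induct)
  case (less M b)
  define K where "K = M + replicate_mset p b"
  have "p \<le> count K b" by (simp add: K_def)
  then have nt: "\<not> truncated K" unfolding truncated_def not_all not_less by (rule exI)
  have "set_mset K \<subseteq> B" using less.prems by (auto simp: K_def split: if_splits)
  with nt obtain c N where K: "K = N + replicate_mset p c" "c \<in> B" "set_mset N \<subseteq> B"
    "E K = cact c (E N)" by (rule E_overflow)
  show ?case
  proof (cases "c = b")
    case True
    then have "M = N" using K(1) by (simp add: K_def)
    then show ?thesis using K(4) True by (simp only: K_def)
  next
    case False
    have 1: "count M c = count K c" using False by (simp add: K_def)
    have "p \<le> count K c" unfolding K(1) by simp
    then have "p \<le> count M c" unfolding 1 .
    from overflow_split[OF this] obtain L where L: "M = L + replicate_mset p c" by (rule exE)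
    have "N + replicate_mset p c = (L + replicate_mset p b) + replicate_mset p c"
      unfolding K(1)[symmetric] K_def unfolding L by (simp only: ac_simps)
    then have N: "N = L + replicate_mset p b" by (rule add_right_imp_eq)
    have "size M = size L + p" unfolding L by simp
    then have sL: "size L < size M" using p_ge_2 by linarith
    have bL: "set_mset L \<subseteq> B" using less.prems(2) unfolding L by simp
    have "E K = cact c (cact b (E L))" unfolding K(4) N less.hyps[OF sL less.prems(1) bL] ..
    also have "\<dots> = cact b (cact c (E L))" by (rule cact_commute)
    also have "cact c (E L) = E M" unfolding less.hyps[OF sL K(2) bL] L ..
    finally show ?thesis by (simp only: K_def)
  qed
qed

lemma E_lower: "set_mset M \<subseteq> B \<Longrightarrow> K \<in> keys (E M - bmon M) \<Longrightarrow> set_mset K \<subseteq> B \<and> size K < size M"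
proof (induction "size M" arbitrary: M K rule: less_induct)
  case (less M)
  show ?case
  proof (cases "truncated M")
    case True
    then show ?thesis using less.prems by (simp add: E_fixed)
  next
    case False
    then obtain b N where M: "M = N + replicate_mset p b" "b \<in> B" "set_mset N \<subseteq> B" "E M = cact b (E N)"
      using less.prems(1) by (rule E_overflow)
    have sN: "size N < size M" "size M = size N + p" using M(1) p_ge_2 by auto
    let ?n = "size N + (p - 1)"
    have d: "E N - bmon N \<in> size_le (size N)"
      using less.hyps[OF sN(1) M(3)] by (fastforce simp: size_le_def)
    then have "E N \<in> size_le (size N)"
      using pm.subspace_add[OF subspace_size_le d bmon_in_size_le[OF M(3) order_refl]] by simp
    from cact_top[OF M(2) this] have 1: "E M - bmon (replicate_mset p b) * E N \<in> size_le ?n"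
      by (simp add: M(4))
    have 2: "bmon (replicate_mset p b) * (E N - bmon N) \<in> size_le ?n"
    proof (cases "size N = 0")
      case True
      then have "N = {#}" by simp
      moreover have "truncated {#}" using p_ge_2 by (simp add: truncated_def)
      ultimately show ?thesis by (simp add: E_fixed pm.subspace_0[OF subspace_size_le])
    next
      case False
      then have "E N - bmon N \<in> size_le (size N - 1)"
        using less.hyps[OF sN(1) M(3)] by (fastforce simp: size_le_def)
      then have "bmon (replicate_mset p b) * (E N - bmon N) \<in> size_le (p + (size N - 1))"
        using bmon_mult_size_le[of "replicate_mset p b" _ "size N - 1"] M(2) by (auto split: if_splits)
      then show ?thesis using False p_ge_2 by (simp add: add.commute)
    qed
    have "bmon (replicate_mset p b) * bmon N = (bmon M :: 'a multiset \<Rightarrow>\<^sub>0 'f)"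
      by (simp add: bmon_def mult_single M(1) add.commute)
    then have e: "E M - bmon M = (E M - bmon (replicate_mset p b) * E N) + bmon (replicate_mset p b) * (E N - bmon N)"
      by (simp add: right_diff_distrib)
    have "E M - bmon M \<in> size_le ?n" unfolding e by (rule pm.subspace_add[OF subspace_size_le 1 2])
    then show ?thesis using less.prems(2) sN(2) p_ge_2 by (fastforce simp: size_le_def)
  qed
qed

lemma lin_ext_E_injective:
  assumes "lin_ext E s = 0"
  shows "s = 0"
proof (rule ccontr)
  assume "s \<noteq> 0"
  then have "keys s \<noteq> {}" by simp
  then obtain M where M: "M \<in> keys s" "\<And>K. K \<in> keys s \<Longrightarrow> size K \<le> size M"
  proof -
    have "Max (size ` keys s) \<in> size ` keys s" using \<open>keys s \<noteq> {}\<close> by (intro Max_in) auto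
    then show thesis using that by (metis (no_types, lifting) Max_ge finite_imageI finite_keys imageE imageI)
  qed
  have "lookup (E K) M = (if K = M then 1 else 0)" if "K \<in> keys s" for K
  proof -
    have "M \<notin> keys (E K - bmon K)"
      using E_lower[of K M] E_fixed[of K] M(2)[OF that] by (cases "set_mset K \<subseteq> B") auto
    then show ?thesis by (simp add: in_keys_iff lookup_minus bmon_def lookup_single when_def)
  qed
  then have "lookup (lin_ext E s) M = (\<Sum>K\<in>keys s. lookup s K * (if K = M then 1 else 0))"
    unfolding lin_ext_def lookup_sum lookup_scal by (intro sum.cong) auto
  then show False using assms M(1) by (simp add: in_keys_iff if_distrib cong: if_cong)
qed

lemma lin_ext_bmon_id: "lin_ext bmon s = s"
  by (induction s rule: poly_mapping_linear_induct) (simp_all add: bmon_def lin_ext_add)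

lemma subspace_range_lin_ext: "pm.subspace (range (lin_ext f))"
proof (rule pm.subspaceI)
  show "0 \<in> range (lin_ext f)" by (metis lin_ext_zero rangeI)
qed (auto simp flip: lin_ext_add lin_ext_scal)

lemma lin_ext_E_surjective: "\<exists>s'. s = lin_ext E s'"
proof -
  have "bmon M \<in> range (lin_ext E)" for M
  proof (induction "size M" arbitrary: M rule: less_induct)
    case (less M)
    show ?case
    proof (cases "set_mset M \<subseteq> B")
      case False
      then show ?thesis using E_fixed[of M] lin_ext_mon[of E M] by (metis rangeI)
    next
      case True
      have 1: "E M - bmon M \<in> range (lin_ext E)"
      proof -
        have "lin_ext bmon (E M - bmon M) \<in> range (lin_ext E)"
          using E_lower[OF True] less.hyps by (intro lin_ext_in_subspace subspace_range_lin_ext) blast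
        then show ?thesis by (simp only: lin_ext_bmon_id)
      qed
      have "lin_ext E (bmon M) - (E M - bmon M) \<in> range (lin_ext E)"
        by (rule pm.subspace_diff[OF subspace_range_lin_ext rangeI 1])
      then show ?thesis by simp
    qed
  qed
  then have "lin_ext bmon s \<in> range (lin_ext E)" by (intro lin_ext_in_subspace subspace_range_lin_ext)
  then show ?thesis by (auto simp: lin_ext_bmon_id)
qed

definition overflow_space :: "('a multiset \<Rightarrow>\<^sub>0 'f) set" where
  "overflow_space = lin_ext E ` {s. \<forall>M\<in>keys s. \<not> truncated M}"

lemma subspace_overflow_space: "pm.subspace overflow_space"
  unfolding overflow_space_def
proof (rule pm.subspaceI)
  show "0 \<in> lin_ext E ` {s. \<forall>M\<in>keys s. \<not> truncated M}" by (rule image_eqI[of _ _ 0]) simp_all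
next
  fix x y c assume "x \<in> lin_ext E ` {s. \<forall>M\<in>keys s. \<not> truncated M}"
  then obtain s where s: "x = lin_ext E s" "s \<in> {s. \<forall>M\<in>keys s. \<not> truncated M}" by auto
  show "scal c x \<in> lin_ext E ` {s. \<forall>M\<in>keys s. \<not> truncated M}"
    using pm.subspace_scale[OF subspace_keys s(2), of c] s(1) by (auto simp flip: lin_ext_scal)
  assume "y \<in> lin_ext E ` {s. \<forall>M\<in>keys s. \<not> truncated M}"
  then obtain t where t: "y = lin_ext E t" "t \<in> {s. \<forall>M\<in>keys s. \<not> truncated M}" by auto
  show "x + y \<in> lin_ext E ` {s. \<forall>M\<in>keys s. \<not> truncated M}"
    using pm.subspace_add[OF subspace_keys s(2) t(2)] s(1) t(1) by (auto simp flip: lin_ext_add)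
qed

lemma E_in_overflow_space: "\<not> truncated M \<Longrightarrow> E M \<in> overflow_space"
  unfolding overflow_space_def by (rule image_eqI[of _ _ "bmon M"]) (simp_all, simp add: bmon_def)

lemma cact_in_overflow_space:
  assumes "b \<in> B"
  shows "cact b s \<in> overflow_space"
proof -
  obtain s' where s: "s = lin_ext E s'" using lin_ext_E_surjective by blast
  have "cact b (lin_ext E s') = lin_ext (\<lambda>M. cact b (E M)) s'"
    by (induction s' rule: poly_mapping_linear_induct) (simp_all add: lin_ext_add cact_add cact_scal)
  also have "\<dots> \<in> overflow_space"
  proof (intro lin_ext_in_subspace subspace_overflow_space)
    fix M
    show "cact b (E M) \<in> overflow_space"
    proof (cases "set_mset M \<subseteq> B")
      case True
      have "\<not> truncated (M + replicate_mset p b)" by (auto simp: truncated_def intro!: exI[of _ b])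
      then show ?thesis using cact_E[OF assms True] E_in_overflow_space by simp
    next
      case False
      have e: "tact (free_gen b) = act b" by (rule ext) simp
      have "(act b ^^ p) (bmon M) = 0"
      proof -
        have "(act b ^^ Suc k) (bmon M) = 0" for k
          by (induction k) (simp_all add: act_junk[OF False])
        then show ?thesis using p_ge_2 by (metis Suc_diff_1 less_le_trans pos2)
      qed
      then have "cact b (E M) = 0"
        using False by (simp add: E_fixed cact_def tact_diff_left tact_power e act_junk)
      then show ?thesis by (simp add: pm.subspace_0[OF subspace_overflow_space])
    qed
  qed
  finally show ?thesis using s by simp
qed

lemma cact_add_left: "cact (u + v) s = cact u s + cact v s"
proof -
  let ?u = "free_gen u :: 'a free_mon \<Rightarrow>\<^sub>0 'f" and ?v = "free_gen v :: 'a free_mon \<Rightarrow>\<^sub>0 'f"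
  obtain c where c: "(?u + ?v) ^ p = ?u ^ p + ?v ^ p + (\<Sum>i=1..p-1. c i)"
    "\<And>i. 1 \<le> i \<Longrightarrow> i \<le> p - 1 \<Longrightarrow> of_nat i * c i = jacobson_coeff comm ?u ?v (p - 1) (i - 1)"
    using jacobson_formula[OF prime_p of_nat_p_poly_mapping, of ?u ?v] by metis
  have ci: "tact (c i) s = act (jacobson_s scale bracket p i u v) s" if "i \<in> {1..p-1}" for i
  proof -
    have "of_nat i * c i = scal (of_nat i) (c i)" by (simp add: scal_def)
    then have "scal (of_nat i) (tact (c i) s) = act (jacobson_coeff bracket u v (p - 1) (i - 1)) s"
      using c(2)[of i] that tact_jacobson_coeff[of u v "p - 1" "i - 1" s] by (simp flip: tact_scal_left)
    then have "scal (inverse (of_nat i)) (scal (of_nat i) (tact (c i) s)) =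
        act (jacobson_s scale bracket p i u v) s"
      by (simp add: jacobson_s_eq act_scale_left)
    moreover have "of_nat i \<noteq> (0 :: 'f)" using that by (intro of_nat_less_p) auto
    ultimately show ?thesis by simp
  qed
  have sum_tact: "tact (\<Sum>i\<in>A. c i) s = (\<Sum>i\<in>A. tact (c i) s)" if "finite A" for A
    using that by (induction A rule: finite_induct) (simp_all add: tact_add_left)
  have sum_act: "act (\<Sum>i\<in>A. f i) s = (\<Sum>i\<in>A. act (f i) s)" if "finite A" for A :: "nat set" and f
    using that by (induction A rule: finite_induct) (simp_all add: act_add_left)
  have "tact (free_gen (u + v)) = tact (?u + ?v)"
    by (rule ext) (simp add: act_add_left tact_add_left)
  then have "tact (free_gen (u + v) ^ p) s = tact ((?u + ?v) ^ p) s" by (simp add: tact_power)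
  also have "\<dots> = tact (?u ^ p) s + tact (?v ^ p) s + (\<Sum>i=1..p-1. act (jacobson_s scale bracket p i u v) s)"
    unfolding c(1) tact_add_left by (simp add: sum_tact ci)
  finally show ?thesis
    by (simp add: cact_def tact_diff_left pmap_add act_add_left sum_act)
qed

text \<open>
  By Jacobson's formula, \<open>v \<mapsto> v\<^sup>p - v\<^sup>[\<^sup>p\<^sup>]\<close> is semilinear as a map into the enveloping algebra. So the
  relations \<open>v\<^sup>p = v\<^sup>[\<^sup>p\<^sup>]\<close> for all \<open>v\<close> follow from those for basis elements.
\<close>

lemma cact_all_in_overflow_space: "cact v s \<in> overflow_space"
proof -
  have "v \<in> span B" by (simp add: span_B)
  then show ?thesis
  proof (induction rule: span_induct_alt)
    case base
    have e: "tact (free_gen 0) = (\<lambda>s. 0)" by (rule ext) simp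
    have "((\<lambda>s. 0) ^^ p) s = (0 :: 'a multiset \<Rightarrow>\<^sub>0 'f)"
      using p_ge_2 by (cases p) auto
    then have "cact 0 s = 0" by (simp add: cact_def tact_diff_left tact_power e pmap_zero)
    then show ?case by (simp add: pm.subspace_0[OF subspace_overflow_space])
  next
    case (step c b w)
    have "tact (free_gen (scale c b)) = tact (scal c (free_gen b))"
      by (rule ext) (simp add: tact_scal_left act_scale_left)
    then have "cact (scale c b) s = scal (c ^ p) (cact b s)"
      by (simp add: cact_def tact_diff_left tact_power[of "free_gen (scale c b)"]
          flip: tact_power)
        (simp add: scal_power tact_scal_left pmap_scale act_scale_left pm.scale_right_diff_distrib)
    then show ?case using step cact_add_left[of "scale c b" w s] cact_in_overflow_space
      by (simp add: pm.subspace_add[OF subspace_overflow_space] pm.subspace_scale[OF subspace_overflow_space])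
  qed
qed

lemma tact_env_ideal:
  assumes "t \<in> env_ideal"
  shows "tact t s \<in> overflow_space"
proof -
  have left: "tact a x \<in> overflow_space" if "x \<in> overflow_space" for a x
  proof -
    obtain s where s: "x = lin_ext E s" "\<And>M. M \<in> keys s \<Longrightarrow> \<not> truncated M"
      using \<open>x \<in> overflow_space\<close> by (auto simp: overflow_space_def)
    have "tact a (lin_ext E s) = lin_ext (\<lambda>M. tact a (E M)) s"
      by (induction s rule: poly_mapping_linear_induct) (simp_all add: lin_ext_add tact_add tact_scal)
    also have "\<dots> \<in> overflow_space"
    proof (intro lin_ext_in_subspace subspace_overflow_space)
      fix M assume "M \<in> keys s"
      then have nt: "\<not> truncated M" using s by blast
      show "tact a (E M) \<in> overflow_space"
      proof (cases "set_mset M \<subseteq> B")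
        case True
        with nt obtain b N where "b \<in> B" "E M = cact b (E N)" by (rule E_overflow)
        then show ?thesis using cact_in_overflow_space by (simp flip: cact_tact)
      next
        case False
        obtain c where "tact a (bmon M) = scal c (bmon M)"
        proof -
          have "\<exists>c. tact a (bmon M) = scal c (bmon M)"
          proof (induction a rule: poly_mapping_linear_induct)
            case (single k c)
            obtain w where k: "k = Free_Mon w" by (cases k)
            have "wact w (bmon M) = (if w = [] then bmon M else 0)"
              by (induction w) (simp_all add: act_junk[OF False])
            then show ?case by (auto simp: k intro: exI[of _ c] exI[of _ 0])
          qed (auto simp: tact_add_left simp flip: pm.scale_left_distrib)
          then show thesis using that by blast
        qed
        then show ?thesis using E_in_overflow_space[OF nt] False
          by (simp add: E_fixed pm.subspace_scale[OF subspace_overflow_space])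
      qed
    qed
    finally show ?thesis using s by simp
  qed
  let ?I = "{t. \<forall>s. tact t s \<in> overflow_space}"
  have "two_sided ?I"
    unfolding two_sided_def
    using left pm.subspace_add[OF subspace_overflow_space] pm.subspace_0[OF subspace_overflow_space]
    by (auto simp: tact_mult tact_add_left)
  moreover have "restricted_relators scale bracket p pmap \<subseteq> ?I"
  proof -
    have "tact (free_gen (pmap x) - free_gen x ^ p) s = - cact x s" for x s
      by (simp add: cact_def tact_diff_left)
    then have "tact (free_gen (pmap x) - free_gen x ^ p) s \<in> overflow_space" for x s
      using cact_all_in_overflow_space pm.subspace_neg[OF subspace_overflow_space] by simp
    then show ?thesis
      unfolding restricted_relators_def scal_def[symmetric]
      by (auto simp: tact_diff_left tact_add_left tact_mult act_add_left act_scale_left tact_scal_left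
          act_bracket pm.subspace_0[OF subspace_overflow_space])
  qed
  ultimately have "env_ideal \<subseteq> ?I" unfolding env_ideal_def by (rule gen_ideal_minimal)
  then show ?thesis using assms by blast
qed

definition pbw_word :: "'a list \<Rightarrow> bool" where
  "pbw_word w \<longleftrightarrow> set w \<subseteq> B \<and> sorted_wrt le w \<and> truncated (mset w)"

lemma wact_pbw_word: "set w \<subseteq> B \<Longrightarrow> sorted_wrt le w \<Longrightarrow> wact w (bmon {#}) = bmon (mset w)"
proof (induction w)
  case (Cons b w)
  then have "below b (mset w)" "set_mset (mset w) \<subseteq> B" "b \<in> B" by (auto simp: below_def)
  then show ?case using Cons by (simp add: act_basis bact_below)
qed simp

lemma sorted_wrt_mset_unique: "sorted_wrt le v \<Longrightarrow> sorted_wrt le w \<Longrightarrow> mset v = mset w \<Longrightarrow> v = w"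
proof (induction v arbitrary: w)
  case (Cons a v)
  then obtain b w' where w: "w = b # w'" by (cases w) auto
  have "a \<in> set w" "b \<in> set (a # v)" using Cons.prems(3) w
    by (metis list.set_intros(1) set_mset_mset)+
  then have "a = b" using Cons.prems w le_antisym by auto
  then show ?case using Cons w by auto
qed simp

text \<open>
  Acting on \<open>1\<close> turns a sorted word into its monomial and an element of the ideal into a combination
  of those \<open>E M\<close> for which \<open>M\<close> is not truncated. Since \<open>E M = M\<close> for truncated \<open>M\<close>, a vector of both
  kinds vanishes.
\<close>

theorem pbw_independent:
  assumes "t \<in> env_ideal" "\<And>m. m \<in> keys t \<Longrightarrow> \<exists>w. m = Free_Mon w \<and> pbw_word w"
  shows "t = 0"
proof -
  define f :: "'a free_mon \<Rightarrow> 'a multiset" where "f = (\<lambda>m. case m of Free_Mon w \<Rightarrow> mset w)"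
  define s where "s = lin_ext (\<lambda>m. bmon (f m)) t"
  have s: "tact t (bmon {#}) = s"
    unfolding tact_def s_def
  proof (rule lin_ext_cong)
    fix m assume "m \<in> keys t"
    then obtain w where "m = Free_Mon w" "pbw_word w" using assms(2) by blast
    then show "(case m of Free_Mon w \<Rightarrow> wact w (bmon {#})) = bmon (f m)"
      using wact_pbw_word by (simp add: f_def pbw_word_def)
  qed
  then have "s \<in> overflow_space" using tact_env_ideal[OF assms(1), of "bmon {#}"] by simp
  then obtain s' where s': "s = lin_ext E s'" "\<And>M. M \<in> keys s' \<Longrightarrow> \<not> truncated M"
    by (auto simp: overflow_space_def)
  have tr: "truncated M" if "M \<in> keys s" for M
  proof (rule ccontr)
    assume "\<not> truncated M"
    have "s \<in> {s. \<forall>M\<in>keys s. truncated M}"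
      unfolding s_def
    proof (intro lin_ext_in_subspace subspace_keys)
      fix m assume "m \<in> keys t"
      then show "bmon (f m) \<in> {s. \<forall>M\<in>keys s. truncated M}"
        using assms(2) by (fastforce simp: bmon_def f_def pbw_word_def)
    qed
    then show False using \<open>M \<in> keys s\<close> \<open>\<not> truncated M\<close> by auto
  qed
  have "lin_ext E s = lin_ext bmon s" using tr by (intro lin_ext_cong) (simp add: E_fixed)
  also have "lin_ext bmon s = s" by (rule lin_ext_bmon_id)
  finally have "lin_ext E (s - s') = 0" using s'(1) by (simp add: lin_ext_diff)
  then have "s = s'" using lin_ext_E_injective by fastforce
  then have "keys s = {}" using tr s'(2) by blast
  then have s0: "s = 0" by simp
  have inj: "inj_on f (keys t)"
  proof (rule inj_onI)
    fix m n assume "m \<in> keys t" "n \<in> keys t" "f m = f n"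
    then show "m = n" using assms(2)[of m] assms(2)[of n] sorted_wrt_mset_unique
      by (auto simp: f_def pbw_word_def)
  qed
  have "m \<notin> keys t" for m
  proof
    assume m: "m \<in> keys t"
    have "lookup s (f m) = (\<Sum>k\<in>keys t. lookup t k * (if k = m then 1 else 0))"
      unfolding s_def lin_ext_def lookup_sum lookup_scal
      using inj m by (intro sum.cong) (auto simp: bmon_def lookup_single when_def inj_on_eq_iff)
    then show False using s0 m by (simp add: in_keys_iff if_distrib cong: if_cong)
  qed
  then have "keys t = {}" by blast
  then show ?thesis by simp
qed

end

section \<open>Weight filtrations\<close>

definition gprod :: "'a list \<Rightarrow> ('a free_mon \<Rightarrow>\<^sub>0 'f::field)" where
  "gprod w = prod_list (map free_gen w)"

lemma gprod_simps [simp]: "gprod [] = 1" "gprod (v # w) = free_gen v * gprod w"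
  by (simp_all add: gprod_def)

lemma gprod_append: "gprod (u @ w) = gprod u * gprod w"
  by (simp add: gprod_def)

lemma gprod_replicate: "gprod (replicate n v) = free_gen v ^ n"
  by (induction n) simp_all

lemma gprod_eq_single: "gprod w = Poly_Mapping.single (Free_Mon w) 1"
proof (induction w)
  case Nil
  then show ?case by (metis gprod_simps(1) single_one zero_free_mon_def)
qed (simp add: free_gen_def mult_single)

lemma keys_gprod [simp]: "keys (gprod w :: _ \<Rightarrow>\<^sub>0 'f::field) = {Free_Mon w}"
  by (simp add: gprod_eq_single)

lemma span_mult:
  assumes J: "two_sided J" and a: "a \<in> pm.span (P \<union> J)" and b: "b \<in> pm.span (Q \<union> J)"
    and xy: "\<And>x y. x \<in> P \<Longrightarrow> y \<in> Q \<Longrightarrow> x * y \<in> U" and U: "pm.subspace U" "J \<subseteq> U"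
  shows "a * b \<in> U"
proof -
  have 1: "x * b \<in> U" if x: "x \<in> P" for x
    using b
  proof (induction rule: pm.span_induct_alt)
    case base
    then show ?case using pm.subspace_0[OF U(1)] by simp
  next
    case (step c y z)
    have "x * y \<in> U"
      using step(1)
    proof
      assume "y \<in> Q"
      then show ?thesis by (rule xy[OF x])
    next
      assume "y \<in> J"
      then show ?thesis using two_sided_mult_left[OF J] U(2) by blast
    qed
    then show ?case using step(2)
      by (simp add: distrib_left pm.subspace_add[OF U(1)] pm.subspace_scale[OF U(1)])
  qed
  show ?thesis
    using a
  proof (induction rule: pm.span_induct_alt)
    case base
    then show ?case using pm.subspace_0[OF U(1)] by simp
  next
    case (step c x z)
    have "x * b \<in> U"
      using step(1)
    proof
      assume "x \<in> P"
      then show ?thesis by (rule 1)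
    next
      assume "x \<in> J"
      then show ?thesis using two_sided_mult_right[OF J] U(2) by blast
    qed
    then show ?case using step(2)
      by (simp add: distrib_right pm.subspace_add[OF U(1)] pm.subspace_scale[OF U(1)])
  qed
qed

locale weight_filtration = restricted_lie_algebra scale bracket p pmap
  for scale :: "'f::field \<Rightarrow> 'a::ab_group_add \<Rightarrow> 'a" and bracket p pmap +
  fixes D :: "nat \<Rightarrow> 'a set"
  assumes D_subspace: "subspace (D n)"
    and D_antimono: "m \<le> n \<Longrightarrow> D n \<subseteq> D m"
    and D_bracket: "x \<in> D a \<Longrightarrow> y \<in> D b \<Longrightarrow> bracket x y \<in> D (a + b)"
    and D_pmap: "x \<in> D a \<Longrightarrow> pmap x \<in> D (p * a)"
begin

text \<open>
  A word has weight at least \<open>n\<close> if its letters lie in members of the filtration whose indices add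
  up to at least \<open>n\<close>. The indices are not determined by the letters, since the members of the
  filtration may all contain a common ideal.
\<close>

definition heavy :: "nat \<Rightarrow> 'a list \<Rightarrow> bool" where
  "heavy n w \<longleftrightarrow> (\<exists>ns. list_all2 (\<lambda>v m. v \<in> D m) w ns \<and> n \<le> sum_list ns)"

definition filt :: "nat \<Rightarrow> ('a free_mon \<Rightarrow>\<^sub>0 'f) set" where
  "filt n = pm.span ({gprod w |w. heavy n w} \<union> env_ideal)"

lemma heavy_append: "heavy m u \<Longrightarrow> heavy n w \<Longrightarrow> heavy (m + n) (u @ w)"
  unfolding heavy_def by (metis add_mono list_all2_appendI sum_list_append)

lemma heavy_single: "v \<in> D n \<Longrightarrow> heavy n [v]"
  unfolding heavy_def by (intro exI[of _ "[n]"]) simp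

lemma subspace_filt: "pm.subspace (filt n)"
  unfolding filt_def by (rule pm.subspace_span)

lemma env_ideal_filt: "env_ideal \<subseteq> filt n"
  unfolding filt_def using pm.span_superset by blast

lemma gprod_filt: "heavy n w \<Longrightarrow> gprod w \<in> filt n"
  unfolding filt_def by (intro pm.span_base) blast

lemma free_gen_filt: "v \<in> D n \<Longrightarrow> free_gen v \<in> filt n"
  using gprod_filt[OF heavy_single] by simp

lemma filt_mult: "a \<in> filt m \<Longrightarrow> b \<in> filt n \<Longrightarrow> a * b \<in> filt (m + n)"
  unfolding filt_def[of m] filt_def[of n]
proof (erule (1) span_mult[OF two_sided_env_ideal _ _ _ subspace_filt env_ideal_filt])
  fix x y :: "'a free_mon \<Rightarrow>\<^sub>0 'f"
  assume "x \<in> {gprod w |w. heavy m w}" "y \<in> {gprod w |w. heavy n w}"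
  then show "x * y \<in> filt (m + n)"
    using gprod_filt[OF heavy_append] by (auto simp flip: gprod_append)
qed

lemma filt_antimono: "m \<le> n \<Longrightarrow> filt n \<subseteq> filt m"
  unfolding filt_def by (rule pm.span_mono) (auto simp: heavy_def intro: order_trans)

lemma filt_mult_le:
  "a \<in> filt m \<Longrightarrow> b \<in> filt n \<Longrightarrow> N \<le> m + n \<Longrightarrow> a * b \<in> filt N"
  using filt_mult[of a m b n] filt_antimono[of N "m + n"] by blast

lemma filt_eqm: "eqm env_ideal a b \<Longrightarrow> b \<in> filt n \<Longrightarrow> a \<in> filt n"
  using pm.subspace_add[OF subspace_filt, of "a - b" n b] env_ideal_filt[of n]
  unfolding eqm_def by auto

end

locale weight_filtration_basis = weight_filtration scale bracket p pmap D + restricted_basis scale bracket p pmap B le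
  for scale :: "'f::field \<Rightarrow> 'a::ab_group_add \<Rightarrow> 'a" and bracket p pmap D B le +
  assumes D_basis: "D n \<subseteq> span (B \<inter> D n)"
begin

definition pbw_filt :: "nat \<Rightarrow> ('a free_mon \<Rightarrow>\<^sub>0 'f) set" where
  "pbw_filt n = pm.span ({gprod w |w. pbw_word w \<and> heavy n w} \<union> env_ideal)"

lemma subspace_pbw_filt: "pm.subspace (pbw_filt n)"
  unfolding pbw_filt_def by (rule pm.subspace_span)

lemma env_ideal_pbw_filt: "env_ideal \<subseteq> pbw_filt n"
  unfolding pbw_filt_def using pm.span_superset by blast

lemma pbw_filt_eqm: "eqm env_ideal a b \<Longrightarrow> b \<in> pbw_filt n \<Longrightarrow> a \<in> pbw_filt n"
  using pm.subspace_add[OF subspace_pbw_filt, of "a - b" n b] env_ideal_pbw_filt[of n]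
  unfolding eqm_def by auto

lemma free_gen_span: "v \<in> span S \<Longrightarrow> free_gen v \<in> pm.span (free_gen ` S \<union> env_ideal)"
proof (induction rule: span_induct_alt)
  case base
  show ?case using free_gen_zero_mem by (intro pm.span_base) simp
next
  case (step c x y)
  let ?U = "pm.span (free_gen ` S \<union> env_ideal)"
  have "scal c (free_gen x) + free_gen y \<in> ?U"
    using step by (intro pm.span_add pm.span_scale) (auto intro: pm.span_base)
  moreover have "eqm env_ideal (free_gen (scale c x + y)) (scal c (free_gen x) + free_gen y)"
    using env_add env_scale eqm_add eqm_refl eqm_trans two_sided_env_ideal by meson
  then have "free_gen (scale c x + y) - (scal c (free_gen x) + free_gen y) \<in> ?U"
    unfolding eqm_def by (intro pm.span_base) simp
  ultimately show ?case by (metis pm.span_add diff_add_cancel)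
qed

lemma gprod_expand:
  "list_all2 (\<lambda>v m. v \<in> D m) w ns \<Longrightarrow>
    gprod w \<in> pm.span ({gprod u |u. list_all2 (\<lambda>v m. v \<in> B \<inter> D m) u ns} \<union> env_ideal)"
proof (induction w ns rule: list_all2_induct)
  case Nil
  then show ?case by (intro pm.span_base) (auto intro: exI[of _ "[]"])
next
  case (Cons v w m ns)
  let ?U = "pm.span ({gprod u |u. list_all2 (\<lambda>v m. v \<in> B \<inter> D m) u (m # ns)} \<union> env_ideal)"
  have "v \<in> span (B \<inter> D m)" using Cons.hyps(1) D_basis by blast
  from free_gen_span[OF this] Cons.IH have "free_gen v * gprod w \<in> ?U"
  proof (rule span_mult[OF two_sided_env_ideal _ _ _ pm.subspace_span])
    fix x y :: "'a free_mon \<Rightarrow>\<^sub>0 'f"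
    assume "x \<in> free_gen ` (B \<inter> D m)" "y \<in> {gprod u |u. list_all2 (\<lambda>v m. v \<in> B \<inter> D m) u ns}"
    then obtain b u where "b \<in> B \<inter> D m" "list_all2 (\<lambda>v m. v \<in> B \<inter> D m) u ns" "x * y = gprod (b # u)"
      by auto
    then show "x * y \<in> ?U" by (intro pm.span_base) (auto intro!: exI[of _ "b # u"] simp del: gprod_simps)
  next
    show "env_ideal \<subseteq> ?U" using pm.span_superset by blast
  qed
  then show ?case by simp
qed

lemma sorted_pairs_exist: "\<exists>zs. mset zs = (M :: ('a \<times> nat) multiset) \<and> sorted_wrt (\<lambda>x y. le (fst x) (fst y)) zs"
proof (induction "size M" arbitrary: M rule: less_induct)
  case (less M)
  show ?case
  proof (cases "M = {#}")
    case True
    then show ?thesis by (intro exI[of _ "[]"]) simp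
  next
    case False
    then have "image_mset fst M \<noteq> {#}" by simp
    from least_letter[OF this] obtain z where z: "z \<in># M" "below (fst z) (image_mset fst M)" by auto
    then have "size (M - {#z#}) < size M" by (simp add: size_Diff1_less)
    from less[OF this] obtain zs where zs: "mset zs = M - {#z#}" "sorted_wrt (\<lambda>x y. le (fst x) (fst y)) zs"
      by blast
    have "le (fst z) (fst y)" if "y \<in> set zs" for y
    proof -
      have "y \<in># M" using that zs(1) by (metis in_diffD set_mset_mset)
      then show ?thesis using z(2) by (auto simp: below_def)
    qed
    moreover have "mset (z # zs) = M" using zs(1) z(1) by simp
    ultimately show ?thesis using zs(2) by (intro exI[of _ "z # zs"]) simp
  qed
qed

text \<open>
  Straightening. Exchanging two neighbouring letters changes the word by a shorter one, in which they
  are replaced by their bracket; a word with \<open>p\<close> equal letters \<open>b\<close> can be permuted so that they become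
  \<open>b\<^sup>p = b\<^sup>[\<^sup>p\<^sup>]\<close>. Neither step lowers the weight.
\<close>

lemma heavy_in_pbw_filt: "heavy n w \<Longrightarrow> gprod w \<in> pbw_filt n"
proof (induction "length w" arbitrary: w n rule: less_induct)
  case (less w)
  define good where "good = (\<lambda>zs :: ('a \<times> nat) list. length zs = length w \<and> n \<le> sum_list (map snd zs)
    \<and> (\<forall>z\<in>set zs. fst z \<in> B \<inter> D (snd z)))"
  let ?g = "\<lambda>zs. gprod (map fst zs) :: 'a free_mon \<Rightarrow>\<^sub>0 'f"
  have heavyI: "heavy (sum_list (map snd zs)) (map fst zs)" if "\<forall>z\<in>set zs. fst z \<in> D (snd z)" for zs
    unfolding heavy_def using that
    by (intro exI[of _ "map snd zs"]) (auto simp: list_all2_conv_all_nth)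
  have swap: "?g (xs @ a # b # ys) - ?g (xs @ b # a # ys) \<in> pbw_filt n" if g: "good (xs @ a # b # ys)" for xs a b ys
  proof -
    let ?w = "map fst xs @ bracket (fst a) (fst b) # map fst ys"
    have "heavy (sum_list (map snd (xs @ (bracket (fst a) (fst b), snd a + snd b) # ys)))
        (map fst (xs @ (bracket (fst a) (fst b), snd a + snd b) # ys))"
      by (rule heavyI) (use g D_bracket in \<open>auto simp: good_def\<close>)
    then have "heavy n ?w" using g by (auto simp: good_def heavy_def)
    moreover have "length ?w < length w" using g by (auto simp: good_def)
    ultimately have 1: "gprod ?w \<in> pbw_filt n" using less.hyps by blast
    have "?g (xs @ a # b # ys) - ?g (xs @ b # a # ys) =
        ?g xs * (comm (free_gen (fst a)) (free_gen (fst b)) * ?g ys)"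
      by (simp add: gprod_append comm_def algebra_simps)
    moreover have "eqm env_ideal (?g xs * (comm (free_gen (fst a)) (free_gen (fst b)) * ?g ys)) (gprod ?w)"
      unfolding gprod_append gprod_simps
      by (intro eqm_mult eqm_refl eqm_sym[OF _ env_bracket] two_sided_env_ideal)
    ultimately show ?thesis using pbw_filt_eqm 1 by metis
  qed
  have move: "?g (us @ xs @ z # ys) - ?g (us @ z # xs @ ys) \<in> pbw_filt n" if "good (us @ xs @ z # ys)" for us xs z ys
    using that
  proof (induction xs arbitrary: ys rule: rev_induct)
    case Nil
    then show ?case by (simp add: pm.subspace_0[OF subspace_pbw_filt])
  next
    case (snoc x xs)
    have 1: "?g ((us @ xs) @ x # z # ys) - ?g ((us @ xs) @ z # x # ys) \<in> pbw_filt n"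
      by (rule swap) (use snoc.prems in simp)
    have "good (us @ xs @ z # x # ys)" using snoc.prems by (auto simp: good_def)
    then have 2: "?g (us @ xs @ z # x # ys) - ?g (us @ z # xs @ x # ys) \<in> pbw_filt n" by (rule snoc.IH)
    show ?case using pm.subspace_add[OF subspace_pbw_filt 1 2] by simp
  qed
  have permute: "?g (us @ zs) - ?g (us @ zs') \<in> pbw_filt n" if "good (us @ zs)" "mset zs = mset zs'" for us zs zs'
    using that
  proof (induction zs' arbitrary: us zs)
    case Nil
    then show ?case by (simp add: pm.subspace_0[OF subspace_pbw_filt])
  next
    case (Cons z zs')
    then have "z \<in> set zs" by (metis list.set_intros(1) set_mset_mset)
    then obtain xs ys where zs: "zs = xs @ z # ys" by (meson split_list)
    have 1: "?g (us @ zs) - ?g (us @ z # xs @ ys) \<in> pbw_filt n"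
      unfolding zs by (rule move) (use Cons.prems zs in simp)
    have "good ((us @ [z]) @ xs @ ys)" "mset (xs @ ys) = mset zs'"
      using Cons.prems zs by (auto simp: good_def)
    then have 2: "?g ((us @ [z]) @ xs @ ys) - ?g ((us @ [z]) @ zs') \<in> pbw_filt n" by (rule Cons.IH)
    show ?case using pm.subspace_add[OF subspace_pbw_filt 1 2] by simp
  qed
  have good_in: "?g zs \<in> pbw_filt n" if g: "good zs" for zs
  proof (cases "truncated (mset (map fst zs))")
    case True
    obtain zs' where zs': "mset zs' = mset zs" "sorted_wrt (\<lambda>x y. le (fst x) (fst y)) zs'"
      using sorted_pairs_exist by blast
    have set': "set zs' = set zs" using zs'(1) by (metis set_mset_mset)
    have "sum_list (map snd zs') = sum_list (map snd zs)"
      using zs'(1) by (metis mset_map sum_mset_sum_list)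
    then have "heavy n (map fst zs')"
      using heavyI[of zs'] g set' by (auto simp: good_def heavy_def)
    moreover have "pbw_word (map fst zs')"
      using True zs' g set' by (auto simp: pbw_word_def good_def sorted_wrt_map)
    ultimately have 1: "?g zs' \<in> pbw_filt n" unfolding pbw_filt_def by (intro pm.span_base) blast
    have 2: "?g ([] @ zs) - ?g ([] @ zs') \<in> pbw_filt n" by (rule permute) (use g zs' in simp_all)
    show ?thesis using pm.subspace_add[OF subspace_pbw_filt 2 1] by simp
  next
    case False
    then obtain b where b: "p \<le> count (mset (map fst zs)) b" by (auto simp: truncated_def not_less)
    define fs where "fs = filter (\<lambda>z. fst z = b) zs"
    have lfs: "p \<le> length fs"
    proof -
      have "count (mset (map fst zs)) b = length fs"
        unfolding fs_def by (induction zs) auto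
      then show ?thesis using b by simp
    qed
    define ps where "ps = take p fs"
    define rs where "rs = drop p fs @ filter (\<lambda>z. fst z \<noteq> b) zs"
    have ms: "mset (ps @ rs) = mset zs"
      unfolding ps_def rs_def append_assoc[symmetric] append_take_drop_id mset_append fs_def
      by (simp add: multiset_partition[symmetric])
    have lps: "length ps = p" using lfs by (simp add: ps_def)
    have fps: "fst z = b" if "z \<in> set ps" for z using that by (auto simp: ps_def fs_def dest: in_set_takeD)
    then have mps: "map fst ps = replicate p b" using lps
      by (metis (no_types, lifting) length_map list.set_map imageE replicate_eqI)
    have setpr: "set ps \<union> set rs = set zs" using ms by (metis set_append set_mset_mset)
    \<comment> \<open>The \<open>p\<close> equal letters may have been given different weights; \<open>b\<close> has the largest of them.\<close>
    define m where "m = Max (snd ` set ps)"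
    have ne: "set ps \<noteq> {}" using lps p_ge_2 by auto
    then have "m \<in> snd ` set ps" unfolding m_def by (intro Max_in) auto
    then obtain z where "z \<in> set ps" "snd z = m" by blast
    moreover from this have "z \<in> set zs" using setpr by blast
    then have "fst z \<in> D (snd z)" using g by (simp add: good_def)
    ultimately have bm: "b \<in> D m" using fps[of z] by simp
    have "sum_list (map snd ps) \<le> length ps * m"
    proof -
      have "\<forall>z\<in>set ps. snd z \<le> m" unfolding m_def by auto
      then show ?thesis by (induction ps) auto
    qed
    then have pb: "pmap b \<in> D (sum_list (map snd ps))"
      using D_pmap[OF bm] D_antimono lps by blast
    let ?w = "pmap b # map fst rs"
    have s: "sum_list (map snd ps) + sum_list (map snd rs) = sum_list (map snd zs)"
    proof -
      have "sum_list (map snd (ps @ rs)) = sum_list (map snd zs)"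
        using ms by (metis mset_map sum_mset_sum_list)
      then show ?thesis by simp
    qed
    have "heavy (sum_list (map snd ((pmap b, sum_list (map snd ps)) # rs)))
       (map fst ((pmap b, sum_list (map snd ps)) # rs))"
      by (rule heavyI) (use pb g setpr in \<open>auto simp: good_def\<close>)
    then have "heavy n ?w" using s g by (auto simp: heavy_def good_def)
    moreover have "length ?w < length w"
    proof -
      have "length ps + length rs = length zs" using ms by (metis length_append size_mset)
      then show ?thesis using g lps p_ge_2 by (simp add: good_def)
    qed
    ultimately have 1: "gprod ?w \<in> pbw_filt n" using less.hyps by blast
    have "?g (ps @ rs) = free_gen b ^ p * ?g rs" by (simp add: gprod_append mps gprod_replicate)
    moreover have "eqm env_ideal (free_gen b ^ p * ?g rs) (gprod ?w)"
      unfolding gprod_simps by (intro eqm_mult eqm_refl eqm_sym[OF _ env_pmap] two_sided_env_ideal)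
    ultimately have 2: "?g (ps @ rs) \<in> pbw_filt n" using pbw_filt_eqm[OF _ 1] by simp
    have 3: "?g ([] @ zs) - ?g ([] @ (ps @ rs)) \<in> pbw_filt n"
      by (rule permute) (use g ms in \<open>simp_all del: mset_append\<close>)
    have "?g zs = (?g ([] @ zs) - ?g ([] @ (ps @ rs))) + ?g (ps @ rs)" by simp
    then show ?thesis using pm.subspace_add[OF subspace_pbw_filt 3 2] by (simp only:)
  qed
  obtain ns where ns: "list_all2 (\<lambda>v m. v \<in> D m) w ns" "n \<le> sum_list ns"
    using less.prems by (auto simp: heavy_def)
  have "gprod u \<in> pbw_filt n" if u: "list_all2 (\<lambda>v m. v \<in> B \<inter> D m) u ns" for u
  proof -
    have l: "length u = length ns" "length ns = length w" using u ns(1) by (auto dest: list_all2_lengthD)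
    have "good (zip u ns)"
      using u l ns(2) by (auto simp: good_def list_all2_iff)
    from good_in[OF this] show ?thesis using l by simp
  qed
  then have "pm.span ({gprod u |u. list_all2 (\<lambda>v m. v \<in> B \<inter> D m) u ns} \<union> env_ideal) \<subseteq> pbw_filt n"
    using env_ideal_pbw_filt by (intro pm.span_minimal subspace_pbw_filt) auto
  then show ?case using gprod_expand[OF ns(1)] by blast
qed

text \<open>
  After straightening, membership in the filtration is a linear relation between basis monomials,
  so the given monomial is itself one of the heavy ones.
\<close>

theorem heavy_if_in_filt:
  assumes "pbw_word u" "gprod u \<in> filt n"
  shows "heavy n u"
proof -
  let ?S = "{gprod w |w. pbw_word w \<and> heavy n w} :: ('a free_mon \<Rightarrow>\<^sub>0 'f) set"
  have "filt n \<subseteq> pbw_filt n"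
    unfolding filt_def using heavy_in_pbw_filt env_ideal_pbw_filt
    by (intro pm.span_minimal subspace_pbw_filt) auto
  then have "gprod u \<in> pm.span (?S \<union> env_ideal)" using assms(2) unfolding pbw_filt_def by blast
  then obtain s j where sj: "gprod u = s + j" "s \<in> pm.span ?S" "j \<in> pm.span env_ideal"
    unfolding pm.span_Un by blast
  have "pm.span env_ideal = env_ideal"
    unfolding pm.span_eq_iff by (rule subspace_two_sided[OF two_sided_env_ideal])
  then have j: "j \<in> env_ideal" using sj(3) by blast
  let ?P = "\<lambda>m. \<exists>w. m = Free_Mon w \<and> pbw_word w \<and> heavy n w"
  have "pm.span ?S \<subseteq> {s. \<forall>m\<in>keys s. ?P m}"
    by (intro pm.span_minimal subspace_keys) auto
  then have s: "\<And>m. m \<in> keys s \<Longrightarrow> ?P m" using sj(2) by blast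
  have "j = 0"
  proof (rule pbw_independent[OF j])
    fix m assume "m \<in> keys j"
    moreover have "j = gprod u - s" using sj(1) by simp
    ultimately have "lookup (gprod u :: _ \<Rightarrow>\<^sub>0 'f) m - lookup s m \<noteq> 0"
      by (simp add: in_keys_iff lookup_minus)
    then have "m \<in> keys (gprod u :: _ \<Rightarrow>\<^sub>0 'f) \<or> m \<in> keys s"
      unfolding in_keys_iff by (cases "lookup s m = 0") simp_all
    then show "\<exists>w. m = Free_Mon w \<and> pbw_word w" using s assms(1) by auto
  qed
  then have "Free_Mon u \<in> keys s" using sj(1) keys_gprod[of u, where 'f = 'f] by simp
  then show ?thesis using s by blast
qed

end

text \<open>
  An order for which a word of interest is already sorted.
\<close>

lemma total_order_with_initial_list:
  assumes "distinct vs"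
  obtains le :: "'a \<Rightarrow> 'a \<Rightarrow> bool" where
    "\<And>a. le a a" "\<And>a b c. le a b \<Longrightarrow> le b c \<Longrightarrow> le a c"
    "\<And>a b. le a b \<Longrightarrow> le b a \<Longrightarrow> a = b" "\<And>a b. le a b \<or> le b a" "sorted_wrt le vs"
proof -
  obtain r :: "('a \<times> 'a) set" where r: "well_order_on UNIV r" using well_order_on by blast
  then have lin_ext: "linear_order r" by (simp add: well_order_on_def)
  \<comment> \<open>The elements of \<open>vs\<close> come first, by position, then all others, in the order \<open>r\<close>.\<close>
  define rank where "rank = (\<lambda>a. if a \<in> set vs then (LEAST i. i < length vs \<and> vs ! i = a) else length vs)"
  define le where "le = (\<lambda>a b. rank a < rank b \<or> rank a = rank b \<and> (a, b) \<in> r)"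
  have rfl: "(a, a) \<in> r" for a
    using lin_ext by (auto simp: linear_order_on_def partial_order_on_def preorder_on_def refl_on_def)
  have trn: "(a, b) \<in> r \<Longrightarrow> (b, c) \<in> r \<Longrightarrow> (a, c) \<in> r" for a b c
    using lin_ext by (auto simp: linear_order_on_def partial_order_on_def preorder_on_def dest: transD)
  have asym: "(a, b) \<in> r \<Longrightarrow> (b, a) \<in> r \<Longrightarrow> a = b" for a b
    using lin_ext by (auto simp: linear_order_on_def partial_order_on_def dest: antisymD)
  have tot: "(a, b) \<in> r \<or> (b, a) \<in> r" for a b
    using lin_ext rfl[of a] by (cases "a = b") (auto simp: linear_order_on_def total_on_def)
  have rank: "rank (vs ! i) = i" if "i < length vs" for i
  proof -
    have "(LEAST j. j < length vs \<and> vs ! j = vs ! i) = i"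
      by (rule Least_equality) (use that assms in \<open>auto simp: nth_eq_iff_index_eq\<close>)
    then show ?thesis using that by (simp add: rank_def)
  qed
  show thesis
  proof (rule that[of le])
    show "sorted_wrt le vs" by (simp add: sorted_wrt_iff_nth_less le_def rank)
  next
    fix a b c assume "le a b" "le b c"
    then show "le a c" unfolding le_def using trn by (metis order.strict_trans)
  next
    fix a b assume "le a b" "le b a"
    then show "a = b" unfolding le_def using asym by auto
  next
    fix a b show "le a b \<or> le b a" unfolding le_def using tot[of a b] by (cases "rank a" "rank b" rule: linorder_cases) auto
  qed (simp add: le_def rfl)
qed

lemma sorted_wrt_replicate_concat:
  assumes "\<And>a. r a a" "sorted_wrt r vs"
  shows "sorted_wrt r (concat (map (\<lambda>v. replicate (k v) v) vs))"
  using assms(2)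
proof (induction vs)
  case (Cons v vs)
  have "sorted_wrt r (replicate n v)" for n
    by (induction n) (auto simp: assms(1))
  then show ?case using Cons by (auto simp: sorted_wrt_append)
qed simp

lemma count_replicate_concat:
  assumes "distinct vs"
  shows "count (mset (concat (map (\<lambda>v. replicate (k v) v) vs))) b = (if b \<in> set vs then k b else 0)"
  using assms by (induction vs) auto

theorem (in weight_filtration) heavy_monomial:
  assumes "independent B" "span B = UNIV" "\<And>n. D n \<subseteq> span (B \<inter> D n)"
    and "distinct vs" "set vs \<subseteq> B" "\<And>v. k v < p"
    and "gprod (concat (map (\<lambda>v. replicate (k v) v) vs)) \<in> filt n"
  shows "heavy n (concat (map (\<lambda>v. replicate (k v) v) vs))"
proof -
  obtain le where le: "\<And>a. le a a" "\<And>a b c. le a b \<Longrightarrow> le b c \<Longrightarrow> le a c"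
    "\<And>a b. le a b \<Longrightarrow> le b a \<Longrightarrow> a = b" "\<And>a b. le a b \<or> le b a" "sorted_wrt le vs"
    using total_order_with_initial_list[OF assms(4)] by blast
  interpret b: weight_filtration_basis scale bracket p pmap D B le
    by unfold_locales (fact | use assms le in blast)+
  have p0: "0 < p" using p_ge_2 by simp
  have "b.pbw_word (concat (map (\<lambda>v. replicate (k v) v) vs))"
    unfolding b.pbw_word_def b.truncated_def count_replicate_concat[OF assms(4)]
    using assms(5,6) p0 sorted_wrt_replicate_concat[OF le(1,5)] by auto
  then show ?thesis using b.heavy_if_in_filt assms(7) by blast
qed

section \<open>Words modulo a restricted ideal\<close>

context restricted_lie_algebra begin

definition restricted_ideal :: "'a set \<Rightarrow> bool" where
  "restricted_ideal I \<longleftrightarrow> subspace I \<and> (\<forall>x\<in>I. \<forall>y. bracket x y \<in> I) \<and> (\<forall>x\<in>I. pmap x \<in> I)"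

definition env_ideal_mod :: "'a set \<Rightarrow> ('a free_mon \<Rightarrow>\<^sub>0 'f) set" where
  "env_ideal_mod I = gen_ideal (restricted_relators scale bracket p pmap \<union> free_gen ` I)"

lemma two_sided_env_ideal_mod: "two_sided (env_ideal_mod I)"
  unfolding env_ideal_mod_def by (rule two_sided_gen_ideal)

lemma env_ideal_subset_mod: "env_ideal \<subseteq> env_ideal_mod I"
  unfolding env_ideal_mod_def env_ideal_def by (rule gen_ideal_mono, rule Un_upper1)

lemma free_gen_env_ideal_mod: "x \<in> I \<Longrightarrow> free_gen x \<in> env_ideal_mod I"
  unfolding env_ideal_mod_def by (rule subsetD[OF gen_ideal_superset]) simp

lemma restricted_ideal_bracket_right: "restricted_ideal I \<Longrightarrow> y \<in> I \<Longrightarrow> bracket x y \<in> I"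
proof -
  assume I: "restricted_ideal I" and "y \<in> I"
  then have "- bracket y x \<in> I" unfolding restricted_ideal_def by (simp add: subspace_neg)
  then show "bracket x y \<in> I" by (subst bracket_swap)
qed

lemma independent_modulo_list:
  assumes "independent S" "\<And>i. i < length vs \<Longrightarrow> vs ! i \<notin> span (S \<union> set (take i vs))"
  shows "independent (S \<union> set vs) \<and> distinct vs \<and> set vs \<inter> span S = {}"
  using assms(2)
proof (induction vs rule: rev_induct)
  case Nil
  then show ?case using assms(1) by simp
next
  case (snoc v vs)
  have "vs ! i \<notin> span (S \<union> set (take i vs))" if "i < length vs" for i
    using snoc.prems[of i] that by (simp add: nth_append)
  then have IH: "independent (S \<union> set vs) \<and> distinct vs \<and> set vs \<inter> span S = {}" by (rule snoc.IH)
  have v: "v \<notin> span (S \<union> set vs)" using snoc.prems[of "length vs"] by simp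
  have "S \<union> set (vs @ [v]) = insert v (S \<union> set vs)" by auto
  moreover have "v \<notin> set vs" using v span_superset[of "S \<union> set vs"] by blast
  moreover have "v \<notin> span S" using v span_mono[of S "S \<union> set vs"] by blast
  ultimately show ?case using IH independent_insertI[OF v] by simp
qed

text \<open>
  For the filtration \<open>L, I, I, \<dots>\<close> a word has weight at least \<open>1\<close> iff it contains a letter from \<open>I\<close>. So
  in a basis adapted to \<open>I\<close> the ideal generated by \<open>I\<close> contains no monomial in the other letters.
\<close>

theorem gprod_not_in_env_ideal_mod:
  assumes I: "restricted_ideal I" and ind: "\<And>i. i < length vs \<Longrightarrow> vs ! i \<notin> span (I \<union> set (take i vs))"
  shows "gprod vs \<notin> env_ideal_mod I"
proof
  assume in_mod: "gprod vs \<in> env_ideal_mod I"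
  define D where "D = (\<lambda>n::nat. if n = 0 then UNIV else I)"
  have sub: "subspace I" using I by (simp add: restricted_ideal_def)
  interpret weight_filtration scale bracket p pmap D
  proof
    show "subspace (D n)" for n using sub by (simp add: D_def)
    show "m \<le> n \<Longrightarrow> D n \<subseteq> D m" for m n by (auto simp: D_def)
    show "x \<in> D a \<Longrightarrow> y \<in> D b \<Longrightarrow> bracket x y \<in> D (a + b)" for x y a b
      using I restricted_ideal_bracket_right[OF I]
      by (auto simp: D_def restricted_ideal_def split: if_splits)
    show "x \<in> D a \<Longrightarrow> pmap x \<in> D (p * a)" for x a
      using I by (auto simp: D_def restricted_ideal_def split: if_splits)
  qed
  obtain S where S: "S \<subseteq> I" "independent S" "I \<subseteq> span S" using maximal_independent_subset by blast
  have spS: "span S = I" using S sub span_minimal by blast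
  have "vs ! i \<notin> span (S \<union> set (take i vs))" if "i < length vs" for i
    using ind[OF that] span_mono[of "S \<union> set (take i vs)" "I \<union> set (take i vs)"] S(1) by blast
  from independent_modulo_list[OF S(2) this]
  have ivs: "independent (S \<union> set vs)" "distinct vs" "set vs \<inter> I = {}" by (auto simp: spS)
  define B where "B = extend_basis (S \<union> set vs)"
  have B: "independent B" "span B = UNIV" "S \<subseteq> B" "set vs \<subseteq> B"
    using independent_extend_basis[OF ivs(1)] span_extend_basis[OF ivs(1)]
      extend_basis_superset[OF ivs(1)] by (auto simp: B_def)
  have cc: "concat (map (\<lambda>v. replicate 1 v) vs) = vs" by (induction vs) auto
  have "two_sided (filt 1)"
    unfolding two_sided_def
  proof (intro conjI ballI allI)
    show "0 \<in> filt 1" by (rule pm.subspace_0[OF subspace_filt])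
    show "a + b \<in> filt 1" if "a \<in> filt 1" "b \<in> filt 1" for a b
      by (rule pm.subspace_add[OF subspace_filt that])
    have all: "t \<in> filt 0" for t
    proof (induction t rule: poly_mapping_linear_induct)
      case (single k c)
      obtain w where k: "k = Free_Mon w" by (cases k)
      have "heavy 0 w" unfolding heavy_def
        by (intro exI[of _ "replicate (length w) 0"]) (auto simp: list_all2_conv_all_nth D_def)
      then have "scal c (gprod w) \<in> filt 0" by (intro pm.subspace_scale subspace_filt gprod_filt)
      then show ?case by (simp add: gprod_eq_single k)
    qed (rule pm.subspace_add[OF subspace_filt])
    show "t * a \<in> filt 1" if "a \<in> filt 1" for a t using filt_mult[OF all that, of t] by simp
    show "a * t \<in> filt 1" if "a \<in> filt 1" for a t using filt_mult[OF that all, of t] by simp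
  qed
  moreover have "restricted_relators scale bracket p pmap \<union> free_gen ` I \<subseteq> filt 1"
    using env_relators env_ideal_filt[of 1] free_gen_filt[of _ 1] by (auto simp: D_def)
  ultimately have "env_ideal_mod I \<subseteq> filt 1" unfolding env_ideal_mod_def by (rule gen_ideal_minimal)
  then have "gprod (concat (map (\<lambda>v. replicate 1 v) vs)) \<in> filt 1" unfolding cc using in_mod by blast
  moreover have "D n \<subseteq> span (B \<inter> D n)" for n
  proof (cases "n = 0")
    case True
    then show ?thesis by (simp add: D_def B(2))
  next
    case False
    have "span S \<subseteq> span (B \<inter> I)" using B(3) S(1) by (intro span_mono) blast
    then show ?thesis using False spS by (simp add: D_def)
  qed
  moreover have "1 < p" using p_ge_2 by simp
  ultimately have "heavy 1 (concat (map (\<lambda>v. replicate 1 v) vs))"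
    using heavy_monomial[OF B(1,2) _ ivs(2) B(4), of "\<lambda>_. 1" 1] by blast
  then obtain ns where ns: "list_all2 (\<lambda>v m. v \<in> D m) vs ns" "1 \<le> sum_list ns"
    unfolding cc heavy_def by blast
  have "m = 0" if m: "m \<in> set ns" for m
  proof -
    obtain i where i: "i < length ns" "ns ! i = m" using m by (auto simp: in_set_conv_nth)
    then have "vs ! i \<in> D m" "vs ! i \<in> set vs" using ns(1) by (auto simp: list_all2_conv_all_nth)
    then show ?thesis using ivs(3) by (auto simp: D_def split: if_splits)
  qed
  then have "sum_list ns = 0" by (induction ns) auto
  then show False using ns(2) by linarith
qed

end

section \<open>Lie powers of the free algebra\<close>

primrec lcs :: "nat \<Rightarrow> ('m::monoid_add \<Rightarrow>\<^sub>0 'f::field) set" where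
  "lcs 0 = UNIV"
| "lcs (Suc n) = pm.span {comm a b |a b. a \<in> lcs n}"

primrec ulp :: "nat \<Rightarrow> ('m::monoid_add \<Rightarrow>\<^sub>0 'f::field) set" where
  "ulp 0 = UNIV"
| "ulp (Suc n) = pm.span {c * d |c d. c \<in> pm.span {comm a b |a b. a \<in> ulp n}}"

lemma subspace_lcs: "pm.subspace (lcs n)"
  by (cases n) simp_all

lemma subspace_ulp: "pm.subspace (ulp n)"
  by (cases n) simp_all

lemma comm_in_lcs: "a \<in> lcs n \<Longrightarrow> comm a b \<in> lcs (Suc n)"
  by (auto intro!: pm.span_base)

lemma lcs_Suc_subset: "lcs (Suc n) \<subseteq> (lcs n :: ('m::monoid_add \<Rightarrow>\<^sub>0 'f::field) set)"
proof (induction n)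
  case (Suc n)
  then have "{comm a b |a b. a \<in> (lcs (Suc n) :: ('m \<Rightarrow>\<^sub>0 'f) set)} \<subseteq> {comm a b |a b. a \<in> lcs n}"
    by blast
  then show ?case unfolding lcs.simps(2)[of "Suc n"] lcs.simps(2)[of n] by (rule pm.span_mono)
qed simp

lemma lcs_antimono: "m \<le> n \<Longrightarrow> lcs n \<subseteq> lcs m"
  by (rule lift_Suc_antimono_le[of lcs, OF lcs_Suc_subset])

lemma lcs_subset_ulp: "lcs n \<subseteq> (ulp n :: ('m::monoid_add \<Rightarrow>\<^sub>0 'f::field) set)"
proof (induction n)
  case (Suc n)
  show ?case unfolding lcs.simps(2)
  proof (intro pm.span_minimal subspace_ulp subsetI)
    fix t :: "'m \<Rightarrow>\<^sub>0 'f" assume "t \<in> {comm a b |a b. a \<in> lcs n}"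
    then obtain a b where "t = comm a b" "a \<in> lcs n" by blast
    then have "t * 1 \<in> {c * d |c d. c \<in> pm.span {comm a b |a b. a \<in> ulp n}}"
      using Suc by (blast intro: pm.span_base)
    then show "t \<in> ulp (Suc n)" by (simp add: pm.span_base)
  qed
qed simp

text \<open>
  This follows from the Jacobi identity. It lets a bracket with a product such as \<open>x [x, y] = [x, x y]\<close>
  count twice.
\<close>

lemma comm_in_lcs_two:
  assumes "a \<in> lcs n" "b \<in> lcs 1"
  shows "comm a b \<in> lcs (n + 2)"
proof -
  have "b \<in> pm.span {comm u v |u v. u \<in> lcs 0}" using assms(2) by simp
  then show ?thesis
  proof (induction rule: pm.span_induct_alt)
    case base
    then show ?case using pm.subspace_0[OF subspace_lcs, of "n + 2"] by simp
  next
    case (step c x y)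
    then obtain u v where x: "x = comm u v" by blast
    have "comm a x \<in> lcs (n + 2)"
      unfolding x comm_comm_right
      using assms(1) by (intro pm.subspace_diff subspace_lcs) (simp_all add: comm_in_lcs del: lcs.simps)
    then show ?case using step(2)
      by (simp only: comm_add_right scal_comm_right pm.subspace_add[OF subspace_lcs] pm.subspace_scale[OF subspace_lcs])
  qed
qed

lemma comm_free_induct:
  assumes I: "two_sided I" and gen: "\<And>y. comm a (free_gen y) \<in> I"
  shows "comm a (t :: 'a free_mon \<Rightarrow>\<^sub>0 'f::field) \<in> I"
proof (induction t rule: poly_mapping_linear_induct)
  case (single k c)
  obtain w where k: "k = Free_Mon w" by (cases k)
  have "comm a (gprod w) \<in> I"
  proof (induction w)
    case Nil
    then show ?case by (simp add: comm_def two_sided_zero[OF I])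
  next
    case (Cons v w)
    then show ?case
      by (simp add: comm_mult_right two_sided_add[OF I] two_sided_mult_left[OF I] two_sided_mult_right[OF I] gen)
  qed
  then have "comm a (scal c (gprod w)) \<in> I" by (simp add: two_sided_scal[OF I])
  then show ?case by (simp add: k gprod_eq_single)
qed (simp add: comm_add_right two_sided_add[OF I])

lemma comm_swap_mem: "two_sided I \<Longrightarrow> comm a b \<in> I \<Longrightarrow> comm b a \<in> I"
  unfolding comm_minus_swap[of a b, symmetric] by (rule two_sided_minus)

lemma comm_power_mem:
  assumes I: "two_sided I" and a: "comm a t \<in> I"
  shows "comm (a ^ n) t \<in> I"
  by (induction n) (simp_all add: comm_def[of 1] two_sided_zero[OF I] comm_mult_left two_sided_add[OF I]
      two_sided_mult_left[OF I] two_sided_mult_right[OF I] a)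

section \<open>Central chains of restricted ideals\<close>

context restricted_lie_algebra begin

lemma jacobson_coeff_in_ideal:
  "restricted_ideal I \<Longrightarrow> x \<in> I \<Longrightarrow> jacobson_coeff bracket x y k n \<in> I"
proof (induction k arbitrary: n)
  case 0
  then show ?case by (simp add: restricted_ideal_def subspace_0)
next
  case (Suc k)
  have "bracket x (jacobson_coeff bracket x y k (n - 1)) \<in> I"
    using Suc.prems by (simp add: restricted_ideal_def)
  moreover have "bracket y (jacobson_coeff bracket x y k n) \<in> I"
    using Suc by (intro restricted_ideal_bracket_right) auto
  ultimately show ?case using Suc.prems(1) by (cases "n = 0") (simp_all add: restricted_ideal_def subspace_add)
qed

lemma pmap_add_in_ideal:
  assumes I: "restricted_ideal I" and x: "x \<in> I" "pmap y \<in> I"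
  shows "pmap (x + y) \<in> I"
proof -
  have s: "subspace I" using I by (simp add: restricted_ideal_def)
  have "jacobson_s scale bracket p i x y \<in> I" for i
    unfolding jacobson_s_eq using jacobson_coeff_in_ideal[OF I x(1)] by (intro subspace_scale[OF s])
  moreover have "pmap x \<in> I" using I x(1) by (simp add: restricted_ideal_def)
  ultimately show ?thesis unfolding pmap_add using x(2)
    by (intro subspace_add[OF s] subspace_sum[OF s])
qed

lemma pmap_iterate_bracket:
  assumes I: "restricted_ideal I" and z: "\<And>x. bracket z x \<in> I"
  shows "bracket ((pmap ^^ a) z) x \<in> I"
proof (induction a arbitrary: x)
  case 0
  then show ?case using z by simp
next
  case (Suc a)
  have "(bracket ((pmap ^^ a) z) ^^ Suc n) x \<in> I" for n
    using Suc by simp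
  from this[of "p - 1"] have "(bracket ((pmap ^^ a) z) ^^ p) x \<in> I" using char_pos by simp
  then show ?case by (simp add: bracket_pmap)
qed

text \<open>
  A restricted ideal \<open>I\<close> with \<open>p_chain d I\<close> has a chain of restricted ideals of codimension one,
  from \<open>I\<close> down to \<open>0\<close>, on whose steps both \<open>L\<close> and the \<open>p\<close>-map act trivially.
\<close>

inductive p_chain :: "nat \<Rightarrow> 'a set \<Rightarrow> bool" where
  zero: "p_chain 0 {0}"
| extend: "p_chain d I \<Longrightarrow> c \<notin> I \<Longrightarrow> (\<And>x. bracket c x \<in> I) \<Longrightarrow> pmap c \<in> I
    \<Longrightarrow> p_chain (Suc d) (span (insert c I))"

lemma restricted_ideal_zero: "restricted_ideal {0}"
  by (simp add: restricted_ideal_def)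

lemma p_chain_step:
  assumes I: "restricted_ideal I" and c: "\<And>x. bracket c x \<in> I" "pmap c \<in> I" and v: "v \<in> span (insert c I)"
  shows "bracket v x \<in> I" "pmap v \<in> I"
proof -
  have s: "subspace I" using I by (simp add: restricted_ideal_def)
  then have sp: "span I = I" by simp
  from v obtain k where k: "v - scale k c \<in> I" unfolding span_breakdown_eq sp by blast
  have v': "v = (v - scale k c) + scale k c" by simp
  have "bracket (v - scale k c) x \<in> I" using I k by (simp add: restricted_ideal_def)
  then show "bracket v x \<in> I"
    by (subst v', unfold bracket_add_left bracket_scale_left)
       (intro subspace_add[OF s] subspace_scale[OF s] c(1))
  show "pmap v \<in> I"
    by (subst v') (rule pmap_add_in_ideal[OF I k], simp add: pmap_scale subspace_scale[OF s] c(2))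
qed

lemma p_chain_restricted_ideal: "p_chain d I \<Longrightarrow> restricted_ideal I"
proof (induction rule: p_chain.induct)
  case zero
  show ?case by (rule restricted_ideal_zero)
next
  case (extend d I c)
  have "I \<subseteq> span (insert c I)" using span_superset[of "insert c I"] by blast
  then show ?case unfolding restricted_ideal_def[of "span (insert c I)"]
    by (intro conjI subspace_span ballI allI; elim subsetD)
       (rule p_chain_step[OF extend(5,3,4)], assumption)+
qed

lemma p_chain_basis: "p_chain d I \<Longrightarrow> \<exists>S. finite S \<and> independent S \<and> card S = d \<and> span S = I"
proof (induction rule: p_chain.induct)
  case zero
  show ?case by (intro exI[of _ "{}"]) (simp add: independent_empty)
next
  case (extend d I c)
  then obtain S where S: "finite S" "independent S" "card S = d" "span S = I" by blast
  have c: "c \<notin> span S" using S extend by simp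
  have "span (insert c I) = span (insert c S)"
    unfolding S(4)[symmetric] span_insert[of c "span S"] span_insert[of c S] span_span ..
  moreover have "c \<notin> S" using c span_superset[of S] by blast
  ultimately show ?case using S independent_insertI[OF c S(2)]
    by (intro exI[of _ "insert c S"]) auto
qed

lemma p_chain_dim: "p_chain d I \<Longrightarrow> dim I = d"
  using p_chain_basis[of d I] dim_span_eq_card_independent by auto

lemma p_chain_nilpotent: "p_chain d I \<Longrightarrow> x \<in> I \<Longrightarrow> (pmap ^^ d) x = 0"
proof (induction arbitrary: x rule: p_chain.induct)
  case (extend d I c)
  have "pmap x \<in> I" by (rule p_chain_step(2)[OF p_chain_restricted_ideal[OF extend(1)] extend(3,4,6)])
  then show ?case using extend.IH by (simp only: funpow_Suc_right o_apply)
qed simp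

text \<open>
  The chain is extended by \<open>z\<^sup>[\<^sup>p\<^sup>]\<^sup>a\<^sup>-\<^sup>1\<close>, \<dots>, \<open>z\<^sup>[\<^sup>p\<^sup>]\<close>, \<open>z\<close>, in this order.
\<close>

lemma p_chain_add:
  assumes "p_chain d I" "I \<subseteq> H" "restricted_subalgebra scale bracket pmap H"
    and "z \<in> H" "\<And>x. bracket z x \<in> I" "(pmap ^^ a) z \<in> I"
  shows "\<exists>d' I'. p_chain d' I' \<and> insert z I \<subseteq> I' \<and> I' \<subseteq> H"
  using assms(4-6)
proof (induction a arbitrary: z)
  case 0
  then show ?case using assms by (intro exI[of _ d] exI[of _ I]) auto
next
  case (Suc a)
  note I = p_chain_restricted_ideal[OF assms(1)]
  have "pmap z \<in> H" using assms(3) Suc.prems(1) by (simp add: restricted_subalgebra_def)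
  moreover have "bracket (pmap z) x \<in> I" for x
    using pmap_iterate_bracket[OF I Suc.prems(2), of 1 x] by simp
  moreover have "(pmap ^^ a) (pmap z) \<in> I" using Suc.prems(3) by (simp add: funpow_swap1)
  ultimately have "\<exists>d' I'. p_chain d' I' \<and> insert (pmap z) I \<subseteq> I' \<and> I' \<subseteq> H" by (rule Suc.IH)
  then obtain d' I' where I': "p_chain d' I'" "insert (pmap z) I \<subseteq> I'" "I' \<subseteq> H" by blast
  show ?case
  proof (cases "z \<in> I'")
    case True
    then show ?thesis using I' by blast
  next
    case False
    have "p_chain (Suc d') (span (insert z I'))"
      by (rule p_chain.extend[OF I'(1) False]) (use I'(2) Suc.prems(2) in auto)
    moreover have "insert z I \<subseteq> span (insert z I')"
      using I'(2) span_superset[of "insert z I'"] by blast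
    moreover have "span (insert z I') \<subseteq> H"
      using I'(3) Suc.prems(1) assms(3) by (intro span_minimal) (auto simp: restricted_subalgebra_def)
    ultimately show ?thesis by blast
  qed
qed

lemma p_chain_add_finite:
  assumes "p_chain d I" "I \<subseteq> H" "restricted_subalgebra scale bracket pmap H" "finite S"
    and "\<And>z. z \<in> S \<Longrightarrow> z \<in> H" "\<And>z x. z \<in> S \<Longrightarrow> bracket z x \<in> I" "\<And>z. z \<in> S \<Longrightarrow> \<exists>a. (pmap ^^ a) z \<in> I"
  shows "\<exists>d' I'. p_chain d' I' \<and> S \<union> I \<subseteq> I' \<and> I' \<subseteq> H"
  using assms(4-7)
proof (induction S rule: finite_induct)
  case empty
  then show ?case using assms by auto
next
  case (insert z S)
  then obtain d' I' where I': "p_chain d' I'" "S \<union> I \<subseteq> I'" "I' \<subseteq> H" by auto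
  obtain a where "(pmap ^^ a) z \<in> I" using insert.prems(3)[of z] by auto
  then have "(pmap ^^ a) z \<in> I'" using I'(2) by blast
  moreover have "bracket z x \<in> I'" for x using insert.prems(2)[of z x] I'(2) by auto
  moreover have "z \<in> H" using insert.prems(1) by simp
  ultimately obtain d'' I'' where "p_chain d'' I''" "insert z I' \<subseteq> I''" "I'' \<subseteq> H"
    using p_chain_add[OF I'(1,3) assms(3)] by blast
  then show ?case using I'(2) by (intro exI[of _ d''] exI[of _ I'']) auto
qed

section \<open>The upper bound\<close>

lemma env_ideal_mod_zero: "env_ideal_mod {0} = env_ideal"
proof
  show "env_ideal_mod {0} \<subseteq> env_ideal"
    unfolding env_ideal_mod_def using env_relators free_gen_zero_mem by (intro gen_ideal_minimal two_sided_env_ideal) auto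
qed (rule env_ideal_subset_mod)

lemma free_gen_comm_mod:
  assumes "bracket x y \<in> I"
  shows "comm (free_gen x) (free_gen y) \<in> env_ideal_mod I"
proof -
  have "eqm (env_ideal_mod I) (comm (free_gen x) (free_gen y)) (free_gen (bracket x y))"
    by (rule eqm_sym[OF two_sided_env_ideal_mod eqm_mono[OF env_ideal_subset_mod env_bracket]])
  then show ?thesis
    by (rule eqm_mem[OF two_sided_env_ideal_mod _ free_gen_env_ideal_mod[OF assms]])
qed

lemma free_gen_central_mod:
  assumes "\<And>x. bracket c x \<in> I"
  shows "comm (free_gen c) t \<in> env_ideal_mod I"
  by (rule comm_free_induct[OF two_sided_env_ideal_mod free_gen_comm_mod[OF assms]])

text \<open>
  Modulo \<open>I\<close> the element \<open>c\<close> is central with \<open>c\<^sup>p = 0\<close>. Once an upper Lie power lies in the ideal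
  of \<open>c\<close>, every further block of as many commutators produces another factor \<open>c\<close>.
\<close>

lemma ulp_central_step:
  assumes I: "restricted_ideal I" and c: "\<And>x. bracket c x \<in> I" "pmap c \<in> I"
    and k: "ulp k \<subseteq> env_ideal_mod (span (insert c I))"
  shows "ulp (k * p) \<subseteq> env_ideal_mod I"
proof -
  let ?Q = "env_ideal_mod I" and ?c = "free_gen c :: 'a free_mon \<Rightarrow>\<^sub>0 'f"
  note Q = two_sided_env_ideal_mod[of I]
  note cen = free_gen_central_mod[OF c(1)]
  have sI: "subspace I" using I by (simp add: restricted_ideal_def)
  define W where "W = (\<lambda>m U. {t. \<exists>u\<in>U. eqm ?Q t (?c ^ m * u)})"
  have WI: "t \<in> W m U" if "u \<in> U" "eqm ?Q t (?c ^ m * u)" for t m u U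
    unfolding W_def using that by blast
  have WE: "\<exists>u\<in>U. eqm ?Q t (?c ^ m * u)" if "t \<in> W m U" for t m U
    using that unfolding W_def by (rule CollectD)
  have subW: "pm.subspace (W m U)" if U: "pm.subspace U" for m U
  proof (rule pm.subspaceI)
    show "0 \<in> W m U"
      by (rule WI[OF pm.subspace_0[OF U]]) (simp add: eqm_refl[OF Q])
    fix s t assume "s \<in> W m U"
    from WE[OF this] obtain u where u: "u \<in> U" "eqm ?Q s (?c ^ m * u)" by (rule bexE)
    have "eqm ?Q (scal a s) (?c ^ m * scal a u)" for a using eqm_scal[OF Q u(2)] by simp
    then show "scal a s \<in> W m U" for a
      by (rule WI[OF pm.subspace_scale[OF U u(1)]])
    assume "t \<in> W m U"
    from WE[OF this] obtain v where v: "v \<in> U" "eqm ?Q t (?c ^ m * v)" by (rule bexE)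
    have "eqm ?Q (s + t) (?c ^ m * (u + v))" using eqm_add[OF Q u(2) v(2)] by (simp add: distrib_left)
    then show "s + t \<in> W m U" by (rule WI[OF pm.subspace_add[OF U u(1) v(1)]])
  qed
  have commW: "comm x y \<in> W m U'" if x: "x \<in> W m U" and U: "\<And>u. u \<in> U \<Longrightarrow> comm u y \<in> U'" for x y m U U'
  proof -
    from WE[OF x] obtain u where u: "u \<in> U" "eqm ?Q x (?c ^ m * u)" by (rule bexE)
    have "eqm ?Q (comm x y) (comm (?c ^ m * u) y)" by (rule eqm_comm[OF Q u(2) eqm_refl[OF Q]])
    moreover have "eqm ?Q (comm (?c ^ m * u) y) (?c ^ m * comm u y)"
      unfolding eqm_def comm_mult_left
      using two_sided_mult_right[OF Q comm_power_mem[OF Q cen]] by simp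
    ultimately show ?thesis by (rule WI[OF U[OF u(1)] eqm_trans[OF Q]])
  qed
  have multW: "x * y \<in> W m U'" if x: "x \<in> W m U" and U: "\<And>u. u \<in> U \<Longrightarrow> u * y \<in> U'" for x y m U U'
  proof -
    from WE[OF x] obtain u where u: "u \<in> U" "eqm ?Q x (?c ^ m * u)" by (rule bexE)
    have "eqm ?Q (x * y) (?c ^ m * (u * y))"
      using eqm_mult[OF Q u(2) eqm_refl[OF Q, of y]] by (simp add: mult.assoc)
    then show ?thesis by (rule WI[OF U[OF u(1)]])
  qed
  have ulpW: "ulp (a + b) \<subseteq> W m (ulp b)" if a: "ulp a \<subseteq> W m UNIV" for a b m
  proof (induction b)
    case 0
    then show ?case using a by simp
  next
    case (Suc b)
    let ?S = "pm.span {comm x y |x y. x \<in> ulp b} :: ('a free_mon \<Rightarrow>\<^sub>0 'f) set"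
    have 1: "pm.span {comm x y |x y. x \<in> ulp (a + b)} \<subseteq> W m ?S"
    proof (intro pm.span_minimal subW pm.subspace_span subsetI)
      fix t :: "'a free_mon \<Rightarrow>\<^sub>0 'f" assume "t \<in> {comm x y |x y. x \<in> ulp (a + b)}"
      then obtain x y where "t = comm x y" "x \<in> W m (ulp b)" using Suc by blast
      moreover have "comm u y \<in> ?S" if "u \<in> ulp b" for u
        using that by (intro pm.span_base) blast
      ultimately show "t \<in> W m ?S" by (simp only: commW)
    qed
    have "ulp (Suc (a + b)) \<subseteq> W m (ulp (Suc b))"
      unfolding ulp.simps(2)[of "a + b"]
    proof (intro pm.span_minimal subW subspace_ulp subsetI)
      fix t :: "'a free_mon \<Rightarrow>\<^sub>0 'f" assume "t \<in> {x * y |x y. x \<in> pm.span {comm x y |x y. x \<in> ulp (a + b)}}"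
      then obtain x y where "t = x * y" "x \<in> W m ?S" using 1 by blast
      moreover have "u * y \<in> ulp (Suc b)" if "u \<in> ?S" for u
        unfolding ulp.simps(2) using that by (intro pm.span_base) blast
      ultimately show "t \<in> W m (ulp (Suc b))" by (simp only: multW)
    qed
    then show ?case by simp
  qed
  have W1: "env_ideal_mod (span (insert c I)) \<subseteq> W 1 UNIV"
    unfolding env_ideal_mod_def[of "span _"]
  proof (rule gen_ideal_minimal)
    have s: "pm.subspace (W 1 UNIV)" by (intro subW) simp
    show "two_sided (W 1 UNIV)"
      unfolding two_sided_def
    proof (intro conjI ballI allI)
      fix a t assume a: "a \<in> W 1 UNIV"
      from WE[OF this] obtain u where u: "eqm ?Q a (?c * u)" by auto
      have "eqm ?Q (t * a) (t * (?c * u))" by (rule eqm_mult[OF Q eqm_refl[OF Q] u])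
      moreover have "eqm ?Q (t * (?c * u)) (?c * (t * u))"
      proof -
        have "t * (?c * u) - ?c * (t * u) = comm t ?c * u" by (simp add: comm_def algebra_simps)
        then show ?thesis unfolding eqm_def
          using two_sided_mult_right[OF Q comm_swap_mem[OF Q cen]] by simp
      qed
      ultimately have "eqm ?Q (t * a) (?c * (t * u))" by (rule eqm_trans[OF Q])
      then have "eqm ?Q (t * a) (?c ^ 1 * (t * u))" by simp
      then show "t * a \<in> W 1 UNIV" by (rule WI[OF UNIV_I])
      show "a * t \<in> W 1 UNIV" by (rule multW[OF a]) simp
    next
      show "0 \<in> W 1 UNIV" by (rule pm.subspace_0[OF s])
    next
      fix a b assume "a \<in> W 1 UNIV" "b \<in> W 1 UNIV"
      then show "a + b \<in> W 1 UNIV" by (rule pm.subspace_add[OF s])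
    qed
    have QW: "?Q \<subseteq> W 1 UNIV"
      by (intro subsetI WI[of 0]) (simp_all add: eqm_def)
    have "free_gen v \<in> W 1 UNIV" if v: "v \<in> span (insert c I)" for v
    proof -
      have sp: "span I = I" using sI by simp
      from v obtain a where a: "v - scale a c \<in> I" unfolding span_breakdown_eq sp by blast
      have "eqm ?Q (free_gen ((v - scale a c) + scale a c)) (free_gen (v - scale a c) + free_gen (scale a c))"
        by (rule eqm_mono[OF env_ideal_subset_mod env_add])
      moreover have "eqm ?Q (free_gen (v - scale a c) + free_gen (scale a c)) (0 + scal a ?c)"
        by (rule eqm_add[OF Q _ eqm_mono[OF env_ideal_subset_mod env_scale]])
           (simp add: eqm_def free_gen_env_ideal_mod[OF a])
      moreover have "0 + scal a ?c = ?c ^ 1 * scal a 1" by simp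
      ultimately have "eqm ?Q (free_gen ((v - scale a c) + scale a c)) (?c ^ 1 * scal a 1)"
        by (metis eqm_trans[OF Q])
      then have "free_gen ((v - scale a c) + scale a c) \<in> W 1 UNIV" by (rule WI[OF UNIV_I])
      then show ?thesis by simp
    qed
    then show "restricted_relators scale bracket p pmap \<union> free_gen ` span (insert c I) \<subseteq> W 1 UNIV"
      using QW env_relators env_ideal_subset_mod by blast
  qed
  have "ulp (k * m) \<subseteq> W m UNIV" for m
  proof (induction m)
    case 0
    have "eqm ?Q t (?c ^ 0 * t)" for t by (simp add: eqm_refl[OF Q])
    then have "t \<in> W 0 UNIV" for t by (rule WI[OF UNIV_I])
    then show ?case by (intro subsetI)
  next
    case (Suc m)
    have "ulp (k * m + k) \<subseteq> W m (ulp k)" by (rule ulpW[OF Suc])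
    also have "\<dots> \<subseteq> W (Suc m) UNIV"
    proof
      fix t assume "t \<in> W m (ulp k)"
      from WE[OF this] obtain u where u: "u \<in> ulp k" "eqm ?Q t (?c ^ m * u)" by (rule bexE)
      have "u \<in> W 1 UNIV" using u(1) k W1 by (intro subsetD[OF W1] subsetD[OF k])
      from WE[OF this] obtain v where "eqm ?Q u (?c ^ 1 * v)" by (rule bexE)
      then have "eqm ?Q (?c ^ m * u) (?c ^ m * (?c ^ 1 * v))" by (intro eqm_mult[OF Q eqm_refl[OF Q]])
      then have "eqm ?Q t (?c ^ m * (?c ^ 1 * v))" by (rule eqm_trans[OF Q u(2)])
      moreover have "?c ^ m * (?c ^ 1 * v) = ?c ^ Suc m * v"
        by (simp only: power_Suc2 power_one_right mult.assoc)
      ultimately have "eqm ?Q t (?c ^ Suc m * v)" by (simp only:)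
      then show "t \<in> W (Suc m) UNIV" by (rule WI[OF UNIV_I])
    qed
    finally show ?case by (simp add: add.commute)
  qed
  moreover have "W p UNIV \<subseteq> ?Q"
  proof
    fix t assume "t \<in> W p UNIV"
    from WE[OF this] obtain u where u: "eqm ?Q t (?c ^ p * u)" by (rule bexE)
    have "eqm ?Q (?c ^ p) (free_gen (pmap c))"
      by (rule eqm_sym[OF Q eqm_mono[OF env_ideal_subset_mod env_pmap]])
    then have "?c ^ p \<in> ?Q" by (rule eqm_mem[OF Q _ free_gen_env_ideal_mod[OF c(2)]])
    then show "t \<in> ?Q" by (intro eqm_mem[OF Q u] two_sided_mult_right[OF Q])
  qed
  ultimately show ?thesis by blast
qed

lemma ulp_p_chain: "p_chain d I \<Longrightarrow> ulp k \<subseteq> env_ideal_mod I \<Longrightarrow> ulp (k * p ^ d) \<subseteq> env_ideal"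
proof (induction arbitrary: k rule: p_chain.induct)
  case zero
  then show ?case by (simp add: env_ideal_mod_zero)
next
  case (extend d I c)
  have "ulp (k * p) \<subseteq> env_ideal_mod I"
    by (rule ulp_central_step[OF p_chain_restricted_ideal[OF extend(1)] extend(3,4,6)])
  from extend.IH[OF this] show ?case by (simp add: mult.assoc)
qed

lemma ulp_one_subset:
  assumes "\<And>x y. bracket x y \<in> I"
  shows "ulp 1 \<subseteq> env_ideal_mod I"
proof -
  let ?Q = "env_ideal_mod I"
  note Q = two_sided_env_ideal_mod[of I]
  have "comm (free_gen x) t \<in> ?Q" for x t by (rule free_gen_central_mod) (rule assms)
  then have c: "comm a b \<in> ?Q" for a b
    by (rule comm_free_induct[OF Q comm_swap_mem[OF Q]])
  have "pm.span {comm a b |a b. a \<in> ulp 0} \<subseteq> ?Q"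
    using c by (intro pm.span_minimal subspace_two_sided[OF Q]) auto
  then show ?thesis
    unfolding One_nat_def ulp.simps(2)
    by (intro pm.span_minimal subspace_two_sided[OF Q]) (auto intro: two_sided_mult_right[OF Q])
qed

theorem ulp_upper_bound:
  assumes "p_chain d I" "\<And>x y. bracket x y \<in> I"
  shows "ulp (p ^ d) \<subseteq> env_ideal"
  using ulp_p_chain[OF assms(1) ulp_one_subset[OF assms(2)]] by simp

end

section \<open>Lie nilpotency of the enveloping algebra bounds the derived algebra\<close>

context restricted_lie_algebra begin

primrec gam :: "nat \<Rightarrow> 'a set" where
  "gam 0 = UNIV"
| "gam (Suc n) = span {bracket x y |x y. x \<in> gam n}"

lemma subspace_gam: "subspace (gam n)"
  by (cases n) simp_all

text \<open>
  A commutator in \<open>L\<close> is a commutator in the enveloping algebra, in which \<open>L\<close> embeds; so Lie nilpotency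
  passes to \<open>L\<close>.
\<close>

lemma gam_lcs: "x \<in> gam n \<Longrightarrow> \<exists>t\<in>lcs n. eqm env_ideal (free_gen x) t"
proof (induction n arbitrary: x)
  case 0
  then show ?case by (intro bexI[of _ "free_gen x"] eqm_refl two_sided_env_ideal) simp
next
  case (Suc n)
  note E = two_sided_env_ideal
  have "x \<in> span {bracket x y |x y. x \<in> gam n}" using Suc.prems by simp
  then show ?case
  proof (induction rule: span_induct_alt)
    case base
    have "eqm env_ideal (free_gen 0) 0" using free_gen_zero_mem by (simp add: eqm_def)
    then show ?case using pm.subspace_0[OF subspace_lcs, of "Suc n"] by (rule bexI)
  next
    case (step c u z)
    then obtain x y where u: "u = bracket x y" "x \<in> gam n" by blast
    obtain s where s: "s \<in> lcs n" "eqm env_ideal (free_gen x) s" using Suc.IH[OF u(2)] by (rule bexE)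
    obtain t where t: "t \<in> lcs (Suc n)" "eqm env_ideal (free_gen z) t" using step(2) by (rule bexE)
    have "eqm env_ideal (free_gen u) (comm s (free_gen y))"
      unfolding u(1) by (rule eqm_trans[OF E env_bracket eqm_comm[OF E s(2) eqm_refl[OF E]]])
    then have "eqm env_ideal (free_gen (scale c u)) (scal c (comm s (free_gen y)))"
      by (rule eqm_trans[OF E env_scale eqm_scal[OF E]])
    then have "eqm env_ideal (free_gen (scale c u + z)) (scal c (comm s (free_gen y)) + t)"
      by (rule eqm_trans[OF E env_add eqm_add[OF E _ t(2)]])
    moreover have "scal c (comm s (free_gen y)) + t \<in> lcs (Suc n)"
      by (rule pm.subspace_add[OF subspace_lcs pm.subspace_scale[OF subspace_lcs comm_in_lcs[OF s(1)]] t(1)])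
    ultimately show ?case by (rule bexI)
  qed
qed

lemma free_gen_in_env_ideal_mod_iff:
  assumes I: "restricted_ideal I"
  shows "free_gen x \<in> env_ideal_mod I \<longleftrightarrow> x \<in> I"
proof
  assume x: "free_gen x \<in> env_ideal_mod I"
  show "x \<in> I"
  proof (rule ccontr)
    assume "x \<notin> I"
    moreover have "span I = I" using I by (simp add: restricted_ideal_def)
    ultimately have "x \<notin> span I" by blast
    then have "gprod [x] \<notin> env_ideal_mod I"
      by (intro gprod_not_in_env_ideal_mod[OF I]) simp
    then show False using x by simp
  qed
qed (rule free_gen_env_ideal_mod)

lemma gam_eq_zero:
  assumes "lcs n \<subseteq> env_ideal"
  shows "gam n = {0}"
proof -
  have "x = 0" if x: "x \<in> gam n" for x
  proof -
    obtain t where "t \<in> lcs n" "eqm env_ideal (free_gen x) t" using gam_lcs[OF x] by (rule bexE)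
    then have "free_gen x \<in> env_ideal_mod {0}"
      using assms eqm_mem[OF two_sided_env_ideal] unfolding env_ideal_mod_zero by blast
    then show ?thesis using free_gen_in_env_ideal_mod_iff[OF restricted_ideal_zero] by simp
  qed
  then show ?thesis using subspace_0[OF subspace_gam] by blast
qed

text \<open>
  Bracketing \<open>z\<^sub>1 \<dots> z\<^sub>t h\<close> with the product \<open>l h'\<close>, where the \<open>z\<^sub>i\<close> are central and \<open>h\<close> commutes with
  \<open>h'\<close>, gives \<open>z\<^sub>1 \<dots> z\<^sub>t [h, l] h'\<close>. So long products of central commutators lie deep in the lower
  central series.
\<close>

inductive comm_chain :: "'a set \<Rightarrow> 'a set \<Rightarrow> 'a list \<Rightarrow> 'a \<Rightarrow> bool" for I P where
  start: "h \<in> P \<Longrightarrow> comm_chain I P [] h"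
| step: "comm_chain I P zs h \<Longrightarrow> h' \<in> P \<Longrightarrow> bracket h h' \<in> I \<Longrightarrow> comm_chain I P (zs @ [bracket h l]) h'"

lemma comm_gprod_mem:
  assumes Q: "two_sided Q" and "\<And>z. z \<in> set zs \<Longrightarrow> comm (free_gen z) t \<in> Q"
  shows "comm (gprod zs) t \<in> Q"
  using assms(2)
proof (induction zs)
  case Nil
  then show ?case by (simp add: comm_def two_sided_zero[OF Q])
next
  case (Cons z zs)
  then have "comm (gprod zs) t \<in> Q" "comm (free_gen z) t \<in> Q" by simp_all
  then show ?case
    by (simp add: comm_mult_left two_sided_add[OF Q] two_sided_mult_left[OF Q] two_sided_mult_right[OF Q])
qed

lemma comm_chain_lcs:
  assumes cen: "\<And>h l x. h \<in> P \<Longrightarrow> bracket (bracket h l) x \<in> I" and "comm_chain I P zs h"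
  shows "h \<in> P \<and> (\<forall>z\<in>set zs. \<forall>x. bracket z x \<in> I) \<and>
    (\<exists>t\<in>lcs (length zs). eqm (env_ideal_mod I) t (gprod zs * free_gen h))"
  using assms(2)
proof (induction rule: comm_chain.induct)
  case (start h)
  then show ?case by (simp add: exI[of _ "free_gen h"] eqm_refl[OF two_sided_env_ideal_mod])
next
  case (step zs h h' l)
  let ?Q = "env_ideal_mod I"
  note Q = two_sided_env_ideal_mod[of I]
  let ?d = "free_gen l * free_gen h' :: 'a free_mon \<Rightarrow>\<^sub>0 'f"
  have h: "h \<in> P" "\<And>z x. z \<in> set zs \<Longrightarrow> bracket z x \<in> I" using step.IH by blast+
  from step.IH have "\<exists>t\<in>lcs (length zs). eqm ?Q t (gprod zs * free_gen h)" by blast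
  then obtain t where t: "t \<in> lcs (length zs)" "eqm ?Q t (gprod zs * free_gen h)" by (rule bexE)
  have 1: "eqm ?Q (comm t ?d) (comm (gprod zs * free_gen h) ?d)"
    by (rule eqm_comm[OF Q t(2) eqm_refl[OF Q]])
  have "comm (gprod zs) ?d \<in> ?Q"
    by (rule comm_gprod_mem[OF Q free_gen_central_mod[OF h(2)]])
  then have 2: "eqm ?Q (comm (gprod zs) ?d * free_gen h) 0"
    by (simp add: eqm_def two_sided_mult_right[OF Q])
  have "comm (free_gen h) (free_gen h') \<in> ?Q" by (rule free_gen_comm_mod[OF step.hyps(3)])
  then have 3: "eqm ?Q (free_gen l * comm (free_gen h) (free_gen h')) 0"
    by (simp add: eqm_def two_sided_mult_left[OF Q])
  have "eqm ?Q (comm (free_gen h) (free_gen l)) (free_gen (bracket h l))"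
    by (rule eqm_sym[OF Q eqm_mono[OF env_ideal_subset_mod env_bracket]])
  then have 4: "eqm ?Q (comm (free_gen h) (free_gen l) * free_gen h') (free_gen (bracket h l) * free_gen h')"
    by (rule eqm_mult[OF Q _ eqm_refl[OF Q]])
  have "eqm ?Q (comm (free_gen h) ?d) (0 + free_gen (bracket h l) * free_gen h')"
    unfolding comm_mult_right[of "free_gen h"] by (rule eqm_add[OF Q 3 4])
  then have "eqm ?Q (gprod zs * comm (free_gen h) ?d) (gprod zs * (0 + free_gen (bracket h l) * free_gen h'))"
    by (rule eqm_mult[OF Q eqm_refl[OF Q]])
  from eqm_add[OF Q this 2] have "eqm ?Q (comm (gprod zs * free_gen h) ?d)
      (gprod zs * (0 + free_gen (bracket h l) * free_gen h') + 0)"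
    unfolding comm_mult_left[of "gprod zs"] .
  from eqm_trans[OF Q 1 this] have "eqm ?Q (comm t ?d) (gprod (zs @ [bracket h l]) * free_gen h')"
    by (simp add: gprod_append mult.assoc)
  moreover have "comm t ?d \<in> lcs (length (zs @ [bracket h l]))"
    using comm_in_lcs[OF t(1), of ?d] by (simp del: lcs.simps)
  ultimately have "\<exists>t\<in>lcs (length (zs @ [bracket h l])). eqm ?Q t (gprod (zs @ [bracket h l]) * free_gen h')"
    by (rule bexI)
  moreover have "\<forall>z\<in>set (zs @ [bracket h l]). \<forall>x. bracket z x \<in> I"
    using h(2) cen[OF h(1)] by simp
  ultimately show ?case using step.hyps(2) by blast
qed

lemma span_central_mod:
  assumes I: "restricted_ideal I" and S: "\<And>z x. z \<in> S \<Longrightarrow> bracket z x \<in> I" and v: "v \<in> span (I \<union> S)"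
  shows "bracket v x \<in> I"
proof -
  have s: "subspace I" using I by (simp add: restricted_ideal_def)
  show ?thesis
    using v
  proof (induction rule: span_induct_alt)
    case base
    then show ?case using subspace_0[OF s] by simp
  next
    case (step c u w)
    have "bracket u x \<in> I" using step(1) S I by (auto simp: restricted_ideal_def)
    then show ?case using step(2)
      by (simp add: bracket_add_left bracket_scale_left subspace_add[OF s] subspace_scale[OF s])
  qed
qed

text \<open>
  A chain of length \<open>n\<close> whose members are independent modulo \<open>I\<close> is ruled out by the theorem of
  Poincare, Birkhoff and Witt: \<open>z\<^sub>1 \<dots> z\<^sub>n h\<close> would be a basis monomial, as \<open>h\<close> is independent of the
  central \<open>z\<^sub>i\<close> unless it is central itself.
\<close>

lemma comm_chain_bounded:
  assumes n: "lcs n \<subseteq> env_ideal" and I: "restricted_ideal I"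
    and cen: "\<And>h l x. h \<in> P \<Longrightarrow> bracket (bracket h l) x \<in> I"
    and chain: "comm_chain I P zs h" "length zs = n"
    and ind: "\<And>i. i < n \<Longrightarrow> zs ! i \<notin> span (I \<union> set (take i zs))"
  shows "bracket h l \<in> I"
proof (rule ccontr)
  assume nc: "bracket h l \<notin> I"
  note c = comm_chain_lcs[OF cen chain(1)]
  have "h \<notin> span (I \<union> set zs)" using span_central_mod[OF I, of "set zs" h l] c nc by blast
  then have "(zs @ [h]) ! i \<notin> span (I \<union> set (take i (zs @ [h])))" if "i < length (zs @ [h])" for i
    using that ind[of i] chain(2) by (cases "i < n") (auto simp: nth_append)
  then have "gprod (zs @ [h]) \<notin> env_ideal_mod I" by (rule gprod_not_in_env_ideal_mod[OF I])
  moreover obtain t where t: "t \<in> lcs n" "eqm (env_ideal_mod I) t (gprod zs * free_gen h)"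
    using c chain(2) by blast
  then have "t \<in> env_ideal_mod I" using n env_ideal_subset_mod by blast
  from eqm_mem[OF two_sided_env_ideal_mod eqm_sym[OF two_sided_env_ideal_mod t(2)] this]
  have "gprod (zs @ [h]) \<in> env_ideal_mod I" by (simp add: gprod_append)
  ultimately show False by blast
qed

lemma env_pmap_iterate: "eqm env_ideal (free_gen ((pmap ^^ a) x)) (free_gen x ^ (p ^ a))"
proof (induction a)
  case 0
  then show ?case by (simp add: eqm_refl[OF two_sided_env_ideal])
next
  case (Suc a)
  have "eqm env_ideal (free_gen (pmap ((pmap ^^ a) x))) (free_gen ((pmap ^^ a) x) ^ p)" by (rule env_pmap)
  from eqm_trans[OF two_sided_env_ideal this eqm_power[OF two_sided_env_ideal Suc, of p]]
  show ?case by (simp add: power_mult[symmetric] mult.commute)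
qed

text \<open>
  The constant chain with \<open>z = [h, l]\<close> gives \<open>z\<^sup>q h = z\<^sup>[\<^sup>p\<^sup>]\<^sup>n h\<close> for \<open>q = p\<^sup>n\<close>, a product of only two
  factors, which is nonzero unless \<open>z\<^sup>[\<^sup>p\<^sup>]\<^sup>n\<close> is zero.
\<close>

lemma central_commutator_p_nilpotent:
  assumes n: "lcs n \<subseteq> env_ideal" and I: "restricted_ideal I"
    and cen: "\<And>h l x. h \<in> P \<Longrightarrow> bracket (bracket h l) x \<in> I" and h: "h \<in> P"
  shows "\<exists>a. (pmap ^^ a) (bracket h l) \<in> I"
proof (rule ccontr)
  assume nonil: "\<nexists>a. (pmap ^^ a) (bracket h l) \<in> I"
  let ?z = "bracket h l" and ?Q = "env_ideal_mod I"
  note Q = two_sided_env_ideal_mod[of I]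
  have sI: "subspace I" using I by (simp add: restricted_ideal_def)
  define c where "c = (pmap ^^ n) ?z"
  have cI: "c \<notin> I" and zI: "?z \<notin> I" using nonil unfolding c_def by (blast, metis funpow_0)
  have ccen: "bracket c x \<in> I" for x
    unfolding c_def by (rule pmap_iterate_bracket[OF I cen[OF h]])
  have "comm_chain I P (replicate t ?z) h" for t
  proof (induction t)
    case 0
    then show ?case using comm_chain.start[OF h] by simp
  next
    case (Suc t)
    from comm_chain.step[OF Suc h, of l] show ?case
      by (simp add: bracket_self subspace_0[OF sI] replicate_append_same)
  qed
  from comm_chain_lcs[OF cen this[of "p ^ n"]]
  obtain t where t: "t \<in> lcs (p ^ n)" "eqm ?Q t (free_gen ?z ^ (p ^ n) * free_gen h)"
    by (auto simp: gprod_replicate)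
  \<comment> \<open>So \<open>p\<^sup>n\<close> brackets are enough to reach zero.\<close>
  have "n < p ^ n" using p_ge_2 by (intro power_gt_expt) simp
  then have "t \<in> ?Q" using t(1) n env_ideal_subset_mod lcs_antimono[of n "p ^ n"] by auto
  then have 1: "free_gen ?z ^ (p ^ n) * free_gen h \<in> ?Q" by (rule eqm_mem[OF Q eqm_sym[OF Q t(2)]])
  have "eqm ?Q (free_gen c * free_gen h) (free_gen ?z ^ (p ^ n) * free_gen h)"
    unfolding c_def by (rule eqm_mult[OF Q eqm_mono[OF env_ideal_subset_mod env_pmap_iterate] eqm_refl[OF Q]])
  from eqm_mem[OF Q this 1] have "gprod [c, h] \<in> ?Q" by simp
  moreover have "gprod [c, h] \<notin> ?Q"
  proof (rule gprod_not_in_env_ideal_mod[OF I])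
    fix i assume "i < length [c, h]"
    then consider "i = 0" | "i = 1" by fastforce
    then show "[c, h] ! i \<notin> span (I \<union> set (take i [c, h]))"
    proof cases
      case 1
      have "span I = I" using sI by simp
      then show ?thesis using cI 1 by (simp del: span_eq_iff)
    next
      case 2
      have "h \<notin> span (I \<union> {c})" using span_central_mod[OF I, of "{c}" h l] ccen zI by blast
      then show ?thesis using 2 by simp
    qed
  qed
  ultimately show False by blast
qed

text \<open>
  Otherwise there are arbitrarily long chains \<open>[h, l\<^sub>1], \<dots>, [h, l\<^sub>t]\<close> that are independent modulo \<open>I\<close>,
  with the same \<open>h\<close> in every step.
\<close>

lemma finite_rank_bracket:
  assumes n: "lcs n \<subseteq> env_ideal" and I: "restricted_ideal I"
    and cen: "\<And>h l x. h \<in> P \<Longrightarrow> bracket (bracket h l) x \<in> I" and h: "h \<in> P"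
  shows "\<exists>V. finite V \<and> V \<subseteq> U \<and> (\<forall>l\<in>U. bracket h l \<in> span (I \<union> bracket h ` V))"
proof (rule ccontr)
  assume contra: "\<nexists>V. finite V \<and> V \<subseteq> U \<and> (\<forall>l\<in>U. bracket h l \<in> span (I \<union> bracket h ` V))"
  have sI: "subspace I" using I by (simp add: restricted_ideal_def)
  have next_l: "\<exists>l\<in>U. bracket h l \<notin> span (I \<union> bracket h ` V)" if "finite V" "V \<subseteq> U" for V
    using contra that by blast
  have "\<exists>ls. length ls = t \<and> set ls \<subseteq> U \<and> comm_chain I P (map (bracket h) ls) h \<and>
    (\<forall>i<t. map (bracket h) ls ! i \<notin> span (I \<union> set (take i (map (bracket h) ls))))" for t
  proof (induction t)
    case 0
    then show ?case using comm_chain.start[OF h] by simp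
  next
    case (Suc t)
    then obtain ls where ls: "length ls = t" "set ls \<subseteq> U" "comm_chain I P (map (bracket h) ls) h"
      "\<And>i. i < t \<Longrightarrow> map (bracket h) ls ! i \<notin> span (I \<union> set (take i (map (bracket h) ls)))"
      by blast
    obtain l where l: "l \<in> U" "bracket h l \<notin> span (I \<union> bracket h ` set ls)"
      using next_l[OF _ ls(2)] by auto
    have "comm_chain I P (map (bracket h) (ls @ [l])) h"
      using comm_chain.step[OF ls(3) h, of l] by (simp add: bracket_self subspace_0[OF sI])
    moreover have "map (bracket h) (ls @ [l]) ! i \<notin> span (I \<union> set (take i (map (bracket h) (ls @ [l]))))"
      if "i < Suc t" for i
    proof (cases "i < t")
      case True
      then show ?thesis using ls(4)[OF True] ls(1) by (simp add: nth_append)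
    next
      case False
      then have "i = t" using that by simp
      then show ?thesis using l(2) ls(1) by (simp add: nth_append)
    qed
    ultimately show ?case using ls(1,2) l(1) by (intro exI[of _ "ls @ [l]"]) auto
  qed
  then obtain ls where ls: "length ls = n" "comm_chain I P (map (bracket h) ls) h"
    "\<And>i. i < n \<Longrightarrow> map (bracket h) ls ! i \<notin> span (I \<union> set (take i (map (bracket h) ls)))"
    by blast
  have "bracket h l \<in> I" for l
    by (rule comm_chain_bounded[OF n I cen ls(2) _ ls(3)]) (simp_all add: ls(1))
  moreover obtain l where "bracket h l \<notin> span (I \<union> bracket h ` {})" using next_l[of "{}"] by blast
  moreover have "span (I \<union> bracket h ` {}) = I" using sI by simp
  ultimately show False by blast
qed

lemma span_image_bracket:
  assumes I: "subspace I" and v: "v \<in> span (I \<union> bracket h ` V)"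
  shows "\<exists>w\<in>span V. v - bracket h w \<in> I"
  using v
proof (induction rule: span_induct_alt)
  case base
  show ?case by (rule bexI[OF _ span_zero]) (simp add: subspace_0[OF I])
next
  case (step c u w)
  then obtain w' where w': "w' \<in> span V" "w - bracket h w' \<in> I" by (elim bexE)
  from step(1) show ?case
  proof
    assume u: "u \<in> I"
    have "scale c u + w - bracket h w' \<in> I"
      using subspace_add[OF I subspace_scale[OF I u, of c] w'(2)] by (simp add: add_diff_eq)
    then show ?thesis using w'(1) by (rule bexI)
  next
    assume "u \<in> bracket h ` V"
    then obtain v where u: "u = bracket h v" "v \<in> V" by (rule imageE)
    have "scale c u + w - bracket h (scale c v + w') \<in> I"
      using w'(2) by (simp add: u(1) bracket_add_right bracket_scale_right)
    moreover have "scale c v + w' \<in> span V"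
      by (rule span_add[OF span_scale[OF span_base[OF u(2)]] w'(1)])
    ultimately show ?thesis by (rule bexI)
  qed
qed

text \<open>
  Otherwise a long independent chain exists. The next \<open>h'\<close> has to commute with the current \<open>h\<close> modulo
  \<open>I\<close>; since the bracket with \<open>h\<close> has finite rank, such \<open>h'\<close> have finite codimension in \<open>P\<close>, and the
  brackets with a finite complement only span a finite-dimensional space, by the same argument.
\<close>

lemma finite_commutators:
  assumes n: "lcs n \<subseteq> env_ideal" and I: "restricted_ideal I" and P: "subspace P"
    and cen: "\<And>h l x. h \<in> P \<Longrightarrow> bracket (bracket h l) x \<in> I"
  shows "\<exists>S. finite S \<and> S \<subseteq> {bracket h l |h l. h \<in> P} \<and> (\<forall>h\<in>P. \<forall>l. bracket h l \<in> span (I \<union> S))"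
proof (rule ccontr)
  let ?G = "{bracket h l |h l. h \<in> P}"
  assume contra: "\<nexists>S. finite S \<and> S \<subseteq> ?G \<and> (\<forall>h\<in>P. \<forall>l. bracket h l \<in> span (I \<union> S))"
  have sI: "subspace I" using I by (simp add: restricted_ideal_def)
  have nxt: "\<exists>h\<in>P. \<exists>l. bracket h l \<notin> span (I \<union> S)" if "finite S" "S \<subseteq> ?G" for S
    using contra that by blast
  have "\<exists>zs h l. length zs = t \<and> set zs \<subseteq> ?G \<and> comm_chain I P zs h \<and> h \<in> P \<and>
    (\<forall>i<t. zs ! i \<notin> span (I \<union> set (take i zs))) \<and> bracket h l \<notin> span (I \<union> set zs)" for t
  proof (induction t)
    case 0
    obtain h l where hl: "h \<in> P" "bracket h l \<notin> span (I \<union> {})" using nxt[of "{}"] by auto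
    show ?case by (rule exI[of _ "[]"], rule exI[of _ h], rule exI[of _ l])
        (use hl comm_chain.start[OF hl(1)] in simp)
  next
    case (Suc t)
    then obtain zs h l where s: "length zs = t" "set zs \<subseteq> ?G" "comm_chain I P zs h" "h \<in> P"
      "\<And>i. i < t \<Longrightarrow> zs ! i \<notin> span (I \<union> set (take i zs))" "bracket h l \<notin> span (I \<union> set zs)"
      by blast
    obtain V where V: "finite V" "V \<subseteq> P" "\<And>x. x \<in> P \<Longrightarrow> bracket h x \<in> span (I \<union> bracket h ` V)"
      using finite_rank_bracket[OF n I cen s(4), of P] by blast
    have "\<forall>v\<in>V. \<exists>K. finite K \<and> (\<forall>x. bracket v x \<in> span (I \<union> bracket v ` K))"
    proof
      fix v assume "v \<in> V"
      then have "v \<in> P" using V(2) by (rule subsetD[rotated])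
      from finite_rank_bracket[OF n I cen this, where U = UNIV]
      show "\<exists>K. finite K \<and> (\<forall>x. bracket v x \<in> span (I \<union> bracket v ` K))" by auto
    qed
    from bchoice[OF this] obtain K where K: "\<And>v. v \<in> V \<Longrightarrow> finite (K v)"
      "\<And>v x. v \<in> V \<Longrightarrow> bracket v x \<in> span (I \<union> bracket v ` K v)" by auto
    define S where "S = set (zs @ [bracket h l]) \<union> (\<Union>v\<in>V. bracket v ` K v)"
    have S: "finite S" "S \<subseteq> ?G"
    proof -
      show "finite S" unfolding S_def using V(1) K(1) by simp
      have "bracket v ` K v \<subseteq> ?G" if "v \<in> V" for v
        using subsetD[OF V(2) that] by blast
      moreover have "set (zs @ [bracket h l]) \<subseteq> ?G" using s(2,4) by auto
      ultimately show "S \<subseteq> ?G" unfolding S_def by (intro Un_least UN_least)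
    qed
    obtain h0 l0 where hl0: "h0 \<in> P" "bracket h0 l0 \<notin> span (I \<union> S)" using nxt[OF S] by blast
    obtain w where w: "w \<in> span V" "bracket h h0 - bracket h w \<in> I"
      using span_image_bracket[OF sI V(3)[OF hl0(1)]] by (rule bexE)
    have wP: "w \<in> P" using w(1) span_minimal[OF V(2) P] by blast
    let ?h = "h0 - w"
    have h': "?h \<in> P" "bracket h ?h \<in> I"
      using subspace_diff[OF P hl0(1) wP] w(2) by (simp_all add: bracket_diff_right)
    have "bracket w l0 \<in> span (I \<union> S)"
      using w(1)
    proof (induction rule: span_induct_alt)
      case base
      then show ?case by (simp add: span_zero)
    next
      case (step c v u)
      have "I \<union> bracket v ` K v \<subseteq> I \<union> S" using step(1) by (auto simp: S_def)
      then have "bracket v l0 \<in> span (I \<union> S)" using K(2)[OF step(1)] span_mono by blast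
      then show ?case using step(2)
        by (simp add: bracket_add_left bracket_scale_left span_add span_scale)
    qed
    then have "bracket ?h l0 \<notin> span (I \<union> S)"
      using hl0(2) span_add[of "bracket ?h l0" "I \<union> S" "bracket w l0"]
      unfolding bracket_diff_left diff_add_cancel by blast
    moreover have "span (I \<union> set (zs @ [bracket h l])) \<subseteq> span (I \<union> S)"
      by (rule span_mono) (auto simp: S_def)
    ultimately have 1: "bracket ?h l0 \<notin> span (I \<union> set (zs @ [bracket h l]))" by blast
    have 2: "comm_chain I P (zs @ [bracket h l]) ?h" by (rule comm_chain.step[OF s(3) h'])
    have 3: "(zs @ [bracket h l]) ! i \<notin> span (I \<union> set (take i (zs @ [bracket h l])))" if "i < Suc t" for i
    proof (cases "i < t")
      case True
      then show ?thesis using s(5)[OF True] s(1) by (simp add: nth_append)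
    next
      case False
      then have "i = t" using that by simp
      then show ?thesis using s(6) s(1) by (simp add: nth_append)
    qed
    have 4: "set (zs @ [bracket h l]) \<subseteq> ?G" using s(2,4) by auto
    show ?case
      by (rule exI[of _ "zs @ [bracket h l]"], rule exI[of _ ?h], rule exI[of _ l0])
         (use 1 2 3 4 h'(1) s(1) in simp)
  qed
  then obtain zs h l where s: "length zs = n" "comm_chain I P zs h"
    "\<And>i. i < n \<Longrightarrow> zs ! i \<notin> span (I \<union> set (take i zs))" "bracket h l \<notin> span (I \<union> set zs)"
    by blast
  have "bracket h l \<in> I" by (rule comm_chain_bounded[OF n I cen s(2,1,3)])
  then show False using s(4) span_base[of "bracket h l" "I \<union> set zs"] by blast
qed

lemma p_chain_absorb_commutators:
  assumes n: "lcs n \<subseteq> env_ideal" and I: "p_chain d I" "I \<subseteq> H" and H: "restricted_subalgebra scale bracket pmap H"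
    and P: "subspace P" and cen: "\<And>h l x. h \<in> P \<Longrightarrow> bracket (bracket h l) x \<in> I"
    and PH: "\<And>h l. h \<in> P \<Longrightarrow> bracket h l \<in> H"
  shows "\<exists>d' I'. p_chain d' I' \<and> I' \<subseteq> H \<and> (\<forall>h\<in>P. \<forall>l. bracket h l \<in> I')"
proof -
  note rI = p_chain_restricted_ideal[OF I(1)]
  obtain S where S: "finite S" "S \<subseteq> {bracket h l |h l. h \<in> P}"
    "\<And>h l. h \<in> P \<Longrightarrow> bracket h l \<in> span (I \<union> S)"
    using finite_commutators[OF n rI P cen] by blast
  have "\<exists>d' I'. p_chain d' I' \<and> S \<union> I \<subseteq> I' \<and> I' \<subseteq> H"
  proof (rule p_chain_add_finite[OF I H S(1)])
    fix z assume "z \<in> S"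
    then obtain h l where z: "z = bracket h l" "h \<in> P" using S(2) by blast
    show "z \<in> H" unfolding z(1) by (rule PH[OF z(2)])
    show "bracket z x \<in> I" for x unfolding z(1) by (rule cen[OF z(2)])
    show "\<exists>a. (pmap ^^ a) z \<in> I" unfolding z(1) by (rule central_commutator_p_nilpotent[OF n rI cen z(2)])
  qed
  then obtain d' I' where I': "p_chain d' I'" "S \<union> I \<subseteq> I'" "I' \<subseteq> H" by blast
  have "subspace I'" using p_chain_restricted_ideal[OF I'(1)] by (simp add: restricted_ideal_def)
  then have "span (I \<union> S) \<subseteq> I'" using I'(2) by (intro span_minimal) auto
  then have "\<forall>h\<in>P. \<forall>l. bracket h l \<in> I'" using S(3) by blast
  then show ?thesis using I'(1,3) by blast
qed

definition derived_p :: "'a set" where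
  "derived_p = generated_restricted_subalgebra scale bracket pmap (derived_subalgebra scale bracket)"

lemma restricted_subalgebra_derived_p: "restricted_subalgebra scale bracket pmap derived_p"
proof -
  have "subspace derived_p"
    unfolding derived_p_def generated_restricted_subalgebra_def
    by (rule subspace_Inter) (auto simp: restricted_subalgebra_def)
  then show ?thesis
    unfolding derived_p_def generated_restricted_subalgebra_def restricted_subalgebra_def by blast
qed

lemma bracket_in_derived_p: "bracket x y \<in> derived_p"
  unfolding derived_p_def generated_restricted_subalgebra_def derived_subalgebra_def
  using span_base[of "bracket x y" "{bracket x y |x y. True}"] by blast

text \<open>
  Starting from the last nonzero term of the lower central series of \<open>L\<close>, one term after another is
  absorbed into the chain; modulo the chain built so far, the next term consists of central
  commutators.
\<close>

theorem p_chain_derived_p: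
  assumes n: "lcs n \<subseteq> env_ideal"
  shows "\<exists>d. p_chain d derived_p"
proof -
  note H = restricted_subalgebra_derived_p
  have "\<exists>d I. p_chain d I \<and> I \<subseteq> derived_p \<and> gam (Suc (n - k)) \<subseteq> I" if "k \<le> n" for k
    using that
  proof (induction k)
    case 0
    have "gam (Suc n) \<subseteq> {0}"
      unfolding gam.simps(2) gam_eq_zero[OF n] by (rule span_minimal) auto
    moreover have "0 \<in> derived_p" using H by (simp add: restricted_subalgebra_def subspace_0)
    ultimately show ?case using p_chain.zero by (intro exI[of _ 0] exI[of _ "{0}"]) simp
  next
    case (Suc k)
    define m where "m = n - Suc k"
    have m: "n - k = Suc m" using Suc.prems by (simp add: m_def)
    obtain d I where I: "p_chain d I" "I \<subseteq> derived_p" "gam (Suc (n - k)) \<subseteq> I"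
      using Suc by auto
    have cen: "bracket (bracket h l) x \<in> I" if h: "h \<in> gam m" for h l x
    proof -
      have "bracket h l \<in> gam (Suc m)" unfolding gam.simps(2) using h by (intro span_base) blast
      then have "bracket (bracket h l) x \<in> gam (Suc (Suc m))"
        unfolding gam.simps(2)[of "Suc m"] by (intro span_base) blast
      then show ?thesis using I(3) unfolding m by (rule subsetD[rotated])
    qed
    obtain d' I' where I': "p_chain d' I'" "I' \<subseteq> derived_p" "\<And>h l. h \<in> gam m \<Longrightarrow> bracket h l \<in> I'"
      using p_chain_absorb_commutators[OF n I(1,2) H subspace_gam cen bracket_in_derived_p] by blast
    have "subspace I'" using p_chain_restricted_ideal[OF I'(1)] by (simp add: restricted_ideal_def)
    then have "gam (Suc m) \<subseteq> I'" unfolding gam.simps(2) using I'(3) by (intro span_minimal) auto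
    then show ?case using I'(1,2) unfolding m_def by blast
  qed
  from this[of n] obtain d I where I: "p_chain d I" "I \<subseteq> derived_p" "gam (Suc 0) \<subseteq> I" by auto
  have "derived_subalgebra scale bracket = gam (Suc 0)" by (simp add: derived_subalgebra_def)
  then have "derived_subalgebra scale bracket \<subseteq> I" using I(3) by simp
  moreover have "restricted_subalgebra scale bracket pmap I"
    using p_chain_restricted_ideal[OF I(1)] by (simp add: restricted_ideal_def restricted_subalgebra_def)
  ultimately have "derived_p \<subseteq> I" unfolding derived_p_def generated_restricted_subalgebra_def by blast
  then have "I = derived_p" using I(2) by blast
  then show ?thesis using I(1) by blast
qed

end

section \<open>Weights on the subalgebra generated by two elements\<close>

lemma (in restricted_lie_algebra) pmap_iterate_scale:
  "(pmap ^^ n) (scale c v) = scale (c ^ (p ^ n)) ((pmap ^^ n) v)"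
  by (induction n) (simp_all add: pmap_scale power_mult[symmetric] mult.commute)

lemma (in restricted_lie_algebra) pmap_iterate_zero [simp]: "(pmap ^^ n) 0 = 0"
  by (induction n) simp_all

lemma (in restricted_lie_algebra) bracket_pmap_iterate:
  "bracket ((pmap ^^ b) u) v = (bracket u ^^ (p ^ b)) v"
proof (induction b arbitrary: v)
  case (Suc b)
  have e: "bracket ((pmap ^^ b) u) = (bracket u ^^ (p ^ b))" using Suc by (rule ext)
  have "bracket ((pmap ^^ Suc b) u) v = (bracket ((pmap ^^ b) u) ^^ p) v" by (simp add: bracket_pmap)
  also have "\<dots> = (bracket u ^^ (p ^ Suc b)) v" unfolding e by (simp add: funpow_mult mult.commute)
  finally show ?case .
qed simp

locale commutator_weights = restricted_lie_algebra scale bracket p pmap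
  for scale :: "'f::field \<Rightarrow> 'a::ab_group_add \<Rightarrow> 'a" and bracket p pmap +
  fixes x y :: 'a and K i :: nat
begin

primrec lword :: "nat \<Rightarrow> 'a set" where
  "lword 0 = {x, y}"
| "lword (Suc a) = (if a = 0 then {bracket x y} else {bracket v l |v l. v \<in> lword a \<and> l \<in> {x, y}})"

definition layer :: "nat \<Rightarrow> 'a set" where
  "layer a = span (\<Union>a'\<in>{a..}. lword a')"

lemma lword_SucE:
  assumes "v \<in> lword (Suc a)"
  obtains u l where "u \<in> lword a" "l \<in> {x, y}" "v = bracket u l"
  using assms by (cases "a = 0") auto

lemma lword_layer: "v \<in> lword a \<Longrightarrow> v \<in> layer a"
  unfolding layer_def by (intro span_base) auto

lemma layer_antimono: "a \<le> b \<Longrightarrow> layer b \<subseteq> layer a"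
  unfolding layer_def by (intro span_mono UN_mono) auto

lemma subspace_layer: "subspace (layer a)"
  unfolding layer_def by (rule subspace_span)

lemma layer_induct [consumes 1, case_names base step]:
  assumes "v \<in> layer a" "Q 0"
    and "\<And>c u w a'. a \<le> a' \<Longrightarrow> u \<in> lword a' \<Longrightarrow> w \<in> layer a \<Longrightarrow> Q w \<Longrightarrow> Q (scale c u + w)"
  shows "Q v"
proof -
  have "Q v \<and> v \<in> layer a"
    using assms(1)[unfolded layer_def]
  proof (induction rule: span_induct_alt)
    case base
    then show ?case using assms(2) subspace_0[OF subspace_layer] by simp
  next
    case (step c u w)
    then obtain a' where a': "a \<le> a'" "u \<in> lword a'" by auto
    have "u \<in> layer a" using lword_layer[OF a'(2)] layer_antimono[OF a'(1)] by blast
    then show ?case using assms(3)[OF a'] step(2)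
      by (simp add: subspace_add[OF subspace_layer] subspace_scale[OF subspace_layer])
  qed
  then show ?thesis by simp
qed

lemma bracket_layer_letter:
  assumes "v \<in> layer a" "l \<in> {x, y}"
  shows "bracket v l \<in> layer (Suc a)"
  using assms(1)
proof (induction rule: layer_induct)
  case base
  then show ?case using subspace_0[OF subspace_layer] by simp
next
  case (step c u w a')
  have "bracket u l \<in> layer (Suc a')"
  proof (cases "a' = 0")
    case True
    have xy: "bracket x y \<in> layer (Suc 0)" by (rule lword_layer) simp
    have "bracket y x \<in> layer (Suc 0)"
      by (subst bracket_swap) (rule subspace_neg[OF subspace_layer xy])
    then show ?thesis using True step(2) assms(2) xy subspace_0[OF subspace_layer] bracket_self by auto
  next
    case False
    then have "bracket u l \<in> lword (Suc a')" using step(2) assms(2) by auto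
    then show ?thesis by (rule lword_layer)
  qed
  then have "bracket u l \<in> layer (Suc a)" using layer_antimono[of "Suc a" "Suc a'"] step(1) by auto
  then show ?case using step(4)
    by (simp add: bracket_add_left bracket_scale_left subspace_add[OF subspace_layer] subspace_scale[OF subspace_layer])
qed

lemma bracket_layer_lword: "v \<in> lword b \<Longrightarrow> u \<in> layer a \<Longrightarrow> bracket u v \<in> layer (a + b + 1)"
proof (induction b arbitrary: u v a)
  case 0
  then show ?case using bracket_layer_letter[of u a v] by simp
next
  case (Suc b)
  obtain w l where w: "w \<in> lword b" "l \<in> {x, y}" "v = bracket w l" using Suc.prems(1) by (rule lword_SucE)
  have "bracket (bracket u w) l \<in> layer (a + Suc b + 1)"
    using bracket_layer_letter[OF Suc.IH[OF w(1) Suc.prems(2)] w(2)] by simp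
  moreover have "bracket (bracket u l) w \<in> layer (a + Suc b + 1)"
    using Suc.IH[OF w(1) bracket_layer_letter[OF Suc.prems(2) w(2)]] by simp
  ultimately show ?case unfolding w(3) bracket_bracket_right[of u w l]
    by (rule subspace_diff[OF subspace_layer])
qed

lemma bracket_layer:
  assumes "u \<in> layer a" "v \<in> layer b"
  shows "bracket u v \<in> layer (a + b + 1)"
  using assms(2)
proof (induction rule: layer_induct)
  case base
  then show ?case using subspace_0[OF subspace_layer] by simp
next
  case (step c w v b')
  have "bracket u w \<in> layer (a + b + 1)"
    using bracket_layer_lword[OF step(2) assms(1)] layer_antimono[of "a + b + 1" "a + b' + 1"] step(1) by auto
  then show ?case using step(4)
    by (simp add: bracket_add_right bracket_scale_right subspace_add[OF subspace_layer] subspace_scale[OF subspace_layer])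
qed

lemma bracket_layer_iterate:
  assumes "v \<in> layer b" "u \<in> layer a"
  shows "(bracket v ^^ k) u \<in> layer (a + k * (b + 1))"
proof (induction k)
  case (Suc k)
  show ?case using bracket_layer[OF assms(1) Suc] by (simp add: algebra_simps)
qed (simp add: assms)

text \<open>
  A commutator of length \<open>a + 1\<close> has weight \<open>K a\<close>, plus a correction that makes the weight grow
  strictly faster than \<open>K a\<close> beyond \<open>a = i\<close>. Convexity of the correction keeps the filtration
  compatible with brackets and \<open>p\<close>-th powers.
\<close>

definition weight :: "nat \<Rightarrow> nat" where
  "weight a = K * a + (a - i)"

definition D :: "nat \<Rightarrow> 'a set" where
  "D n = span {(pmap ^^ b) u |u b. \<exists>a. u \<in> layer a \<and> n \<le> weight a * p ^ b}"

lemma subspace_D: "subspace (D n)"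
  unfolding D_def by (rule subspace_span)

lemma antimono_D:
  assumes "m \<le> n"
  shows "D n \<subseteq> D m"
  unfolding D_def by (rule span_mono) (use assms order_trans in blast)

lemma pmap_iterate_in_D: "u \<in> layer a \<Longrightarrow> n \<le> weight a * p ^ b \<Longrightarrow> (pmap ^^ b) u \<in> D n"
  unfolding D_def by (rule span_base) blast

lemma layer_in_D: "u \<in> layer a \<Longrightarrow> n \<le> weight a \<Longrightarrow> u \<in> D n"
  using pmap_iterate_in_D[of u a n 0] by simp

lemma D_induct [consumes 1, case_names base step]:
  assumes "v \<in> D n" "Q 0"
    and "\<And>c u b a w. u \<in> layer a \<Longrightarrow> n \<le> weight a * p ^ b \<Longrightarrow> w \<in> D n \<Longrightarrow> Q w \<Longrightarrow>
      Q (scale c ((pmap ^^ b) u) + w)"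
  shows "Q v"
proof -
  have "Q v \<and> v \<in> D n"
    using assms(1)[unfolded D_def]
  proof (induction rule: span_induct_alt)
    case base
    then show ?case using assms(2) subspace_0[OF subspace_D] by simp
  next
    case (step c t w)
    then obtain u b a where u: "t = (pmap ^^ b) u" "u \<in> layer a" "n \<le> weight a * p ^ b" by auto
    have "t \<in> D n" unfolding u(1) by (rule pmap_iterate_in_D[OF u(2,3)])
    then show ?case using assms(3)[OF u(2,3)] step(2) unfolding u(1)
      by (simp add: subspace_add[OF subspace_D] subspace_scale[OF subspace_D])
  qed
  then show ?thesis by simp
qed

text \<open>
  The argument on the right is \<open>P (a + 1) + Q (b + 1) - 1\<close>, the index of an iterated commutator of \<open>P\<close>
  elements of length \<open>a + 1\<close> and \<open>Q\<close> elements of length \<open>b + 1\<close>. The correction \<open>max(0, a - i)\<close> is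
  convex and vanishes at \<open>0\<close>, hence superadditive.
\<close>

lemma weight_bracket:
  assumes "1 \<le> P" "1 \<le> Q"
  shows "weight a * P + weight b * Q + K \<le> weight (a + Q * (b + 1) + (P - 1) * (a + 1))"
proof -
  obtain P' Q' where P': "P = Suc P'" and Q': "Q = Suc Q'" using assms by (metis Suc_diff_1 less_eq_Suc_le One_nat_def)
  let ?A = "a + Q * (b + 1) + (P - 1) * (a + 1)"
  have A: "a * P + b * Q + 1 \<le> ?A" unfolding P' Q' by (simp add: algebra_simps)
  have 1: "K * (a * P + b * Q + 1) \<le> K * ?A" using A by (rule mult_le_mono2)
  have 2: "(a - i) * P + (b - i) * Q \<le> ?A - i"
  proof -
    have "(a - i) * P + (b - i) * Q \<le> (a * P + b * Q) - i"
    proof -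
      have "i \<le> i * P" "i \<le> i * Q" using assms by simp_all
      consider "a \<le> i" "b \<le> i" | "a \<le> i" "i < b" | "i < a" "b \<le> i" | "i < a" "i < b" by linarith
      then show ?thesis
      proof cases
        case 1
        then show ?thesis by simp
      next
        case 2
        have "(b - i) * Q = b * Q - i * Q" by (rule diff_mult_distrib)
        moreover have "(a - i) * P = 0" using 2 by simp
        ultimately show ?thesis using \<open>i \<le> i * Q\<close> by linarith
      next
        case 3
        have "(a - i) * P = a * P - i * P" by (rule diff_mult_distrib)
        moreover have "(b - i) * Q = 0" using 3 by simp
        ultimately show ?thesis using \<open>i \<le> i * P\<close> by linarith
      next
        case 4
        have "(a - i) * P = a * P - i * P" "(b - i) * Q = b * Q - i * Q" by (rule diff_mult_distrib)+
        moreover have "i * P \<le> a * P" "i * Q \<le> b * Q" using 4 by simp_all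
        ultimately show ?thesis using \<open>i \<le> i * P\<close> by linarith
      qed
    qed
    then show ?thesis using A by linarith
  qed
  have "weight a * P + weight b * Q + K = K * (a * P + b * Q + 1) + ((a - i) * P + (b - i) * Q)"
    by (simp add: weight_def algebra_simps)
  then show ?thesis using 1 2 unfolding weight_def[of ?A] by linarith
qed

text \<open>
  For \<open>P = p\<^sup>b\<close> and \<open>Q = p\<^sup>c\<close> the bracket of \<open>u\<^sup>[\<^sup>p\<^sup>]\<^sup>b\<close> with \<open>v\<^sup>[\<^sup>p\<^sup>]\<^sup>c\<close> is, up to sign,
  \<open>ad(u)\<^sup>P\<^sup>-\<^sup>1 ad(v)\<^sup>Q u\<close>, hence a commutator without \<open>p\<close>-th powers.
\<close>

lemma bracket_D:
  assumes u: "u \<in> D m" and v: "v \<in> D n"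
  shows "bracket u v \<in> D (m + n + K)"
  using u
proof (induction rule: D_induct)
  case base
  then show ?case using subspace_0[OF subspace_D] by simp
next
  case (step c u b a w)
  have "bracket ((pmap ^^ b) u) v \<in> D (m + n + K)"
    using v
  proof (induction rule: D_induct)
    case base
    then show ?case using subspace_0[OF subspace_D] by simp
  next
    case (step c' v b' a' w')
    let ?P = "p ^ b" and ?Q = "p ^ b'"
    have P: "1 \<le> ?P" "1 \<le> ?Q" using char_pos by simp_all
    have "bracket ((pmap ^^ b') v) u \<in> layer (a + ?Q * (a' + 1))"
      unfolding bracket_pmap_iterate by (rule bracket_layer_iterate[OF step(1) \<open>u \<in> layer a\<close>])
    then have "bracket u ((pmap ^^ b') v) \<in> layer (a + ?Q * (a' + 1))"
      by (subst bracket_swap) (rule subspace_neg[OF subspace_layer])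
    then have "(bracket u ^^ (?P - 1)) (bracket u ((pmap ^^ b') v)) \<in> layer (a + ?Q * (a' + 1) + (?P - 1) * (a + 1))"
      by (rule bracket_layer_iterate[OF \<open>u \<in> layer a\<close>])
    also have "(bracket u ^^ (?P - 1)) (bracket u ((pmap ^^ b') v)) = bracket ((pmap ^^ b) u) ((pmap ^^ b') v)"
    proof -
      have e: "Suc (?P - 1) = ?P" using P(1) by simp
      have "bracket ((pmap ^^ b) u) ((pmap ^^ b') v) = (bracket u ^^ Suc (?P - 1)) ((pmap ^^ b') v)"
        unfolding e bracket_pmap_iterate ..
      then show ?thesis by (simp only: funpow_Suc_right o_apply)
    qed
    finally have "bracket ((pmap ^^ b) u) ((pmap ^^ b') v) \<in> D (m + n + K)"
    proof (rule layer_in_D)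
      have "m + n + K \<le> weight a * ?P + weight a' * ?Q + K"
        using \<open>m \<le> weight a * ?P\<close> step(2) by simp
      also have "\<dots> \<le> weight (a + ?Q * (a' + 1) + (?P - 1) * (a + 1))" by (rule weight_bracket[OF P])
      finally show "m + n + K \<le> weight (a + ?Q * (a' + 1) + (?P - 1) * (a + 1))" .
    qed
    then show ?case using step(4)
      by (simp add: bracket_add_right bracket_scale_right subspace_add[OF subspace_D] subspace_scale[OF subspace_D])
  qed
  then show ?case using step(4)
    by (simp add: bracket_add_left bracket_scale_left subspace_add[OF subspace_D] subspace_scale[OF subspace_D])
qed

lemma jacobson_coeff_D:
  assumes "u \<in> D n" "v \<in> D n"
  shows "jacobson_coeff bracket u v (Suc k) m \<in> D ((k + 2) * n + K)"
proof -
  have step: "jacobson_coeff bracket u v (Suc k) m \<in> D ((k + 2) * n + K)"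
    if "\<And>m. jacobson_coeff bracket u v k m \<in> D ((k + 1) * n)" for k m
  proof -
    have "bracket u (jacobson_coeff bracket u v k (m - 1)) \<in> D ((k + 2) * n + K)"
      "bracket v (jacobson_coeff bracket u v k m) \<in> D ((k + 2) * n + K)"
      using bracket_D[OF assms(1) that] bracket_D[OF assms(2) that] by (simp_all add: algebra_simps)
    then show ?thesis
      by (cases "m = 0") (simp_all add: subspace_add[OF subspace_D])
  qed
  have all: "jacobson_coeff bracket u v k m \<in> D ((k + 1) * n)" for k m
  proof (induction k arbitrary: m)
    case 0
    then show ?case using assms(1) subspace_0[OF subspace_D] by simp
  next
    case (Suc k)
    have "(Suc k + 1) * n \<le> (k + 2) * n + K" by simp
    then show ?case using step[OF Suc, of m] antimono_D by blast
  qed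
  then show ?thesis by (rule step)
qed

lemma pmap_add_D:
  assumes "u \<in> D n" "v \<in> D n"
  shows "pmap (u + v) - (pmap u + pmap v) \<in> D (p * n + K)"
proof -
  obtain q where q: "p - 1 = Suc q" "p = q + 2" using p_ge_2 by (metis Suc_1 Suc_diff_1 Suc_diff_le add_2_eq_Suc' diff_Suc_1 le_add_diff_inverse2 plus_1_eq_Suc)
  have "jacobson_s scale bracket p k u v \<in> D (p * n + K)" for k
    unfolding jacobson_s_eq q(1) using jacobson_coeff_D[OF assms, of q] unfolding q(2)[symmetric]
    by (rule subspace_scale[OF subspace_D])
  then show ?thesis unfolding pmap_add
    by (simp add: subspace_sum[OF subspace_D])
qed

lemma pmap_D:
  assumes "v \<in> D n"
  shows "pmap v \<in> D (p * n)"
  using assms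
proof (induction rule: D_induct)
  case base
  then show ?case using subspace_0[OF subspace_D] by simp
next
  case (step c u b a w)
  let ?u = "scale c ((pmap ^^ b) u)"
  have u: "?u \<in> D n" by (rule subspace_scale[OF subspace_D pmap_iterate_in_D[OF step(1,2)]])
  have "p * n \<le> weight a * p ^ Suc b" using step(2) by simp
  then have "(pmap ^^ Suc b) u \<in> D (p * n)" by (rule pmap_iterate_in_D[OF step(1)])
  then have 1: "pmap ?u \<in> D (p * n)" by (simp add: pmap_scale subspace_scale[OF subspace_D])
  have 2: "pmap (?u + w) - (pmap ?u + pmap w) \<in> D (p * n)"
    using pmap_add_D[OF u step(3)] antimono_D[of "p * n" "p * n + K"] by auto
  from subspace_add[OF subspace_D 2 subspace_add[OF subspace_D 1 step(4)]] show ?case by simp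
qed

lemma pmap_iterate_D: "v \<in> D n \<Longrightarrow> (pmap ^^ k) v \<in> D (n * p ^ k)"
proof (induction k)
  case (Suc k)
  then show ?case using pmap_D[of "(pmap ^^ k) v" "n * p ^ k"] by (simp add: mult.left_commute)
qed simp

text \<open>
  All terms of Jacobson's formula other than the \<open>p\<close>-th powers contain brackets, and these raise the
  weight by \<open>K\<close>.
\<close>

lemma pmap_iterate_add_D:
  assumes K: "1 \<le> K" and uv: "u \<in> D n" "v \<in> D n"
  shows "(pmap ^^ k) (u + v) - ((pmap ^^ k) u + (pmap ^^ k) v) \<in> D (n * p ^ k + 1)"
proof (induction k)
  case 0
  then show ?case using subspace_0[OF subspace_D] by simp
next
  case (Suc k)
  let ?N = "n * p ^ k"
  define w where "w = (pmap ^^ k) (u + v) - ((pmap ^^ k) u + (pmap ^^ k) v)"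
  let ?u = "(pmap ^^ k) u" and ?v = "(pmap ^^ k) v"
  have w: "w \<in> D (?N + 1)" unfolding w_def by (rule Suc)
  have w': "w \<in> D ?N" using w antimono_D[of ?N "?N + 1"] by auto
  have uv': "?u \<in> D ?N" "?v \<in> D ?N" using uv by (simp_all add: pmap_iterate_D)
  have le: "n * p ^ Suc k + 1 \<le> p * ?N + K" "n * p ^ Suc k + 1 \<le> p * (?N + 1)"
    using K p_ge_2 by (simp_all add: algebra_simps)
  have 1: "pmap (?u + ?v + w) - (pmap (?u + ?v) + pmap w) \<in> D (n * p ^ Suc k + 1)"
    using pmap_add_D[OF subspace_add[OF subspace_D uv'] w'] antimono_D[OF le(1)] by blast
  have 2: "pmap (?u + ?v) - (pmap ?u + pmap ?v) \<in> D (n * p ^ Suc k + 1)"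
    using pmap_add_D[OF uv'] antimono_D[OF le(1)] by blast
  have 3: "pmap w \<in> D (n * p ^ Suc k + 1)" using pmap_D[OF w] antimono_D[OF le(2)] by blast
  have "(pmap ^^ k) (u + v) = ?u + ?v + w" by (simp add: w_def)
  then have e: "(pmap ^^ Suc k) (u + v) - ((pmap ^^ Suc k) u + (pmap ^^ Suc k) v) =
     (pmap (?u + ?v + w) - (pmap (?u + ?v) + pmap w)) + (pmap (?u + ?v) - (pmap ?u + pmap ?v)) + pmap w"
    by simp
  show ?case unfolding e by (intro subspace_add[OF subspace_D] 1 2 3)
qed

end

sublocale commutator_weights \<subseteq> weight_filtration scale bracket p pmap D
proof
  show "subspace (D n)" for n by (rule subspace_D)
  show "m \<le> n \<Longrightarrow> D n \<subseteq> D m" for m n by (rule antimono_D)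
  show "bracket u v \<in> D (a + b)" if "u \<in> D a" "v \<in> D b" for u v a b
    using bracket_D[OF that] antimono_D[of "a + b" "a + b + K"] by auto
  show "u \<in> D a \<Longrightarrow> pmap u \<in> D (p * a)" for u a by (rule pmap_D)
qed

context commutator_weights begin

lemma comm_filt:
  assumes v: "v \<in> D n" and t: "t \<in> filt m"
  shows "comm t (free_gen v) \<in> filt (m + n + K)"
proof -
  have letter: "comm (free_gen u) (free_gen v) \<in> filt (k + n + K)" if "u \<in> D k" for u k
    by (rule filt_eqm[OF eqm_sym[OF two_sided_env_ideal env_bracket] free_gen_filt[OF bracket_D[OF that v]]])
  have word: "comm (gprod w) (free_gen v) \<in> filt (sum_list ns + n + K)"
    if "list_all2 (\<lambda>v m. v \<in> D m) w ns" for w ns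
    using that
  proof (induction rule: list_all2_induct)
    case Nil
    then show ?case by (simp add: comm_def pm.subspace_0[OF subspace_filt])
  next
    case (Cons u w k ns)
    have "heavy (sum_list ns) w" unfolding heavy_def using Cons(2) by blast
    then have "comm (free_gen u) (free_gen v) * gprod w \<in> filt ((k + n + K) + sum_list ns)"
      by (intro filt_mult letter[OF Cons(1)] gprod_filt)
    moreover have "free_gen u * comm (gprod w) (free_gen v) \<in> filt (k + (sum_list ns + n + K))"
      by (intro filt_mult free_gen_filt[OF Cons(1)] Cons(3))
    ultimately show ?case
      by (simp add: comm_mult_left pm.subspace_add[OF subspace_filt] add_ac)
  qed
  show ?thesis
    using t[unfolded filt_def]
  proof (induction rule: pm.span_induct_alt)
    case base
    then show ?case by (simp add: pm.subspace_0[OF subspace_filt])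
  next
    case (step c s t)
    have "comm s (free_gen v) \<in> filt (m + n + K)"
      using step(1)
    proof
      assume "s \<in> {gprod w |w. heavy m w}"
      then obtain w ns where w: "s = gprod w" "list_all2 (\<lambda>v m. v \<in> D m) w ns" "m \<le> sum_list ns"
        by (auto simp: heavy_def)
      then have "m + n + K \<le> sum_list ns + n + K" by simp
      then show ?thesis using word[OF w(2)] filt_antimono unfolding w(1) by blast
    next
      assume "s \<in> env_ideal"
      then show ?thesis using two_sided_comm[OF two_sided_env_ideal] env_ideal_filt by blast
    qed
    then show ?case using step(2)
      by (simp add: comm_add_left pm.subspace_add[OF subspace_filt] pm.subspace_scale[OF subspace_filt])
  qed
qed

end

section \<open>The lower bound\<close>

text \<open>
  The basis is built from the last member of the filtration backwards. Elements of \<open>E\<close> have different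
  levels, so each step has to include at most one of them.
\<close>

lemma (in vector_space) adapted_basis:
  assumes sub: "\<And>n. subspace (D n)" and anti: "\<And>m n. m \<le> n \<Longrightarrow> D n \<subseteq> D m" and top: "D M = {0}"
    and E: "\<And>v. v \<in> E \<Longrightarrow> v \<in> D (lv v) \<and> v \<notin> D (Suc (lv v))" and inj: "inj_on lv E"
  shows "\<exists>B. E \<subseteq> B \<and> independent B \<and> span B = UNIV \<and> (\<forall>n. D n \<subseteq> span (B \<inter> D n))"
proof -
  have "\<exists>B. independent B \<and> B \<subseteq> D (M - k) \<and> E \<inter> D (M - k) \<subseteq> B \<and>
    (\<forall>n\<ge>M - k. D n \<subseteq> span (B \<inter> D n))" if "k \<le> M" for k
    using that
  proof (induction k)
    case 0
    have "v \<notin> D M" if "v \<in> E" for v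
      using E[OF that] top subspace_0[OF sub] by auto
    then have "E \<inter> D M = {}" by blast
    moreover have "D n \<subseteq> span ({} \<inter> D n)" if "M \<le> n" for n
      using anti[OF that] top by simp
    ultimately show ?case by (intro exI[of _ "{}"]) (simp add: independent_empty)
  next
    case (Suc k)
    define n where "n = M - Suc k"
    have Sn: "M - k = Suc n" using Suc.prems by (simp add: n_def)
    obtain B where B: "independent B" "B \<subseteq> D (Suc n)" "E \<inter> D (Suc n) \<subseteq> B"
      "\<And>m. Suc n \<le> m \<Longrightarrow> D m \<subseteq> span (B \<inter> D m)"
      using Suc unfolding Sn by auto
    have Dn: "D (Suc n) \<subseteq> D n" by (rule anti) simp
    have spB: "span B \<subseteq> D (Suc n)" using B(2) by (rule span_minimal[OF _ sub])
    have lvn: "lv v = n" if "v \<in> E" "v \<in> D n" "v \<notin> D (Suc n)" for v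
    proof (rule ccontr)
      assume "lv v \<noteq> n"
      then consider "Suc (lv v) \<le> n" | "Suc n \<le> lv v" by linarith
      then show False
      proof cases
        case 1
        then show ?thesis using E[OF that(1)] subsetD[OF anti[OF 1] that(2)] by simp
      next
        case 2
        then show ?thesis using E[OF that(1)] subsetD[OF anti[OF 2]] that(3) by simp
      qed
    qed
    have "independent (B \<union> (E \<inter> D n))"
    proof (cases "E \<inter> D n \<subseteq> D (Suc n)")
      case True
      then have "B \<union> (E \<inter> D n) = B" using B(3) by blast
      then show ?thesis using B(1) by simp
    next
      case False
      then obtain v where v: "v \<in> E" "v \<in> D n" "v \<notin> D (Suc n)" by blast
      have "u \<in> insert v B" if u: "u \<in> E" "u \<in> D n" for u
      proof (cases "u \<in> D (Suc n)")
        case True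
        then show ?thesis using B(3) u by blast
      next
        case False
        have "lv u = lv v" using lvn[OF u False] lvn[OF v] by simp
        then show ?thesis using inj_onD[OF inj _ u(1) v(1)] by simp
      qed
      then have "B \<union> (E \<inter> D n) = insert v B" using v by blast
      moreover have "v \<notin> span B" using spB v(3) by blast
      ultimately show ?thesis using independent_insertI B(1) by simp
    qed
    note ind = this
    have "B \<union> (E \<inter> D n) \<subseteq> D n" using B(2) Dn by blast
    from maximal_independent_subset_extend[OF this ind]
    obtain C where C: "B \<union> (E \<inter> D n) \<subseteq> C" "C \<subseteq> D n" "independent C" "D n \<subseteq> span C" .
    have "D m \<subseteq> span (C \<inter> D m)" if "n \<le> m" for m
    proof (cases "m = n")
      case True
      have "C \<inter> D n = C" using C(2) by blast
      then show ?thesis using C(4) True by simp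
    next
      case False
      have "D m \<subseteq> span (B \<inter> D m)" by (rule B(4)) (use False that in simp)
      also have "\<dots> \<subseteq> span (C \<inter> D m)" by (rule span_mono) (use C(1) in blast)
      finally show ?thesis .
    qed
    moreover have "E \<inter> D n \<subseteq> C" using C(1) by simp
    ultimately show ?case using C(2,3) unfolding n_def by blast
  qed
  from this[of M] obtain B where B: "independent B" "E \<inter> D 0 \<subseteq> B" "\<And>n. D n \<subseteq> span (B \<inter> D n)" by auto
  have "E \<subseteq> B"
  proof
    fix v assume v: "v \<in> E"
    have "D (lv v) \<subseteq> D 0" by (rule anti) simp
    then have "v \<in> D 0" using E[OF v] by blast
    then show "v \<in> B" using B(2) v by blast
  qed
  moreover have "B \<subseteq> extend_basis B" by (rule extend_basis_superset[OF B(1)])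
  moreover have "D n \<subseteq> span (extend_basis B \<inter> D n)" for n
  proof -
    have "span (B \<inter> D n) \<subseteq> span (extend_basis B \<inter> D n)"
      using \<open>B \<subseteq> extend_basis B\<close> by (intro span_mono) blast
    then show ?thesis using B(3)[of n] by (rule order_trans[rotated])
  qed
  ultimately show ?thesis
    using independent_extend_basis[OF B(1)] span_extend_basis[OF B(1)]
    by (intro exI[of _ "extend_basis B"]) auto
qed

text \<open>
  The pair \<open>(i, j)\<close> maximises \<open>(i p\<^sup>j, i)\<close> lexicographically among the pairs for which some
  combination of commutators of length at least \<open>i + 1\<close> has a nonzero \<open>p\<^sup>j\<close>-th power.
  The slope \<open>K\<close> of the weight is chosen as the maximum \<open>i p\<^sup>j\<close> itself, as it has to dominate the correction terms in \<open>weight\<close>.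
\<close>

locale leading_commutators = commutator_weights scale bracket p pmap x y K i
  for scale :: "'f::field \<Rightarrow> 'a::ab_group_add \<Rightarrow> 'a" and bracket p pmap x y K i +
  fixes j :: nat
  assumes K_eq: "K = i * p ^ j" and i_pos: "1 \<le> i"
    and leading: "\<exists>u\<in>layer i. (pmap ^^ j) u \<noteq> 0"
    and maximal: "u \<in> layer a \<Longrightarrow> 1 \<le> a \<Longrightarrow> (pmap ^^ b) u \<noteq> 0 \<Longrightarrow> a * p ^ b < K \<or> a * p ^ b = K \<and> a \<le> i"
begin

lemma K_pos: "1 \<le> K"
  using i_pos char_pos by (simp add: K_eq)

lemma weight_le: "a \<le> i \<Longrightarrow> weight a = K * a"
  by (simp add: weight_def)

lemma layer_le_D: "u \<in> layer a \<Longrightarrow> u \<in> D (K * a)"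
  by (erule layer_in_D, unfold weight_def, linarith)

lemma layer_gt_D: "u \<in> layer a \<Longrightarrow> i < a \<Longrightarrow> u \<in> D (K * a + 1)"
  by (erule layer_in_D, unfold weight_def, linarith)

text \<open>
  If the \<open>p\<^sup>b\<close>-th power of a commutator of length \<open>a + 1\<close> has weight above \<open>K\<^sup>2\<close>, then
  \<open>a p\<^sup>b > i p\<^sup>j\<close>, or \<open>a p\<^sup>b = i p\<^sup>j\<close> and \<open>a > i\<close>. So it vanishes by maximality.
\<close>

lemma D_top: "D (K * K + 1) = {0}"
proof -
  have "v = 0" if "v \<in> D (K * K + 1)" for v
    using that
  proof (induction rule: D_induct)
    case (step c u b a w)
    have "(pmap ^^ b) u = 0"
    proof (rule ccontr)
      assume nz: "(pmap ^^ b) u \<noteq> 0"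
      have "1 \<le> a" using step(2) by (cases a) (simp_all add: weight_def)
      from maximal[OF step(1) this nz] show False
      proof
        assume "a * p ^ b = K \<and> a \<le> i"
        then have "weight a * p ^ b = K * K" by (simp add: weight_le)
        then show False using step(2) by simp
      next
        assume lt: "a * p ^ b < K"
        have "weight a * p ^ b \<le> K * (a * p ^ b) + a * p ^ b"
          unfolding weight_def by (simp add: algebra_simps)
        also have "\<dots> \<le> K * (K - 1) + (K - 1)"
          using lt by (intro add_mono mult_le_mono) simp_all
        also have "\<dots> < K * K + 1" using K_pos by (cases K) simp_all
        finally show False using step(2) by simp
      qed
    qed
    then show ?case using step(4) by simp
  qed simp
  then show ?thesis using subspace_0[OF subspace_D] by blast
qed

text \<open>
  The map \<open>u \<mapsto> u\<^sup>[\<^sup>p\<^sup>]\<^sup>j\<close> is additive on combinations of commutators of length at least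
  \<open>i + 1\<close>, because the error terms lie above the top weight. So it does not vanish on all left-normed commutators.
\<close>

lemma leading_word: "\<exists>g\<in>lword i. (pmap ^^ j) g \<noteq> 0"
proof (rule ccontr)
  assume "\<not> ?thesis"
  then have z: "(pmap ^^ j) g = 0" if "g \<in> lword i" for g using that by blast
  have "(pmap ^^ j) u = 0 \<and> u \<in> layer i" if "u \<in> layer i" for u
    using that
  proof (induction rule: layer_induct)
    case base
    then show ?case using subspace_0[OF subspace_layer] by simp
  next
    case (step c v w a)
    have v: "v \<in> layer i" using lword_layer[OF step(2)] layer_antimono[OF step(1)] by blast
    have v0: "(pmap ^^ j) v = 0"
    proof (cases "a = i")
      case True
      then show ?thesis using z step(2) by simp
    next
      case False
      show ?thesis
      proof (rule ccontr)
        assume "(pmap ^^ j) v \<noteq> 0"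
        from maximal[OF lword_layer[OF step(2)] _ this] have "a * p ^ j \<le> K" "a * p ^ j = K \<longrightarrow> a \<le> i"
          using step(1) i_pos by auto
        moreover have "i * p ^ j < a * p ^ j" using False step(1) char_pos by simp
        ultimately show False by (simp add: K_eq)
      qed
    qed
    have in_D: "scale c v \<in> D (K * i)" "w \<in> D (K * i)"
      using layer_le_D[OF v] layer_le_D[OF step(3)] by (simp_all add: subspace_scale[OF subspace_D])
    have KK: "K * i * p ^ j + 1 = K * K + 1" by (simp add: K_eq)
    have "(pmap ^^ j) (scale c v + w) - ((pmap ^^ j) (scale c v) + (pmap ^^ j) w) \<in> D (K * i * p ^ j + 1)"
      by (rule pmap_iterate_add_D[OF K_pos in_D])
    then have "(pmap ^^ j) (scale c v + w) = 0"
      unfolding KK D_top using v0 step(4) by (simp add: pmap_iterate_scale)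
    moreover have "scale c v + w \<in> layer i"
      by (rule subspace_add[OF subspace_layer subspace_scale[OF subspace_layer v] step(3)])
    ultimately show ?case by simp
  qed
  then show False using leading by blast
qed

lemma power_filt:
  assumes "g \<in> D n"
  shows "free_gen g ^ k \<in> filt (n * k)"
proof (induction k)
  case 0
  have "gprod [] \<in> filt 0" by (rule gprod_filt) (simp add: heavy_def exI[of _ "[]"])
  then show ?case by simp
next
  case (Suc k)
  show ?case unfolding power_Suc by (rule filt_mult_le[OF free_gen_filt[OF assms] Suc]) simp
qed

lemma comm_power_filt:
  assumes g: "g \<in> D n" and v: "bracket g v \<in> D (n + m)"
  shows "comm (free_gen g ^ k) (free_gen v) \<in> filt (n * k + m)"
proof (induction k)
  case 0
  then show ?case by (simp add: comm_def pm.subspace_0[OF subspace_filt])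
next
  case (Suc k)
  have "free_gen g * comm (free_gen g ^ k) (free_gen v) \<in> filt (n * Suc k + m)"
    by (rule filt_mult_le[OF free_gen_filt[OF g] Suc]) simp
  moreover have "comm (free_gen g) (free_gen v) \<in> filt (n + m)"
    by (rule filt_eqm[OF eqm_sym[OF two_sided_env_ideal env_bracket] free_gen_filt[OF v]])
  from filt_mult_le[OF this power_filt[OF g, of k]]
  have "comm (free_gen g) (free_gen v) * free_gen g ^ k \<in> filt (n * Suc k + m)" by simp
  ultimately show ?case unfolding power_Suc comm_mult_left by (rule pm.subspace_add[OF subspace_filt])
qed

lemma comm_product_filt:
  assumes u: "u \<in> D m" and v: "v \<in> D n" and t: "t \<in> filt a"
  shows "comm t (free_gen u * free_gen v) \<in> filt (a + m + n + K)"
  unfolding comm_mult_right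
proof (rule pm.subspace_add[OF subspace_filt])
  show "free_gen u * comm t (free_gen v) \<in> filt (a + m + n + K)"
    by (rule filt_mult_le[OF free_gen_filt[OF u] comm_filt[OF v t]]) simp
  show "comm t (free_gen u) * free_gen v \<in> filt (a + m + n + K)"
    by (rule filt_mult_le[OF comm_filt[OF u t] free_gen_filt[OF v]]) simp
qed

lemma letter_D: "l \<in> {x, y} \<Longrightarrow> l \<in> D 0"
  using layer_le_D[of l 0] lword_layer[of l 0] by simp

lemma bracket_leading_D:
  assumes "g \<in> layer i" "v \<in> layer a"
  shows "bracket g v \<in> D (K * i + (K * a + K + 1))"
  using layer_gt_D[OF bracket_layer[OF assms]] by (simp add: algebra_simps)

text \<open>
  In the following two lemmas \<open>g\<close> behaves like a central element, since a bracket of \<open>g\<close> raises the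
  weight by more than \<open>K\<close>.
\<close>

lemma power_bracket_letters:
  assumes g: "g \<in> layer i"
  shows "set ls \<subseteq> {x, y} \<Longrightarrow> u \<in> layer c \<Longrightarrow> t \<in> lcs n \<Longrightarrow>
    t - free_gen g ^ k * free_gen u \<in> filt (K * i * k + K * c + 1) \<Longrightarrow>
    \<exists>t'\<in>lcs (n + length ls).
      t' - free_gen g ^ k * free_gen (foldl bracket u ls) \<in> filt (K * i * k + K * (c + length ls) + 1)"
proof (induction ls arbitrary: u c t n)
  case Nil
  then show ?case by auto
next
  case (Cons l ls)
  let ?G = "free_gen g ^ k :: 'a free_mon \<Rightarrow>\<^sub>0 'f" and ?N = "K * i * k + K * Suc c + 1"
  have l: "l \<in> {x, y}" "set ls \<subseteq> {x, y}" using Cons.prems(1) by simp_all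
  have l0: "l \<in> layer 0" using lword_layer[of l 0] l(1) by simp
  have "comm (t - ?G * free_gen u) (free_gen l) \<in> filt (K * i * k + K * c + 1 + 0 + K)"
    by (rule comm_filt[OF letter_D[OF l(1)] Cons.prems(4)])
  then have 1: "comm (t - ?G * free_gen u) (free_gen l) \<in> filt ?N" by (simp add: algebra_simps)
  have 2: "comm ?G (free_gen l) * free_gen u \<in> filt ?N"
    by (rule filt_mult_le[OF comm_power_filt[OF layer_le_D[OF g] bracket_leading_D[OF g l0]]
          free_gen_filt[OF layer_le_D[OF Cons.prems(2)]]]) simp
  have "eqm env_ideal (?G * comm (free_gen u) (free_gen l)) (?G * free_gen (bracket u l))"
    by (intro eqm_mult eqm_refl eqm_sym[OF _ env_bracket] two_sided_env_ideal)
  then have 3: "?G * comm (free_gen u) (free_gen l) - ?G * free_gen (bracket u l) \<in> filt ?N"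
    using env_ideal_filt[of ?N] by (auto simp: eqm_def)
  have "comm t (free_gen l) - ?G * free_gen (bracket u l) = comm (t - ?G * free_gen u) (free_gen l)
      + comm ?G (free_gen l) * free_gen u
      + (?G * comm (free_gen u) (free_gen l) - ?G * free_gen (bracket u l))"
    by (simp add: comm_diff_left comm_mult_left)
  also have "\<dots> \<in> filt ?N" by (intro pm.subspace_add[OF subspace_filt] 1 2 3)
  finally have "\<exists>t'\<in>lcs (Suc n + length ls). t' - ?G * free_gen (foldl bracket (bracket u l) ls)
      \<in> filt (K * i * k + K * (Suc c + length ls) + 1)"
    by (rule Cons.IH[OF l(2) bracket_layer_letter[OF Cons.prems(2) l(1)] comm_in_lcs[OF Cons.prems(3)]])
  then show ?case by (simp del: lcs.simps)
qed

text \<open>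
  The leading term is that of \<open>g\<^sup>k [h, l s] = g\<^sup>k (g s + l [h, s])\<close>, where \<open>[h, s]\<close> is assumed to have
  high weight.
\<close>

lemma power_bracket_product:
  assumes g: "g = bracket h l" "h \<in> layer (i - 1)" "l \<in> {x, y}"
    and s: "s \<in> layer r" "bracket h s \<in> D (K * (i - 1) + K * r + K + 1)"
    and t: "t - free_gen g ^ k * free_gen h \<in> filt (K * i * k + K * (i - 1) + 1)"
  shows "comm t (free_gen l * free_gen s) - free_gen g ^ Suc k * free_gen s
    \<in> filt (K * i * Suc k + K * r + 1)"
proof -
  let ?G = "free_gen g ^ k :: 'a free_mon \<Rightarrow>\<^sub>0 'f" and ?N = "K * i * Suc k + K * r + 1"
  let ?h = "free_gen h :: 'a free_mon \<Rightarrow>\<^sub>0 'f" and ?l = "free_gen l :: 'a free_mon \<Rightarrow>\<^sub>0 'f"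
    and ?s = "free_gen s :: 'a free_mon \<Rightarrow>\<^sub>0 'f"
  have i: "K * (i - 1) + K = K * i" using i_pos by (cases i) simp_all
  have gi: "g \<in> layer i" using bracket_layer_letter[OF g(2,3)] i_pos by (simp add: g(1))
  have l0: "l \<in> layer 0" using lword_layer[of l 0] g(3) by simp
  note D = layer_le_D[OF gi] layer_le_D[OF g(2)] letter_D[OF g(3)] layer_le_D[OF s(1)]
  have G: "?G \<in> filt (K * i * k)" by (rule power_filt[OF D(1)])
  have "comm (t - ?G * ?h) (?l * ?s) \<in> filt (K * i * k + K * (i - 1) + 1 + 0 + K * r + K)"
    by (rule comm_product_filt[OF D(3,4) t])
  then have 1: "comm (t - ?G * ?h) (?l * ?s) \<in> filt ?N"
    by (rule subsetD[OF filt_antimono, rotated]) (use i in simp)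
  have "comm ?G ?s \<in> filt (K * i * k + (K * r + K + 1))"
    by (rule comm_power_filt[OF D(1) bracket_leading_D[OF gi s(1)]])
  from filt_mult_le[OF free_gen_filt[OF D(3)] this order_refl]
  have a: "?l * comm ?G ?s \<in> filt (0 + (K * i * k + (K * r + K + 1)))" .
  have "comm ?G ?l \<in> filt (K * i * k + (K * 0 + K + 1))"
    by (rule comm_power_filt[OF D(1) bracket_leading_D[OF gi l0]])
  from filt_mult_le[OF this free_gen_filt[OF D(4)], of "0 + (K * i * k + (K * r + K + 1))"]
  have b: "comm ?G ?l * ?s \<in> filt (0 + (K * i * k + (K * r + K + 1)))" by simp
  have "comm ?G (?l * ?s) \<in> filt (0 + (K * i * k + (K * r + K + 1)))"
    unfolding comm_mult_right by (rule pm.subspace_add[OF subspace_filt a b])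
  from filt_mult_le[OF this free_gen_filt[OF D(2)], of ?N]
  have 2: "comm ?G (?l * ?s) * ?h \<in> filt ?N" using i by simp
  have "comm ?h ?s \<in> filt (K * (i - 1) + K * r + K + 1)"
    by (rule filt_eqm[OF eqm_sym[OF two_sided_env_ideal env_bracket] free_gen_filt[OF s(2)]])
  from filt_mult_le[OF free_gen_filt[OF D(3)] this order_refl]
  have "?l * comm ?h ?s \<in> filt (0 + (K * (i - 1) + K * r + K + 1))" .
  from filt_mult_le[OF G this, of ?N]
  have 3: "?G * (?l * comm ?h ?s) \<in> filt ?N" using i by simp
  have "eqm env_ideal (?G * (comm ?h ?l * ?s)) (?G * (free_gen g * ?s))"
    unfolding g(1) by (intro eqm_mult eqm_refl eqm_sym[OF _ env_bracket] two_sided_env_ideal)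
  then have 4: "?G * (comm ?h ?l * ?s) - ?G * (free_gen g * ?s) \<in> filt ?N"
    using env_ideal_filt[of ?N] by (auto simp: eqm_def)
  have e: "free_gen g ^ Suc k * ?s = ?G * (free_gen g * ?s)"
    by (simp only: power_Suc2 mult.assoc)
  have "comm t (?l * ?s) = comm (t - ?G * ?h) (?l * ?s) + (?G * comm ?h (?l * ?s) + comm ?G (?l * ?s) * ?h)"
    by (simp add: comm_diff_left comm_mult_left[of ?G])
  then have "comm t (?l * ?s) - free_gen g ^ Suc k * ?s = comm (t - ?G * ?h) (?l * ?s)
      + comm ?G (?l * ?s) * ?h + ?G * (?l * comm ?h ?s) + (?G * (comm ?h ?l * ?s) - ?G * (free_gen g * ?s))"
    unfolding e comm_mult_right[of ?h] by (simp add: distrib_left)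
  also have "\<dots> \<in> filt ?N" by (intro pm.subspace_add[OF subspace_filt] 1 2 3 4)
  finally show ?thesis .
qed

text \<open>
  One cycle leads from \<open>g\<^sup>k s\<close> through brackets with the letters \<open>ls\<close> to \<open>g\<^sup>k h\<close>, and then by a bracket
  with \<open>l s\<close> to \<open>g\<^sup>k\<^sup>+\<^sup>1 s\<close>. The last bracket counts as \<open>r + 1\<close> steps since \<open>l s\<close> lies in \<open>lcs r\<close>, so
  a cycle makes \<open>i\<close> steps.
\<close>

lemma leading_monomial_in_lcs:
  assumes g: "g = bracket h l" "l \<in> {x, y}" and h: "h = foldl bracket s ls" "set ls \<subseteq> {x, y}"
    and len: "length ls + Suc r = i" and r: "r \<le> 1"
    and s: "s \<in> layer r" "bracket h s \<in> D (K * (i - 1) + K * r + K + 1)"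
    and s0: "s' \<in> lcs r" "eqm env_ideal s' (free_gen s)"
    and d0: "d' \<in> lcs r" "eqm env_ideal d' (free_gen l * free_gen s)"
  shows "\<exists>t\<in>lcs (i * Suc k - 1). t - free_gen g ^ k * free_gen h \<in> filt (K * i * k + K * (i - 1) + 1)"
proof -
  have fold: "foldl bracket u ls \<in> layer (c + length ls)" if "set ls \<subseteq> {x, y}" "u \<in> layer c" for u c ls
    using that
  proof (induction ls arbitrary: u c)
    case (Cons l ls)
    have "foldl bracket (bracket u l) ls \<in> layer (Suc c + length ls)"
      by (rule Cons.IH) (use Cons.prems bracket_layer_letter in auto)
    then show ?case by simp
  qed simp
  have il: "r + length ls = i - 1" using len by simp
  have hi: "h \<in> layer (i - 1)" using fold[OF h(2) s(1)] unfolding h(1)[symmetric] il .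
  have gi: "g \<in> layer i" using bracket_layer_letter[OF hi g(2)] i_pos by (simp add: g(1))
  \<comment> \<open>The first part of a cycle, also used once more at the very end.\<close>
  have to_h: "\<exists>t'\<in>lcs (i * Suc k - 1). t' - free_gen g ^ k * free_gen h \<in> filt (K * i * k + K * (i - 1) + 1)"
    if "t \<in> lcs (i * k + r)" "t - free_gen g ^ k * free_gen s \<in> filt (K * i * k + K * r + 1)" for t k
  proof -
    have "i * k + r + length ls = i * Suc k - 1" using len by simp
    then show ?thesis using power_bracket_letters[OF gi h(2) s(1) that] unfolding h(1)[symmetric] il by (simp only:)
  qed
  have "\<exists>t\<in>lcs (i * k + r). t - free_gen g ^ k * free_gen s \<in> filt (K * i * k + K * r + 1)"
  proof (induction k)
    case 0
    have "s' - free_gen s \<in> filt (K * r + 1)"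
      using s0(2) env_ideal_filt[of "K * r + 1"] by (auto simp: eqm_def)
    then show ?case using s0(1) by auto
  next
    case (Suc k)
    then obtain t where t: "t \<in> lcs (i * k + r)" "t - free_gen g ^ k * free_gen s \<in> filt (K * i * k + K * r + 1)"
      by (rule bexE)
    obtain t' where t': "t' \<in> lcs (i * Suc k - 1)"
      "t' - free_gen g ^ k * free_gen h \<in> filt (K * i * k + K * (i - 1) + 1)"
      using to_h[OF t] by (rule bexE)
    let ?N = "K * i * Suc k + K * r + 1"
    have 1: "comm t' (free_gen l * free_gen s) - free_gen g ^ Suc k * free_gen s \<in> filt ?N"
      by (rule power_bracket_product[OF g(1) hi g(2) s t'(2)])
    have "eqm env_ideal (comm t' d') (comm t' (free_gen l * free_gen s))"
      by (rule eqm_comm[OF two_sided_env_ideal eqm_refl[OF two_sided_env_ideal] d0(2)])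
    then have 2: "comm t' d' - comm t' (free_gen l * free_gen s) \<in> filt ?N"
      using env_ideal_filt[of ?N] by (auto simp: eqm_def)
    have 3: "comm t' d' - free_gen g ^ Suc k * free_gen s \<in> filt ?N"
      using pm.subspace_add[OF subspace_filt 2 1] by simp
    have idx: "i * Suc k - 1 + 1 = i * Suc k" using i_pos by simp
    have "comm t' d' \<in> lcs (i * Suc k + r)"
    proof (cases "r = 0")
      case True
      then show ?thesis using comm_in_lcs[OF t'(1), of d'] idx by (simp del: lcs.simps)
    next
      case False
      then have r1: "r = 1" using r by simp
      have "i * Suc k - 1 + 2 = i * Suc k + r" using idx r1 by simp
      then show ?thesis using comm_in_lcs_two[OF t'(1), of d'] d0(1) r1 by (simp only:)
    qed
    then show ?case using 3 by (rule bexI[rotated])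
  qed
  then show ?thesis using to_h by blast
qed

lemma sum_list_map_replicate_concat:
  "sum_list (map (f :: 'a \<Rightarrow> nat) (concat (map (\<lambda>v. replicate (k v) v) vs))) = (\<Sum>v\<leftarrow>vs. k v * f v)"
  by (induction vs) (simp_all add: sum_list_replicate)

text \<open>
  The powers \<open>g\<^sup>[\<^sup>p\<^sup>]\<^sup>a\<close> for \<open>a \<le> j\<close> and \<open>h\<close> have pairwise different weights, so they belong to a basis
  adapted to the filtration; hence \<open>g\<^sup>k h\<close> with \<open>k = p\<^sup>j\<^sup>+\<^sup>1 - 1\<close> is a basis monomial of the exact
  weight \<open>K i k + K (i - 1)\<close>.
\<close>

lemma leading_monomial_not_in_filt:
  assumes g: "g = bracket h l" "l \<in> {x, y}" "h \<in> layer (i - 1)" and nz: "(pmap ^^ j) g \<noteq> 0"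
  shows "free_gen g ^ (p ^ Suc j - 1) * free_gen h \<notin> filt (K * i * (p ^ Suc j - 1) + K * (i - 1) + 1)"
proof
  let ?N = "K * i * (p ^ Suc j - 1) + K * (i - 1) + 1"
  assume in_filt: "free_gen g ^ (p ^ Suc j - 1) * free_gen h \<in> filt ?N"
  have gi: "g \<in> D (K * i)" using layer_le_D[OF bracket_layer_letter[OF g(3,2)]] i_pos by (simp add: g(1))
  have hi: "h \<in> D (K * (i - 1))" by (rule layer_le_D[OF g(3)])
  have Ki: "K * (i - 1) + K = K * i" using i_pos by (cases i) simp_all
  have Kip: "1 \<le> K * i" using K_pos i_pos by simp
  define c where "c = (\<lambda>a. (pmap ^^ a) g)"
  have c1: "c a \<in> D (K * i * p ^ a)" for a unfolding c_def by (rule pmap_iterate_D[OF gi])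
  have c2: "c a \<notin> D (Suc (K * i * p ^ a))" if "a \<le> j" for a
  proof
    assume "c a \<in> D (Suc (K * i * p ^ a))"
    then have 1: "(pmap ^^ (j - a)) (c a) \<in> D (Suc (K * i * p ^ a) * p ^ (j - a))" by (rule pmap_iterate_D)
    have "(pmap ^^ (j - a)) (c a) = (pmap ^^ j) g" unfolding c_def
      using that by (metis (no_types, lifting) funpow_add le_add_diff_inverse2 o_apply)
    moreover have "K * K + 1 \<le> Suc (K * i * p ^ a) * p ^ (j - a)"
    proof -
      have "p ^ a * p ^ (j - a) = p ^ j" using that by (simp flip: power_add)
      then have "K * K = K * i * p ^ a * p ^ (j - a)" by (simp add: K_eq mult.assoc)
      moreover have "1 \<le> p ^ (j - a)" using char_pos by simp
      moreover have "Suc (K * i * p ^ a) * p ^ (j - a) = p ^ (j - a) + K * i * p ^ a * p ^ (j - a)" by simp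
      ultimately show ?thesis by linarith
    qed
    ultimately have "(pmap ^^ j) g \<in> D (K * K + 1)" using 1 D_antimono by auto
    then show False using nz D_top by simp
  qed
  have h2: "h \<notin> D (Suc (K * (i - 1)))"
  proof
    assume "h \<in> D (Suc (K * (i - 1)))"
    then have "g \<in> D (Suc (K * (i - 1)) + 0 + K)" unfolding g(1) by (rule bracket_D[OF _ letter_D[OF g(2)]])
    then have "g \<in> D (Suc (K * i))" using Ki by simp
    then show False using c2[of 0] by (simp add: c_def)
  qed
  define vs where "vs = map c [0..<Suc j] @ [h]"
  \<comment> \<open>The level of \<open>v\<close> is the index of the last member of the filtration that contains \<open>v\<close>.\<close>
  define lv where "lv = (\<lambda>v. if v = h then K * (i - 1) else (SOME n. v \<in> D n \<and> v \<notin> D (Suc n)))"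
  have level_unique: "m = n" if "v \<in> D m" "v \<notin> D (Suc m)" "v \<in> D n" "v \<notin> D (Suc n)" for v m n
  proof (rule ccontr)
    assume "m \<noteq> n"
    then consider "Suc m \<le> n" | "Suc n \<le> m" by linarith
    then show False
    proof cases
      case 1
      then show ?thesis using subsetD[OF D_antimono[OF 1] that(3)] that(2) by simp
    next
      case 2
      then show ?thesis using subsetD[OF D_antimono[OF 2] that(1)] that(4) by simp
    qed
  qed
  have level_lt: "K * (i - 1) < K * i * p ^ a" for a
  proof -
    have "K * (i - 1) < K * i" using Ki K_pos by linarith
    also have "K * i \<le> K * i * p ^ a" using char_pos by simp
    finally show ?thesis .
  qed
  have ch: "c a \<noteq> h" if "a \<le> j" for a
    using level_unique[OF c1 c2[OF that]] hi h2 level_lt[of a] by fastforce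
  have lvc: "lv (c a) = K * i * p ^ a" if "a \<le> j" for a
  proof -
    have "(SOME n. c a \<in> D n \<and> c a \<notin> D (Suc n)) = K * i * p ^ a"
      by (rule some_equality) (use c1 c2[OF that] level_unique in blast)+
    then show ?thesis using ch[OF that] by (simp add: lv_def)
  qed
  have lvh: "lv h = K * (i - 1)" by (simp add: lv_def)
  have "{0..<Suc j} = {..j}" by auto
  then have set_vs: "set vs = c ` {..j} \<union> {h}" by (simp add: vs_def del: upt_Suc)
  have lv: "v \<in> D (lv v) \<and> v \<notin> D (Suc (lv v))" if "v \<in> set vs" for v
    using that c1 c2 hi h2 unfolding set_vs by (auto simp: lvc lvh)
  have lv_inj: "a = b" if "a \<le> j" "b \<le> j" "lv (c a) = lv (c b)" for a b
  proof -
    have "K * i * p ^ a = K * i * p ^ b" using that lvc by simp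
    then have "p ^ a = p ^ b" using Kip by simp
    then show ?thesis using p_ge_2 by (simp add: power_inject_exp)
  qed
  have "inj_on c {..j}"
  proof (rule inj_onI)
    fix a b assume "a \<in> {..j}" "b \<in> {..j}" "c a = c b"
    then show "a = b" using lv_inj[of a b] by simp
  qed
  moreover have "h \<notin> c ` {..j}"
  proof
    assume "h \<in> c ` {..j}"
    then obtain a where "a \<le> j" "h = c a" by auto
    then show False using ch[of a] by simp
  qed
  ultimately have "distinct vs"
    unfolding vs_def distinct_append distinct_map set_map set_upt \<open>{0..<Suc j} = {..j}\<close> by simp
  have inj: "inj_on lv (set vs)"
  proof (rule inj_onI)
    fix u v assume uv: "u \<in> set vs" "v \<in> set vs" "lv u = lv v"
    have neq: "lv (c a) \<noteq> lv h" if "a \<le> j" for a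
      using level_lt[of a] lvc[OF that] lvh by simp
    from uv(1,2) consider "u = h" "v = h" | a where "a \<le> j" "u = c a" "v = h"
      | a where "a \<le> j" "u = h" "v = c a" | a b where "a \<le> j" "b \<le> j" "u = c a" "v = c b"
      unfolding set_vs by fast
    then show "u = v"
    proof cases
      case (2 a)
      then show ?thesis using neq[of a] uv(3) by simp
    next
      case (3 a)
      then show ?thesis using neq[of a] uv(3) by simp
    next
      case (4 a b)
      then show ?thesis using lv_inj[of a b] uv(3) by simp
    qed simp
  qed
  obtain B where B: "set vs \<subseteq> B" "independent B" "span B = UNIV" "\<And>n. D n \<subseteq> span (B \<inter> D n)"
    using adapted_basis[OF D_subspace D_antimono D_top lv inj] by blast
  define k where "k = (\<lambda>v. if v = h then 1 else p - 1 :: nat)"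
  let ?w = "concat (map (\<lambda>v. replicate (k v) v) vs)"
  have kc: "k (c a) = p - 1" if "a \<le> j" for a using ch[OF that] by (simp add: k_def)
  have geo: "(\<Sum>a<n. (p - 1) * p ^ a) = p ^ n - 1" for n
  proof (induction n)
    case (Suc n)
    have "1 \<le> p ^ n" using char_pos by simp
    then have "p ^ n - 1 + (p - 1) * p ^ n = p ^ Suc n - 1" using p_ge_2
      by (cases p) simp_all
    then show ?case using Suc by simp
  qed simp
  have "eqm env_ideal (gprod (concat (map (\<lambda>v. replicate (k v) v) (map c [0..<n])))) (free_gen g ^ (p ^ n - 1))"
    if "n \<le> Suc j" for n
    using that
  proof (induction n)
    case 0
    then show ?case by (simp add: eqm_refl[OF two_sided_env_ideal])
  next
    case (Suc n)
    have "eqm env_ideal (free_gen (c n) ^ (p - 1)) ((free_gen g ^ (p ^ n)) ^ (p - 1))"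
      unfolding c_def by (rule eqm_power[OF two_sided_env_ideal env_pmap_iterate])
    from eqm_mult[OF two_sided_env_ideal _ this] Suc
    have "eqm env_ideal (gprod (concat (map (\<lambda>v. replicate (k v) v) (map c [0..<n]))) * free_gen (c n) ^ (p - 1))
        (free_gen g ^ (p ^ n - 1) * (free_gen g ^ (p ^ n)) ^ (p - 1))" by simp
    moreover have "(free_gen g ^ (p ^ n - 1) * (free_gen g ^ (p ^ n)) ^ (p - 1) :: 'a free_mon \<Rightarrow>\<^sub>0 'f)
        = free_gen g ^ (p ^ Suc n - 1)"
    proof -
      have "p ^ n - 1 + p ^ n * (p - 1) = p ^ Suc n - 1" using geo[of n] geo[of "Suc n"] by (simp add: mult.commute)
      then show ?thesis by (simp only: power_mult[symmetric] power_add[symmetric])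
    qed
    ultimately show ?case using kc[of n] Suc.prems by (simp add: gprod_append gprod_replicate)
  qed
  from eqm_mult[OF two_sided_env_ideal this[OF order_refl] eqm_refl[OF two_sided_env_ideal, of "free_gen h"]]
  have "eqm env_ideal (gprod ?w) (free_gen g ^ (p ^ Suc j - 1) * free_gen h)"
    by (simp add: vs_def gprod_append k_def del: upt_Suc)
  then have "gprod ?w \<in> filt ?N" using in_filt by (rule filt_eqm)
  moreover have "k v < p" for v using p_ge_2 by (simp add: k_def)
  ultimately have "heavy ?N ?w" using heavy_monomial[OF B(2,3,4) \<open>distinct vs\<close> B(1)] by blast
  then obtain ns where ns: "list_all2 (\<lambda>v m. v \<in> D m) ?w ns" "?N \<le> sum_list ns" by (auto simp: heavy_def)
  have bound: "sum_list ns \<le> sum_list (map lv u)" if "list_all2 (\<lambda>v m. v \<in> D m) u ns" "set u \<subseteq> set vs" for u ns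
    using that
  proof (induction rule: list_all2_induct)
    case (Cons v u m ns)
    have "m \<le> lv v"
    proof (rule ccontr)
      assume "\<not> m \<le> lv v"
      then have "D m \<subseteq> D (Suc (lv v))" by (intro D_antimono) simp
      then show False using lv[of v] Cons by auto
    qed
    then show ?case using Cons by simp
  qed simp
  have "sum_list ns \<le> sum_list (map lv ?w)" by (rule bound[OF ns(1)]) auto
  also have "\<dots> = (\<Sum>v\<leftarrow>vs. k v * lv v)" by (rule sum_list_map_replicate_concat)
  also have "\<dots> = (\<Sum>a<Suc j. (p - 1) * (K * i * p ^ a)) + K * (i - 1)"
  proof -
    have "(\<Sum>v\<leftarrow>map c [0..<Suc j]. k v * lv v) = (\<Sum>a\<leftarrow>[0..<Suc j]. (p - 1) * (K * i * p ^ a))"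
      unfolding map_map o_def using kc lvc by (intro arg_cong[of _ _ sum_list] map_cong) (auto simp: less_Suc_eq_le)
    also have "\<dots> = (\<Sum>a<Suc j. (p - 1) * (K * i * p ^ a))"
      by (simp only: interv_sum_list_conv_sum_set_nat set_upt lessThan_atLeast0)
    finally have e: "(\<Sum>v\<leftarrow>map c [0..<Suc j]. k v * lv v) = (\<Sum>a<Suc j. (p - 1) * (K * i * p ^ a))" .
    have "(\<Sum>v\<leftarrow>vs. k v * lv v) = (\<Sum>v\<leftarrow>map c [0..<Suc j]. k v * lv v) + k h * lv h"
      unfolding vs_def by (simp only: map_append sum_list_append list.map sum_list_simps)
    then show ?thesis unfolding e by (simp add: k_def lvh)
  qed
  also have "(\<Sum>a<Suc j. (p - 1) * (K * i * p ^ a)) = K * i * (\<Sum>a<Suc j. (p - 1) * p ^ a)"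
    unfolding sum_distrib_left by (rule sum.cong) (simp_all add: mult_ac)
  also have "\<dots> = K * i * (p ^ Suc j - 1)" unfolding geo ..
  finally show False using ns(2) by simp
qed

lemma lword_foldl: "v \<in> lword (Suc a) \<Longrightarrow> \<exists>ls. v = foldl bracket (bracket x y) ls \<and> length ls = a \<and> set ls \<subseteq> {x, y}"
proof (induction a arbitrary: v)
  case 0
  then show ?case by (intro exI[of _ "[]"]) simp
next
  case (Suc a)
  then obtain u l where u: "v = bracket u l" "u \<in> lword (Suc a)" "l \<in> {x, y}" by auto
  obtain ls where "u = foldl bracket (bracket x y) ls" "length ls = a" "set ls \<subseteq> {x, y}"
    using Suc.IH[OF u(2)] by blast
  then show ?case using u by (intro exI[of _ "ls @ [l]"]) auto
qed

text \<open>
  For \<open>i = 1\<close> the cycle is \<open>x \<mapsto> [x, y x] = [x, y] x\<close>. For \<open>i \<ge> 2\<close> it starts from \<open>s = [x, y]\<close>; then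
  \<open>l s\<close> is a commutator for both letters, namely \<open>x [x, y] = [x, x y]\<close> and \<open>y [x, y] = [y x, y]\<close>, and
  \<open>[h, s]\<close> is a commutator of length \<open>i + 2\<close>.
\<close>

theorem lcs_not_in_env_ideal: "\<not> lcs (p * K - 1) \<subseteq> env_ideal"
proof
  assume contra: "lcs (p * K - 1) \<subseteq> env_ideal"
  note E = two_sided_env_ideal
  obtain g where g: "g \<in> lword i" "(pmap ^^ j) g \<noteq> 0" using leading_word by blast
  have idx: "i * Suc (p ^ Suc j - 1) - 1 = p * K - 1" using char_pos by (simp add: K_eq mult.left_commute)
  let ?k = "p ^ Suc j - 1"
  have fin: False if h: "g = bracket h l" "l \<in> {x, y}" "h \<in> layer (i - 1)"
    and ex: "\<exists>t\<in>lcs (i * Suc ?k - 1). t - free_gen g ^ ?k * free_gen h \<in> filt (K * i * ?k + K * (i - 1) + 1)" for h l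
  proof -
    obtain t where t: "t \<in> lcs (p * K - 1)" "t - free_gen g ^ ?k * free_gen h \<in> filt (K * i * ?k + K * (i - 1) + 1)"
      using ex unfolding idx by (rule bexE)
    have "t \<in> filt (K * i * ?k + K * (i - 1) + 1)" using t(1) contra env_ideal_filt by blast
    from pm.subspace_diff[OF subspace_filt this t(2)] leading_monomial_not_in_filt[OF h g(2)]
    show False by simp
  qed
  show False
  proof (cases "i = 1")
    case True
    have gxy: "g = bracket x y" using g(1) True by simp
    have x0: "x \<in> layer 0" by (rule lword_layer) simp
    have "bracket x x \<in> D (K * (i - 1) + K * 0 + K + 1)"
      unfolding bracket_self by (rule subspace_0[OF subspace_D])
    from leading_monomial_in_lcs[OF gxy _ _ _ _ _ x0 this _ eqm_refl[OF E] _ eqm_refl[OF E], of "[]"]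
    show False using fin[OF gxy] x0 True by simp
  next
    case False
    then obtain i' where i': "i = Suc (Suc i')" using i_pos by (metis One_nat_def Suc_le_D not0_implies_Suc)
    obtain h l where h: "h \<in> lword (Suc i')" "l \<in> {x, y}" "g = bracket h l"
      using g(1) unfolding i' by (rule lword_SucE)
    obtain ls where ls: "h = foldl bracket (bracket x y) ls" "length ls = i'" "set ls \<subseteq> {x, y}"
      using lword_foldl[OF h(1)] by blast
    let ?z = "bracket x y"
    have z1: "?z \<in> layer 1" by (rule lword_layer) simp
    have hl: "h \<in> layer (i - 1)" using lword_layer[OF h(1)] by (simp add: i')
    have "bracket h ?z \<in> D (K * (i + 1) + 1)"
      using layer_gt_D[OF bracket_layer[OF hl z1]] by (simp add: i')
    then have hz: "bracket h ?z \<in> D (K * (i - 1) + K * 1 + K + 1)" by (simp add: i' algebra_simps)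
    have s0: "comm (free_gen x) (free_gen y) \<in> (lcs 1 :: ('a free_mon \<Rightarrow>\<^sub>0 'f) set)"
      unfolding One_nat_def by (rule comm_in_lcs) simp
    have "\<exists>d'\<in>lcs 1. eqm env_ideal d' (free_gen l * free_gen ?z)"
    proof -
      have "free_gen l * comm (free_gen x) (free_gen y) \<in> (lcs 1 :: ('a free_mon \<Rightarrow>\<^sub>0 'f) set)"
      proof -
        consider "l = x" | "l = y" using h(2) by blast
        then show ?thesis
        proof cases
          case 1
          have "free_gen l * comm (free_gen x) (free_gen y) = (comm (free_gen x) (free_gen x * free_gen y) :: 'a free_mon \<Rightarrow>\<^sub>0 'f)"
            by (simp add: 1 comm_mult_right)
          then show ?thesis unfolding One_nat_def by (simp only:) (rule comm_in_lcs, simp)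
        next
          case 2
          have "free_gen l * comm (free_gen x) (free_gen y) = (comm (free_gen y * free_gen x) (free_gen y) :: 'a free_mon \<Rightarrow>\<^sub>0 'f)"
            by (simp add: 2 comm_mult_left)
          then show ?thesis unfolding One_nat_def by (simp only:) (rule comm_in_lcs, simp)
        qed
      qed
      moreover have "eqm env_ideal (free_gen l * comm (free_gen x) (free_gen y)) (free_gen l * free_gen ?z)"
        by (rule eqm_mult[OF E eqm_refl[OF E] eqm_sym[OF E env_bracket]])
      ultimately show ?thesis by (rule bexI[rotated])
    qed
    then obtain d' where d': "d' \<in> lcs 1" "eqm env_ideal d' (free_gen l * free_gen ?z)" by (rule bexE)
    have len: "length ls + Suc 1 = i" using ls(2) i' by simp
    show False
      by (rule fin[OF h(3,2) hl leading_monomial_in_lcs[OF h(3,2) ls(1,3) len order_refl z1 hz s0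
            eqm_sym[OF E env_bracket] d']])
  qed
qed

end

text \<open>
  Among the pairs \<open>(i, j)\<close> for which some combination of commutators of length at least \<open>i + 1\<close>
  in \<open>x\<close> and \<open>y\<close> has a nonzero \<open>p\<^sup>j\<close>-th power, one with maximal \<open>i p\<^sup>j\<close>, and then with maximal \<open>i\<close>, satisfies the assumptions of the
  preceding argument. The pair \<open>(1, r)\<close> competes, so \<open>i p\<^sup>j \<ge> p\<^sup>r\<close>.
\<close>

theorem (in restricted_lie_algebra) lcs_lower_bound:
  assumes n: "lcs n \<subseteq> env_ideal" and r: "(pmap ^^ r) (bracket x y) \<noteq> 0"
  shows "\<not> lcs (p ^ Suc r - 1) \<subseteq> env_ideal"
proof -
  \<comment> \<open>The layers depend on neither \<open>K\<close> nor \<open>i\<close>, so any values serve to study them first.\<close>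
  interpret w: commutator_weights scale bracket p pmap x y 0 0 ..
  have wgam: "v \<in> gam a" if "v \<in> w.lword a" for v a
    using that
  proof (induction a arbitrary: v)
    case (Suc a)
    obtain u l where "u \<in> w.lword a" "v = bracket u l" using Suc.prems by (rule w.lword_SucE)
    then show ?case unfolding gam.simps(2) using Suc.IH by (intro span_base) blast
  qed simp
  have gam0: "gam a \<subseteq> {0}" if "n \<le> a" for a
    using that
  proof (induction a rule: dec_induct)
    case base
    then show ?case using gam_eq_zero[OF n] by simp
  next
    case (step a)
    then show ?case unfolding gam.simps(2) by (intro span_minimal) auto
  qed
  have lay0: "v = 0" if "v \<in> w.layer a" "n \<le> a" for v a
    using that(1)
  proof (induction rule: w.layer_induct)
    case (step c u v a')
    have "u \<in> gam a'" by (rule wgam[OF step(2)])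
    then have "u = 0" using gam0[of a'] that(2) step(1) by auto
    then show ?case using step(4) by simp
  qed simp
  obtain d where d: "p_chain d derived_p" using p_chain_derived_p[OF n] by blast
  have sub: "subspace derived_p" using p_chain_restricted_ideal[OF d] by (simp add: restricted_ideal_def)
  have layd: "v \<in> derived_p" if v: "v \<in> w.layer a" and a: "1 \<le> a" for v a
    using v
  proof (induction rule: w.layer_induct)
    case base
    then show ?case by (rule subspace_0[OF sub])
  next
    case (step c u v a')
    then obtain a'' where "a' = Suc a''" using a by (cases a') auto
    then obtain u' l where "u = bracket u' l" using step(2) w.lword_SucE by metis
    then have "u \<in> derived_p" using bracket_in_derived_p by simp
    then show ?case using step(4) by (simp add: subspace_add[OF sub] subspace_scale[OF sub])
  qed
  have pd: "(pmap ^^ b) v = 0" if "v \<in> w.layer a" "1 \<le> a" "d \<le> b" for v a b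
  proof -
    have "(pmap ^^ b) v = (pmap ^^ (b - d)) ((pmap ^^ d) v)"
      using that(3) by (metis funpow_add le_add_diff_inverse2 o_apply)
    then show ?thesis using p_chain_nilpotent[OF d layd[OF that(1,2)]] by simp
  qed
  define S where "S = {(a, b). 1 \<le> a \<and> (\<exists>u\<in>w.layer a. (pmap ^^ b) u \<noteq> 0)}"
  have S1: "a < n \<and> b < d" if s: "(a, b) \<in> S" for a b
  proof -
    obtain u where u: "1 \<le> a" "u \<in> w.layer a" "(pmap ^^ b) u \<noteq> 0" using s by (auto simp: S_def)
    have "\<not> n \<le> a" using lay0[OF u(2)] u(3) by auto
    moreover have "\<not> d \<le> b" using pd[OF u(2,1)] u(3) by auto
    ultimately show ?thesis by simp
  qed
  have "S \<subseteq> {..<n} \<times> {..<d}" using S1 by auto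
  then have fin: "finite S" by (rule finite_subset) simp
  have "bracket x y \<in> w.layer 1" by (rule w.lword_layer) simp
  then have r1: "(1, r) \<in> S" using r by (auto simp: S_def)
  \<comment> \<open>Since \<open>a < n\<close> on \<open>S\<close>, this encodes the lexicographic order of \<open>(a p\<^sup>b, a)\<close>.\<close>
  define key where "key = (\<lambda>(a, b). a * p ^ b * n + a)"
  have "Max (key ` S) \<in> key ` S" using fin r1 by (intro Max_in) auto
  then obtain s where s: "Max (key ` S) = key s" "s \<in> S" by (rule imageE)
  obtain i j where "s = (i, j)" by (cases s)
  then have ij: "(i, j) \<in> S" "key (i, j) = Max (key ` S)" using s by simp_all
  have mx: "key s \<le> key (i, j)" if "s \<in> S" for s unfolding ij(2) using fin that by (intro Max_ge) auto
  have cmp: "a * p ^ b < i * p ^ j \<or> a * p ^ b = i * p ^ j \<and> a \<le> i" if "(a, b) \<in> S" for a b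
  proof -
    have le: "a * p ^ b * n + a \<le> i * p ^ j * n + i" using mx[OF that] by (simp add: key_def)
    have "i < n" using S1[OF ij(1)] by simp
    show ?thesis
    proof (rule ccontr)
      assume no: "\<not> ?thesis"
      then have "i * p ^ j < a * p ^ b \<or> a * p ^ b = i * p ^ j \<and> i < a" by linarith
      then show False
      proof
        assume "i * p ^ j < a * p ^ b"
        then have "(i * p ^ j + 1) * n \<le> a * p ^ b * n" by (intro mult_le_mono1) simp
        then show False using le \<open>i < n\<close> by simp
      next
        assume "a * p ^ b = i * p ^ j \<and> i < a"
        then show False using le by simp
      qed
    qed
  qed
  let ?K = "i * p ^ j"
  interpret v: commutator_weights scale bracket p pmap x y ?K i ..
  interpret l: leading_commutators scale bracket p pmap x y ?K i j
  proof
    show "1 \<le> i" using ij(1) by (simp add: S_def)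
    show "\<exists>u\<in>v.layer i. (pmap ^^ j) u \<noteq> 0" using ij(1) by (simp add: S_def)
    show "a * p ^ b < ?K \<or> a * p ^ b = ?K \<and> a \<le> i"
      if "u \<in> v.layer a" "1 \<le> a" "(pmap ^^ b) u \<noteq> 0" for u a b
      by (rule cmp) (use that in \<open>auto simp: S_def\<close>)
  qed simp
  have "p ^ r \<le> ?K" using cmp[OF r1] by auto
  then have "p ^ Suc r - 1 \<le> p * ?K - 1" by (simp add: diff_le_mono)
  then show ?thesis using l.lcs_not_in_env_ideal lcs_antimono by blast
qed

section \<open>Transfer to the quotient algebra\<close>

context restricted_lie_algebra begin

abbreviation "free_ring \<equiv> (ring_of_type_algebra :: ('a free_mon \<Rightarrow>\<^sub>0 'f) ring)"
abbreviation "env_alg \<equiv> restricted_env_alg scale bracket p pmap"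

lemma free_ring_simps [simp]:
  "carrier free_ring = UNIV" "a \<otimes>\<^bsub>free_ring\<^esub> b = a * b" "a \<oplus>\<^bsub>free_ring\<^esub> b = a + b"
  "\<zero>\<^bsub>free_ring\<^esub> = 0" "\<one>\<^bsub>free_ring\<^esub> = 1"
  by (simp_all add: ring_of_type_algebra_def)

lemma ring_free_ring: "ring free_ring"
proof -
  have "\<exists>b. a + b = 0 \<and> b + a = 0" for a :: "'a free_mon \<Rightarrow>\<^sub>0 'f"
    by (intro exI[of _ "- a"]) simp
  then show ?thesis
    unfolding ring_of_type_algebra_def
    by unfold_locales (auto simp: algebra_simps Units_def)
qed

lemma two_sided_iff_ideal: "ideal I free_ring \<longleftrightarrow> two_sided I"
proof
  assume I: "ideal I free_ring"
  note sub = ideal.axioms(1)[OF I]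
  show "two_sided I"
    unfolding two_sided_def
    using additive_subgroup.zero_closed[OF sub] additive_subgroup.a_closed[OF sub]
      ideal.I_l_closed[OF I] ideal.I_r_closed[OF I] by simp
next
  assume I: "two_sided I"
  have inv: "inv\<^bsub>add_monoid free_ring\<^esub> a = - a" for a
  proof -
    have "\<ominus>\<^bsub>free_ring\<^esub> a = - a"
      by (rule abelian_group.minus_equality[OF ring.is_abelian_group[OF ring_free_ring]]) simp_all
    then show ?thesis by (simp add: a_inv_def)
  qed
  show "ideal I free_ring"
  proof (rule idealI[OF ring_free_ring])
    show "subgroup I (add_monoid free_ring)"
    proof (rule subgroup.intro)
      show "inv\<^bsub>add_monoid free_ring\<^esub> a \<in> I" if "a \<in> I" for a
        unfolding inv by (rule two_sided_minus[OF I that])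
    qed (simp_all add: two_sided_zero[OF I] two_sided_add[OF I])
  qed (simp_all add: two_sided_mult_left[OF I] two_sided_mult_right[OF I])
qed

lemma genideal_eq: "genideal free_ring S = gen_ideal S"
  by (simp add: genideal_def gen_ideal_def two_sided_iff_ideal)

lemma ideal_env_ideal: "ideal env_ideal free_ring"
  by (simp add: two_sided_iff_ideal two_sided_env_ideal)

lemma ideal_subgroup_env_ideal: "abelian_subgroup env_ideal free_ring"
  by (rule abelian_subgroupI3[OF ideal.axioms(1)[OF ideal_env_ideal] ring.is_abelian_group[OF ring_free_ring]])

definition coset :: "('a free_mon \<Rightarrow>\<^sub>0 'f) \<Rightarrow> ('a free_mon \<Rightarrow>\<^sub>0 'f) set" where
  "coset t = env_ideal +>\<^bsub>free_ring\<^esub> t"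

lemma coset_eq: "coset t = {s. eqm env_ideal s t}"
proof -
  have "s \<in> coset t \<longleftrightarrow> (\<exists>h\<in>env_ideal. s = h + t)" for s
    unfolding coset_def a_r_coset_def r_coset_def by simp
  moreover have "(\<exists>h\<in>env_ideal. s = h + t) \<longleftrightarrow> eqm env_ideal s t" for s
    unfolding eqm_def by (metis add_diff_cancel_right' diff_add_cancel)
  ultimately show ?thesis by blast
qed

lemma coset_cong: "coset s = coset t \<longleftrightarrow> eqm env_ideal s t"
proof
  assume "coset s = coset t"
  moreover have "s \<in> coset s" by (simp add: coset_eq eqm_refl[OF two_sided_env_ideal])
  ultimately show "eqm env_ideal s t" by (simp add: coset_eq)
next
  assume st: "eqm env_ideal s t"
  have "eqm env_ideal u s \<longleftrightarrow> eqm env_ideal u t" for u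
    using eqm_trans[OF two_sided_env_ideal _ st, of u]
      eqm_trans[OF two_sided_env_ideal _ eqm_sym[OF two_sided_env_ideal st], of u] by (rule iffI)
  then show "coset s = coset t" by (simp add: coset_eq)
qed

lemma env_alg_carrier: "carrier env_alg = range coset"
  by (auto simp: restricted_env_alg_def Let_def ring.defs module.defs FactRing_def A_RCOSETS_def'
      genideal_eq env_ideal_def[symmetric] coset_def)

lemma env_alg_mult: "coset s \<otimes>\<^bsub>env_alg\<^esub> coset t = coset (s * t)"
  using ideal.rcoset_mult_add[OF ideal_env_ideal, of s t]
  by (simp add: restricted_env_alg_def Let_def ring.defs module.defs FactRing_def
      genideal_eq env_ideal_def[symmetric] coset_def)

lemma env_alg_add: "coset s \<oplus>\<^bsub>env_alg\<^esub> coset t = coset (s + t)"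
  using abelian_subgroup.a_rcos_sum[OF ideal_subgroup_env_ideal, of s t]
  by (simp add: restricted_env_alg_def Let_def ring.defs module.defs FactRing_def
      genideal_eq env_ideal_def[symmetric] coset_def)

lemma env_alg_zero: "\<zero>\<^bsub>env_alg\<^esub> = coset 0"
proof -
  have "coset 0 = env_ideal" by (simp add: coset_eq eqm_def)
  then show ?thesis
    by (simp add: restricted_env_alg_def Let_def ring.defs module.defs FactRing_def
        genideal_eq env_ideal_def[symmetric])
qed

lemma env_alg_smult: "c \<odot>\<^bsub>env_alg\<^esub> coset t = coset (scal c t)"
proof -
  have "c \<odot>\<^bsub>env_alg\<^esub> coset t = (\<Union>a\<in>coset t. coset (scal c a))"
    by (simp add: restricted_env_alg_def Let_def ring.defs module.defs FactRing_def
        genideal_eq env_ideal_def[symmetric] coset_def scal_def)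
  also have "\<dots> = coset (scal c t)"
  proof (rule UN_constant_eq)
    show "t \<in> coset t" by (simp add: coset_eq eqm_refl[OF two_sided_env_ideal])
    show "\<forall>a\<in>coset t. coset (scal c a) = coset (scal c t)"
      unfolding coset_cong by (intro ballI eqm_scal[OF two_sided_env_ideal]) (simp add: coset_eq)
  qed
  finally show ?thesis .
qed

lemma env_alg_minus: "coset s \<ominus>\<^bsub>env_alg\<^esub> coset t = coset (s - t)"
proof -
  have "\<ominus>\<^bsub>env_alg\<^esub> coset t = coset (- t)"
    unfolding a_inv_def m_inv_def
  proof (rule the_equality)
    show "coset (- t) \<in> carrier (add_monoid env_alg) \<and>
      coset t \<otimes>\<^bsub>add_monoid env_alg\<^esub> coset (- t) = \<one>\<^bsub>add_monoid env_alg\<^esub> \<and>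
      coset (- t) \<otimes>\<^bsub>add_monoid env_alg\<^esub> coset t = \<one>\<^bsub>add_monoid env_alg\<^esub>"
      by (simp add: env_alg_add env_alg_zero env_alg_carrier)
  next
    fix c assume "c \<in> carrier (add_monoid env_alg) \<and>
      coset t \<otimes>\<^bsub>add_monoid env_alg\<^esub> c = \<one>\<^bsub>add_monoid env_alg\<^esub> \<and>
      c \<otimes>\<^bsub>add_monoid env_alg\<^esub> coset t = \<one>\<^bsub>add_monoid env_alg\<^esub>"
    then obtain u where u: "c = coset u" "coset (t + u) = coset 0"
      by (auto simp: env_alg_carrier env_alg_add env_alg_zero)
    then have "eqm env_ideal u (- t)" by (simp add: coset_cong eqm_def add.commute)
    then show "c = coset (- t)" unfolding u(1) coset_cong .
  qed
  then show ?thesis by (simp add: a_minus_def env_alg_add)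
qed

lemma alg_commutator_coset: "alg_commutator env_alg (coset s) (coset t) = coset (comm s t)"
  by (simp add: alg_commutator_def env_alg_mult env_alg_minus comm_def)

lemma alg_span_coset: "alg_span env_alg (coset ` S) = coset ` pm.span S"
proof
  show "alg_span env_alg (coset ` S) \<subseteq> coset ` pm.span S"
  proof
    fix c assume "c \<in> alg_span env_alg (coset ` S)"
    then show "c \<in> coset ` pm.span S"
    proof (induction rule: alg_span.induct)
      case zero
      show ?case unfolding env_alg_zero by (intro imageI pm.span_zero)
    next
      case (add_scaled s v c)
      then obtain t u where t: "s = coset t" "t \<in> S" "v = coset u" "u \<in> pm.span S" by (elim imageE)
      have "scal c t + u \<in> pm.span S"
        by (rule pm.span_add[OF pm.span_scale[OF pm.span_base[OF t(2)]] t(4)])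
      then show ?case unfolding t(1,3) env_alg_smult env_alg_add by (rule imageI)
    qed
  qed
  have "coset t \<in> alg_span env_alg (coset ` S)" if "t \<in> pm.span S" for t
    using that
  proof (induction rule: pm.span_induct_alt)
    case base
    then show ?case using alg_span.zero[of env_alg] by (simp only: env_alg_zero)
  next
    case (step c s t)
    from alg_span.add_scaled[OF imageI[OF step(1)] step(2), of c]
    show ?case by (simp only: env_alg_smult env_alg_add)
  qed
  then show "coset ` pm.span S \<subseteq> alg_span env_alg (coset ` S)" by blast
qed

lemma commutator_space_coset:
  "commutator_space env_alg (coset ` U) (carrier env_alg) = coset ` pm.span {comm a b |a b. a \<in> U}"
proof -
  have "{alg_commutator env_alg c d |c d. c \<in> coset ` U \<and> d \<in> carrier env_alg} =
      coset ` {comm a b |a b. a \<in> U}"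
  proof (intro equalityI subsetI)
    fix z assume "z \<in> {alg_commutator env_alg c d |c d. c \<in> coset ` U \<and> d \<in> carrier env_alg}"
    then obtain a b where "z = alg_commutator env_alg (coset a) (coset b)" "a \<in> U"
      unfolding env_alg_carrier by fast
    then show "z \<in> coset ` {comm a b |a b. a \<in> U}" unfolding alg_commutator_coset by blast
  next
    fix z assume "z \<in> coset ` {comm a b |a b. a \<in> U}"
    then obtain a b where "z = coset (comm a b)" "a \<in> U" by fast
    then have "z = alg_commutator env_alg (coset a) (coset b)" "coset a \<in> coset ` U"
      "coset b \<in> carrier env_alg"
      by (simp_all add: alg_commutator_coset env_alg_carrier)
    then show "z \<in> {alg_commutator env_alg c d |c d. c \<in> coset ` U \<and> d \<in> carrier env_alg}"
      by (intro CollectI exI[of _ "coset a"] exI[of _ "coset b"] conjI)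
  qed
  then show ?thesis unfolding commutator_space_def by (simp only: alg_span_coset)
qed

lemma product_space_coset:
  "product_space env_alg (coset ` U) (carrier env_alg) = coset ` pm.span {c * d |c d. c \<in> U}"
proof -
  have "{c \<otimes>\<^bsub>env_alg\<^esub> d |c d. c \<in> coset ` U \<and> d \<in> carrier env_alg} = coset ` {c * d |c d. c \<in> U}"
  proof (intro equalityI subsetI)
    fix z assume "z \<in> {c \<otimes>\<^bsub>env_alg\<^esub> d |c d. c \<in> coset ` U \<and> d \<in> carrier env_alg}"
    then obtain a b where "z = coset a \<otimes>\<^bsub>env_alg\<^esub> coset b" "a \<in> U"
      unfolding env_alg_carrier by fast
    then show "z \<in> coset ` {c * d |c d. c \<in> U}" unfolding env_alg_mult by blast
  next
    fix z assume "z \<in> coset ` {c * d |c d. c \<in> U}"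
    then obtain a b where "z = coset (a * b)" "a \<in> U" by fast
    then have "z = coset a \<otimes>\<^bsub>env_alg\<^esub> coset b" "coset a \<in> coset ` U" "coset b \<in> carrier env_alg"
      by (simp_all add: env_alg_mult env_alg_carrier)
    then show "z \<in> {c \<otimes>\<^bsub>env_alg\<^esub> d |c d. c \<in> coset ` U \<and> d \<in> carrier env_alg}"
      by (intro CollectI exI[of _ "coset a"] exI[of _ "coset b"] conjI)
  qed
  then show ?thesis unfolding product_space_def by (simp only: alg_span_coset)
qed

lemma lower_central_coset: "lower_central env_alg n = coset ` lcs n"
proof (induction n)
  case (Suc n)
  show ?case unfolding lower_central.simps(2) lcs.simps(2) Suc by (rule commutator_space_coset)
qed (simp add: env_alg_carrier)

lemma upper_lie_power_coset: "upper_lie_power env_alg n = coset ` ulp n"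
proof (induction n)
  case (Suc n)
  show ?case
    unfolding upper_lie_power.simps(2) ulp.simps(2) Suc commutator_space_coset by (rule product_space_coset)
qed (simp add: env_alg_carrier)

lemma coset_image_zero:
  assumes "pm.subspace U"
  shows "coset ` U = {\<zero>\<^bsub>env_alg\<^esub>} \<longleftrightarrow> U \<subseteq> env_ideal"
proof -
  have z: "coset t = coset 0 \<longleftrightarrow> t \<in> env_ideal" for t by (simp add: coset_cong eqm_def)
  have "coset 0 \<in> coset ` U" by (rule imageI[OF pm.subspace_0[OF assms]])
  then have "coset ` U = {coset 0} \<longleftrightarrow> (\<forall>t\<in>U. coset t = coset 0)" by (auto simp del: singletonI)
  then show ?thesis unfolding env_alg_zero z subset_iff Ball_def .
qed

lemma lower_central_zero_iff: "lower_central env_alg n = {\<zero>\<^bsub>env_alg\<^esub>} \<longleftrightarrow> lcs n \<subseteq> env_ideal"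
  unfolding lower_central_coset by (rule coset_image_zero[OF subspace_lcs])

lemma upper_lie_power_zero_iff: "upper_lie_power env_alg n = {\<zero>\<^bsub>env_alg\<^esub>} \<longleftrightarrow> ulp n \<subseteq> env_ideal"
  unfolding upper_lie_power_coset by (rule coset_image_zero[OF subspace_ulp])

lemma one_not_in_env_ideal: "1 \<notin> env_ideal"
  using gprod_not_in_env_ideal_mod[OF restricted_ideal_zero, of "[]"] by (simp add: env_ideal_mod_zero)

theorem lie_class_bounds:
  assumes nil: "lie_nilpotent env_alg"
  shows "p ^ p_exponent pmap (bracket x y) \<le> lie_class env_alg"
    and "lie_class env_alg \<le> upper_lie_class env_alg"
    and "upper_lie_class env_alg \<le> p ^ dim derived_p"
proof -
  obtain n where n: "lcs n \<subseteq> env_ideal"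
    using nil by (auto simp: lie_nilpotent_def lower_central_zero_iff)
  obtain d where d: "p_chain d derived_p" using p_chain_derived_p[OF n] by blast
  have up: "ulp (p ^ d) \<subseteq> env_ideal" by (rule ulp_upper_bound[OF d bracket_in_derived_p])
  have lc: "lie_class env_alg = (LEAST n. lcs n \<subseteq> env_ideal)"
    by (simp add: lie_class_def lower_central_zero_iff)
  have uc: "upper_lie_class env_alg = (LEAST n. ulp n \<subseteq> env_ideal)"
    by (simp add: upper_lie_class_def upper_lie_power_zero_iff)
  show "upper_lie_class env_alg \<le> p ^ dim derived_p"
    unfolding uc p_chain_dim[OF d] by (rule Least_le[of "\<lambda>n. ulp n \<subseteq> env_ideal", OF up])
  have "ulp (upper_lie_class env_alg) \<subseteq> env_ideal"
    unfolding uc by (rule LeastI[of "\<lambda>n. ulp n \<subseteq> env_ideal", OF up])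
  then have "lcs (upper_lie_class env_alg) \<subseteq> env_ideal"
    by (rule order_trans[OF lcs_subset_ulp])
  then show "lie_class env_alg \<le> upper_lie_class env_alg"
    unfolding lc by (rule Least_le)
  have cl: "lcs (lie_class env_alg) \<subseteq> env_ideal"
    unfolding lc by (rule LeastI[of "\<lambda>n. lcs n \<subseteq> env_ideal", OF n])
  let ?e = "p_exponent pmap (bracket x y)"
  have "\<not> lcs (p ^ ?e - 1) \<subseteq> env_ideal"
  proof (cases ?e)
    case 0
    then show ?thesis using one_not_in_env_ideal by auto
  next
    case (Suc r)
    have "(pmap ^^ r) (bracket x y) \<noteq> 0"
    proof
      assume "(pmap ^^ r) (bracket x y) = 0"
      then have "?e \<le> r" unfolding p_exponent_def by (rule Least_le)
      then show False using Suc by simp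
    qed
    from lcs_lower_bound[OF n this] show ?thesis using Suc by simp
  qed
  then have "\<not> lie_class env_alg \<le> p ^ ?e - 1"
    using cl lcs_antimono by blast
  then show "p ^ ?e \<le> lie_class env_alg" by linarith
qed

end

theorem theorem5p3:
  fixes scale :: "'f::field \<Rightarrow> 'a::ab_group_add \<Rightarrow> 'a"
    and bracket :: "'a \<Rightarrow> 'a \<Rightarrow> 'a"
    and p :: nat
    and pmap :: "'a \<Rightarrow> 'a"
  assumes "restricted_lie_algebra scale bracket p pmap"
    and "lie_nilpotent (restricted_env_alg scale bracket p pmap)"
  shows "\<forall>x y.
      p ^ p_exponent pmap (bracket x y) \<le> lie_class (restricted_env_alg scale bracket p pmap) \<and>
      lie_class (restricted_env_alg scale bracket p pmap)
        \<le> upper_lie_class (restricted_env_alg scale bracket p pmap) \<and>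
      upper_lie_class (restricted_env_alg scale bracket p pmap)
        \<le> p ^ vector_space.dim scale
               (generated_restricted_subalgebra scale bracket pmap
                 (derived_subalgebra scale bracket))"
proof (intro allI conjI)
  interpret restricted_lie_algebra scale bracket p pmap by (rule assms(1))
  fix x y
  show "p ^ p_exponent pmap (bracket x y) \<le> lie_class (restricted_env_alg scale bracket p pmap)"
    by (rule lie_class_bounds(1)[OF assms(2)])
  show "lie_class (restricted_env_alg scale bracket p pmap)
        \<le> upper_lie_class (restricted_env_alg scale bracket p pmap)"
    by (rule lie_class_bounds(2)[OF assms(2)])
  show "upper_lie_class (restricted_env_alg scale bracket p pmap)
        \<le> p ^ dim (generated_restricted_subalgebra scale bracket pmap (derived_subalgebra scale bracket))"
    using lie_class_bounds(3)[OF assms(2)] by (simp add: derived_p_def)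
qed

end
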